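(* For pairs of communicating SR-machines the following problems are algorithmically undecidable: (a) given such a pair in which neither machine has a send cycle, is it deadlock-free? (b) given such a deadlock-free pair in which neither machine has a send cycle, does it have the bounded channel property? (c) given an affine such pair, is it deadlock-free? (d) given an affine such pair, does it have the bounded channel property?
   Context: A pair of communicating SR-machines is a CFSM protocol with communication graph having nodes $\{0,1\}$ and two edges $\alpha$ (from $0$ to $1$) and $\beta$ (from $1$ to $0$), disjoint finite message alphabets $M_\alpha,M_\beta$, and two finite state machines $F_j=(K_j,\Sigma_j,T_j,h_j)$, $j=0,1$, with $\Sigma_0=\{-b:b\in M_\alpha\}\cup\{+b:b\in M_\beta\}$, $\Sigma_1=\{-b:b\in M_\beta\}\cup\{+b:b\in M_\alpha\}$, $K_j$ finite, $h_j\in K_j$ initial, $T_j\subseteq K_j\times\Sigma_j\times K_j$ (transitions $p\xrightarrow{e}q$; $+b$ = receive, $-b$ = send; $p\xrightarrow{w}q$ means a directed path labelled $w$). A send state has no outgoing $+b$ transition, a receive state no outgoing $-b$ transition. $F_j$ is an SR-machine if every state is a send or a receive state, its transition diagram is strongly connected, and it is deterministic ($p\xrightarrow{e}q_1$, $p\xrightarrow{e}q_2$ imply $q_1=q_2$). Global states are $((p_0,p_1),(x_\alpha,x_\beta))$; initially $((h_0,h_1),(\lambda,\lambda))$. A step is a send (a machine performs $p\xrightarrow{-b}q$ and $b$ is appended to its output channel: $\alpha$ for $F_0$, $\beta$ for $F_1$) or a receive (a machine performs $p\xrightarrow{+b}q$ and $b$ is removed from the front of its input channel, which must begin with $b$);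 the other machine is unchanged. A global state is deadlocked if both components are receive states and both channels are empty; deadlock-free means no reachable deadlocked global state. Bounded channel property: $|x_\alpha|+|x_\beta|$ bounded over all reachable global states. $\pi_\alpha(w)$ (resp. $\pi_\beta(w)$) is the string of $M_\alpha$- (resp. $M_\beta$-) symbols in $w$, in order, signs removed; $\mathbf Z_j=\{(\pi_\alpha(w),\pi_\beta(w)): h_j\xrightarrow{w}h_j\}$; the pair is affine if $\mathbf Z_0=\mathbf Z_1$. A send cycle of $F_j$ is a directed cycle in its transition diagram all of whose labels are of the form $-b$. *)

theory Defs
  imports Main "HOL-Library.Nat_Bijection"
begin

datatype recf = Zf | Sf | Idf nat | Cnf recf "recf list" | Prf recf recf | Mnf recf

inductive rec_eval :: "recf \<Rightarrow> nat list \<Rightarrow> nat \<Rightarrow> bool" where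
  zero: "rec_eval Zf xs 0"
| succ: "rec_eval Sf (x # xs) (Suc x)"
| proj: "i < length xs \<Longrightarrow> rec_eval (Idf i) xs (xs ! i)"
| comp: "length ys = length gs \<Longrightarrow> (\<forall>i < length gs. rec_eval (gs ! i) xs (ys ! i))
          \<Longrightarrow> rec_eval f ys r \<Longrightarrow> rec_eval (Cnf f gs) xs r"
| pr0: "rec_eval f xs r \<Longrightarrow> rec_eval (Prf f g) (0 # xs) r"
| prS: "rec_eval (Prf f g) (n # xs) r \<Longrightarrow> rec_eval g (n # r # xs) r'
          \<Longrightarrow> rec_eval (Prf f g) (Suc n # xs) r'"
| mn: "rec_eval f (y # xs) 0 \<Longrightarrow> (\<forall>z < y. \<exists>v. rec_eval f (z # xs) v \<and> 0 < v)
          \<Longrightarrow> rec_eval (Mnf f) xs y"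

definition decidable_on :: "('a \<Rightarrow> nat) \<Rightarrow> ('a \<Rightarrow> bool) \<Rightarrow> ('a \<Rightarrow> bool) \<Rightarrow> bool" where
  "decidable_on code promise prop \<longleftrightarrow>
     (\<exists>f. \<forall>x. promise x \<longrightarrow> rec_eval f [code x] (if prop x then 1 else 0))"

datatype act = Snd nat | Rcv nat

fun msg :: "act \<Rightarrow> nat" where
  "msg (Snd b) = b" | "msg (Rcv b) = b"

fun is_send :: "act \<Rightarrow> bool" where
  "is_send (Snd b) = True" | "is_send (Rcv b) = False"

type_synonym fsm = "nat list \<times> (nat \<times> act \<times> nat) list \<times> nat"

definition states :: "fsm \<Rightarrow> nat set" where "states F = set (fst F)"
definition trans :: "fsm \<Rightarrow> (nat \<times> act \<times> nat) set" where "trans F = set (fst (snd F))"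
definition init :: "fsm \<Rightarrow> nat" where "init F = snd (snd F)"

inductive path :: "(nat \<times> act \<times> nat) set \<Rightarrow> nat \<Rightarrow> act list \<Rightarrow> nat \<Rightarrow> bool"
  for T where
  path_nil: "path T p [] p"
| path_cons: "(p, e, q) \<in> T \<Longrightarrow> path T q w r \<Longrightarrow> path T p (e # w) r"

definition send_state :: "fsm \<Rightarrow> nat \<Rightarrow> bool" where
  "send_state F p \<longleftrightarrow> (\<forall>b q. (p, Rcv b, q) \<notin> trans F)"

definition recv_state :: "fsm \<Rightarrow> nat \<Rightarrow> bool" where
  "recv_state F p \<longleftrightarrow> (\<forall>b q. (p, Snd b, q) \<notin> trans F)"

definition SR_machine :: "nat set \<Rightarrow> nat set \<Rightarrow> fsm \<Rightarrow> bool" where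
  "SR_machine Ms Mr F \<longleftrightarrow>
     init F \<in> states F \<and>
     (\<forall>(p, e, q) \<in> trans F. p \<in> states F \<and> q \<in> states F \<and>
         (case e of Snd b \<Rightarrow> b \<in> Ms | Rcv b \<Rightarrow> b \<in> Mr)) \<and>
     (\<forall>p \<in> states F. send_state F p \<or> recv_state F p) \<and>
     (\<forall>p \<in> states F. \<forall>q \<in> states F. \<exists>w. path (trans F) p w q) \<and>
     (\<forall>p e q1 q2. (p, e, q1) \<in> trans F \<longrightarrow> (p, e, q2) \<in> trans F \<longrightarrow> q1 = q2)"

type_synonym sr_pair = "nat list \<times> nat list \<times> fsm \<times> fsm"

definition Malpha :: "sr_pair \<Rightarrow> nat set" where "Malpha P = set (fst P)"
definition Mbeta :: "sr_pair \<Rightarrow> nat set" where "Mbeta P = set (fst (snd P))"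
definition F0 :: "sr_pair \<Rightarrow> fsm" where "F0 P = fst (snd (snd P))"
definition F1 :: "sr_pair \<Rightarrow> fsm" where "F1 P = snd (snd (snd P))"

definition SR_pair :: "sr_pair \<Rightarrow> bool" where
  "SR_pair P \<longleftrightarrow> Malpha P \<inter> Mbeta P = {} \<and>
     SR_machine (Malpha P) (Mbeta P) (F0 P) \<and> SR_machine (Mbeta P) (Malpha P) (F1 P)"

type_synonym gstate = "(nat \<times> nat) \<times> (nat list \<times> nat list)"

inductive gstep :: "sr_pair \<Rightarrow> gstate \<Rightarrow> gstate \<Rightarrow> bool" for P where
  send0: "(p0, Snd b, q0) \<in> trans (F0 P) \<Longrightarrow>
            gstep P ((p0, p1), (xa, xb)) ((q0, p1), (xa @ [b], xb))"
| recv0: "(p0, Rcv b, q0) \<in> trans (F0 P) \<Longrightarrow>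
            gstep P ((p0, p1), (xa, b # xb)) ((q0, p1), (xa, xb))"
| send1: "(p1, Snd b, q1) \<in> trans (F1 P) \<Longrightarrow>
            gstep P ((p0, p1), (xa, xb)) ((p0, q1), (xa, xb @ [b]))"
| recv1: "(p1, Rcv b, q1) \<in> trans (F1 P) \<Longrightarrow>
            gstep P ((p0, p1), (b # xa, xb)) ((p0, q1), (xa, xb))"

definition initial :: "sr_pair \<Rightarrow> gstate" where
  "initial P = ((init (F0 P), init (F1 P)), ([], []))"

definition reachable :: "sr_pair \<Rightarrow> gstate \<Rightarrow> bool" where
  "reachable P s \<longleftrightarrow> (gstep P)\<^sup>*\<^sup>* (initial P) s"

definition deadlocked :: "sr_pair \<Rightarrow> gstate \<Rightarrow> bool" where
  "deadlocked P s \<longleftrightarrow> recv_state (F0 P) (fst (fst s)) \<and> recv_state (F1 P) (snd (fst s))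
      \<and> fst (snd s) = [] \<and> snd (snd s) = []"

definition deadlock_free :: "sr_pair \<Rightarrow> bool" where
  "deadlock_free P \<longleftrightarrow> (\<forall>s. reachable P s \<longrightarrow> \<not> deadlocked P s)"

definition bounded_channel :: "sr_pair \<Rightarrow> bool" where
  "bounded_channel P \<longleftrightarrow>
     (\<exists>N. \<forall>s. reachable P s \<longrightarrow> length (fst (snd s)) + length (snd (snd s)) \<le> N)"

definition proj :: "nat set \<Rightarrow> act list \<Rightarrow> nat list" where
  "proj M w = map msg (filter (\<lambda>e. msg e \<in> M) w)"

definition Zset :: "sr_pair \<Rightarrow> fsm \<Rightarrow> (nat list \<times> nat list) set" where
  "Zset P F = {(proj (Malpha P) w, proj (Mbeta P) w) | w. path (trans F) (init F) w (init F)}"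

definition affine :: "sr_pair \<Rightarrow> bool" where
  "affine P \<longleftrightarrow> Zset P (F0 P) = Zset P (F1 P)"

definition has_send_cycle :: "fsm \<Rightarrow> bool" where
  "has_send_cycle F \<longleftrightarrow> (\<exists>p w. w \<noteq> [] \<and> list_all is_send w \<and> path (trans F) p w p)"

fun encode_act :: "act \<Rightarrow> nat" where
  "encode_act (Snd b) = 2 * b" | "encode_act (Rcv b) = 2 * b + 1"

definition encode_trans :: "nat \<times> act \<times> nat \<Rightarrow> nat" where
  "encode_trans t = prod_encode (fst t, prod_encode (encode_act (fst (snd t)), snd (snd t)))"

definition encode_fsm :: "fsm \<Rightarrow> nat" where
  "encode_fsm F = prod_encode (list_encode (fst F),
      prod_encode (list_encode (map encode_trans (fst (snd F))), snd (snd F)))"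

definition encode_pair :: "sr_pair \<Rightarrow> nat" where
  "encode_pair P = list_encode [list_encode (fst P), list_encode (fst (snd P)),
      encode_fsm (fst (snd (snd P))), encode_fsm (snd (snd (snd P)))]"

end

theory Submission
  imports Defs
begin

text \<open>
  A recursive decider \<open>D\<close> is refuted by diagonalisation: a pair of machines is built that computes \<open>D\<close>
  on the code of this very pair and then does the opposite of what \<open>D\<close> claims.

  The computation runs in the channels. \<open>F\<^sub>1\<close> echoes every letter, so the two channels form one circular
  queue; it holds the contents of counters, an unordered word closed by a marker, and \<open>F\<^sub>0\<close> rotates
  the queue once for each counter instruction. The input is produced by a chain of send states of \<open>F\<^sub>0\<close>.
  At the end \<open>F\<^sub>0\<close> echoes forever, or it drains the queue (a deadlock), or it doubles every letter
  (an unbounded channel).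

  For (a) and (b), strong connectivity comes for free from receive transitions for a letter
  that is never sent. For (c) and (d), each send state may also deviate from the simulation by sending
  any other letter, after which the machine sends and receives arbitrary words up to an end mark and
  starts again. Then both machines have the same loops, namely all sequences of pairs of words closed by
  end marks, whatever they simulate. The order of the actions after a deviation is chosen such that a
  deviation never deadlocks in (c) and never makes a channel grow in (d).
\<close>

section \<open>Recursive functions\<close>

text \<open>The decider has to be run on a code that describes, among other things, the chain
  producing this very input. The circle is broken without a recursion theorem: all parts of the pair
  that do not depend on the chain length are coded into one number \<open>k\<close>, the chain
  length is determined by this same \<open>k\<close>, and \<open>self_pair\<close> recomputes the
  code of the whole pair from \<open>k\<close> alone. So only the chain must be listed explicitly
  and recursively; the other lists may be arbitrary enumerations.

  A decider must answer only where the promise holds, so the promise has to be proved without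
  knowing that the simulation ends. In (b) this means excluding an empty queue at every moment,
  hence the requirement that a growing transducer never removes the marker.

  The sets compared by affinity record what is sent and what is received, not the interleaving. The
  order of sends and receives after a deviation is therefore free, and \<open>Flush\<close> and
  \<open>Block\<close> are two uses of this freedom with equal loops for both machines. That loops
  split into whole rounds depends on honest steps never returning to the initial state, which
  explains the separate initial states 7 of \<open>F0\<close> and 6 of \<open>F1\<close>.\<close>

definition recfn :: "nat \<Rightarrow> (nat list \<Rightarrow> nat) \<Rightarrow> bool" where
  "recfn n f \<longleftrightarrow> (\<exists>r. \<forall>xs. length xs = n \<longrightarrow> rec_eval r xs (f xs))"

lemma recfn_nth: "i < n \<Longrightarrow> recfn n (\<lambda>xs. xs ! i)"
  unfolding recfn_def by (rule exI[of _ "Idf i"]) (auto intro: rec_eval.proj)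

lemma recfn_comp1:
  assumes "recfn 1 (\<lambda>xs. h (xs ! 0))" "recfn n f"
  shows "recfn n (\<lambda>xs. h (f xs))"
proof -
  obtain r where r: "\<And>xs. length xs = 1 \<Longrightarrow> rec_eval r xs (h (xs ! 0))"
    using assms(1) unfolding recfn_def by blast
  obtain q where q: "\<And>xs. length xs = n \<Longrightarrow> rec_eval q xs (f xs)"
    using assms(2) unfolding recfn_def by blast
  have "rec_eval (Cnf r [q]) xs (h (f xs))" if "length xs = n" for xs
    using r[of "[f xs]"] q[OF that] by (intro rec_eval.comp[where ys = "[f xs]"]) auto
  then show ?thesis unfolding recfn_def by blast
qed

lemma recfn_comp2:
  assumes "recfn 2 (\<lambda>xs. h (xs ! 0) (xs ! 1))" "recfn n f" "recfn n g"
  shows "recfn n (\<lambda>xs. h (f xs) (g xs))"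
proof -
  obtain r where r: "\<And>xs. length xs = 2 \<Longrightarrow> rec_eval r xs (h (xs ! 0) (xs ! 1))"
    using assms(1) unfolding recfn_def by blast
  obtain q where q: "\<And>xs. length xs = n \<Longrightarrow> rec_eval q xs (f xs)"
    using assms(2) unfolding recfn_def by blast
  obtain p where p: "\<And>xs. length xs = n \<Longrightarrow> rec_eval p xs (g xs)"
    using assms(3) unfolding recfn_def by blast
  have "rec_eval (Cnf r [q, p]) xs (h (f xs) (g xs))" if "length xs = n" for xs
    using r[of "[f xs, g xs]"] q[OF that] p[OF that]
    by (intro rec_eval.comp[where ys = "[f xs, g xs]"]) (auto simp: less_Suc_eq nth_Cons')
  then show ?thesis unfolding recfn_def by blast
qed

lemma recfn_Suc: "recfn n f \<Longrightarrow> recfn n (\<lambda>xs. Suc (f xs))"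
proof -
  have "rec_eval Sf xs (Suc (xs ! 0))" if "length xs = 1" for xs
    using that by (cases xs) (auto intro: rec_eval.succ)
  then have "recfn 1 (\<lambda>xs. Suc (xs ! 0))" unfolding recfn_def by blast
  then show "recfn n f \<Longrightarrow> recfn n (\<lambda>xs. Suc (f xs))" by (rule recfn_comp1)
qed

lemma recfn_const: "recfn n (\<lambda>xs. c)"
proof (induction c)
  case 0
  then show ?case unfolding recfn_def by (auto intro: rec_eval.zero)
qed (rule recfn_Suc)

lemma recfn_prim:
  assumes "recfn n f" "recfn (Suc (Suc n)) g" "recfn n k"
  shows "recfn n (\<lambda>xs. rec_nat (f xs) (\<lambda>i r. g (i # r # xs)) (k xs))"
proof -
  obtain rf where rf: "\<And>xs. length xs = n \<Longrightarrow> rec_eval rf xs (f xs)"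
    using assms(1) unfolding recfn_def by blast
  obtain rg where rg: "\<And>xs. length xs = Suc (Suc n) \<Longrightarrow> rec_eval rg xs (g xs)"
    using assms(2) unfolding recfn_def by blast
  obtain rk where rk: "\<And>xs. length xs = n \<Longrightarrow> rec_eval rk xs (k xs)"
    using assms(3) unfolding recfn_def by blast
  have prim: "rec_eval (Prf rf rg) (m # xs) (rec_nat (f xs) (\<lambda>i r. g (i # r # xs)) m)"
    if "length xs = n" for m xs
    by (induction m) (auto intro!: rec_eval.pr0 rec_eval.prS rf rg simp: that)
  have "rec_eval (Cnf (Prf rf rg) (rk # map Idf [0..<n])) xs
      (rec_nat (f xs) (\<lambda>i r. g (i # r # xs)) (k xs))" if "length xs = n" for xs
    using prim[OF that, of "k xs"] rk[OF that]
    by (intro rec_eval.comp[where ys = "k xs # xs"])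
      (auto simp: that nth_Cons' intro!: rec_eval.proj)
  then show ?thesis unfolding recfn_def by blast
qed

lemma recfn_add: "recfn n f \<Longrightarrow> recfn n g \<Longrightarrow> recfn n (\<lambda>xs. f xs + g xs)"
proof -
  have *: "rec_nat a (\<lambda>i r. Suc r) b = a + b" for a b :: nat by (induction b) auto
  have "recfn 2 (\<lambda>xs. rec_nat (xs ! 0) (\<lambda>i r. (\<lambda>ys. Suc (ys ! 1)) (i # r # xs)) (xs ! 1))"
    by (intro recfn_prim recfn_nth recfn_Suc) auto
  then have "recfn 2 (\<lambda>xs. xs ! 0 + xs ! 1)" by (simp add: *)
  then show "recfn n f \<Longrightarrow> recfn n g \<Longrightarrow> recfn n (\<lambda>xs. f xs + g xs)" by (rule recfn_comp2)
qed

lemma recfn_pred: "recfn n f \<Longrightarrow> recfn n (\<lambda>xs. f xs - Suc 0)"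
proof -
  have *: "rec_nat 0 (\<lambda>i r. i) b = b - Suc 0" for b :: nat by (cases b) auto
  have "recfn 1 (\<lambda>xs. rec_nat 0 (\<lambda>i r. (\<lambda>ys. ys ! 0) (i # r # xs)) (xs ! 0))"
    by (intro recfn_prim recfn_nth recfn_const) auto
  then have "recfn 1 (\<lambda>xs. xs ! 0 - Suc 0)" by (simp add: *)
  then show "recfn n f \<Longrightarrow> recfn n (\<lambda>xs. f xs - Suc 0)" by (rule recfn_comp1)
qed

lemma recfn_diff: "recfn n f \<Longrightarrow> recfn n g \<Longrightarrow> recfn n (\<lambda>xs. f xs - g xs)"
proof -
  have *: "rec_nat a (\<lambda>i r. r - Suc 0) b = a - b" for a b :: nat by (induction b) auto
  have "recfn 2 (\<lambda>xs. rec_nat (xs ! 0) (\<lambda>i r. (\<lambda>ys. ys ! 1 - Suc 0) (i # r # xs)) (xs ! 1))"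
    by (intro recfn_prim recfn_nth recfn_pred) auto
  then have "recfn 2 (\<lambda>xs. xs ! 0 - xs ! 1)" by (simp add: *)
  then show "recfn n f \<Longrightarrow> recfn n g \<Longrightarrow> recfn n (\<lambda>xs. f xs - g xs)" by (rule recfn_comp2)
qed

text \<open>Primitive recursion whose step ignores the previous value is a test for zero. The step
  function sees two additional leading arguments, hence the variant of \<open>g\<close> on
  \<open>tl (tl ys)\<close>.\<close>

lemma recfn_if0:
  assumes "recfn n c" "recfn n f" "recfn n g"
  shows "recfn n (\<lambda>xs. if c xs = 0 then f xs else g xs)"
proof -
  have *: "rec_nat a (\<lambda>i r. b) c = (if c = 0 then a else b)" for a b c :: nat by (cases c) auto
  have "recfn (Suc (Suc n)) (\<lambda>ys. g (tl (tl ys)))"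
  proof -
    obtain rg where rg: "\<And>xs. length xs = n \<Longrightarrow> rec_eval rg xs (g xs)"
      using assms(3) unfolding recfn_def by blast
    have "rec_eval (Cnf rg (map (\<lambda>i. Idf (Suc (Suc i))) [0..<n])) ys (g (tl (tl ys)))"
      if "length ys = Suc (Suc n)" for ys
    proof (rule rec_eval.comp[where ys = "tl (tl ys)"], goal_cases)
      case 2
      have "rec_eval (Idf (Suc (Suc i))) ys (tl (tl ys) ! i)" if "i < n" for i
        using rec_eval.proj[of "Suc (Suc i)" ys] that \<open>length ys = _\<close> by (simp add: nth_tl)
      then show ?case by simp
    qed (use that rg in auto)
    then show ?thesis unfolding recfn_def by blast
  qed
  from recfn_prim[OF assms(2) this assms(1)] show ?thesis by (simp add: *)
qed

lemma recfn_triangle: "recfn n f \<Longrightarrow> recfn n (\<lambda>xs. triangle (f xs))"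
proof -
  have *: "rec_nat 0 (\<lambda>i r. r + Suc i) b = triangle b" for b :: nat by (induction b) auto
  have "recfn 1 (\<lambda>xs. rec_nat 0 (\<lambda>i r. (\<lambda>ys. ys ! 1 + Suc (ys ! 0)) (i # r # xs)) (xs ! 0))"
    by (intro recfn_prim recfn_nth recfn_const recfn_add recfn_Suc) auto
  then have "recfn 1 (\<lambda>xs. triangle (xs ! 0))" by (simp add: * del: add_Suc_right)
  then show "recfn n f \<Longrightarrow> recfn n (\<lambda>xs. triangle (f xs))" by (rule recfn_comp1)
qed

lemma recfn_prod_encode:
  "recfn n f \<Longrightarrow> recfn n g \<Longrightarrow> recfn n (\<lambda>xs. prod_encode (f xs, g xs))"
  unfolding prod_encode_def prod.case by (intro recfn_add recfn_triangle)

text \<open>The diagonal of Cantor's pairing on which \<open>z\<close> lies, that is, the greatest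
  \<open>d\<close> with \<open>triangle d \<le> z\<close>. The comparison is written as a truncated
  difference equal to 0, the form of test that \<open>recfn_if0\<close> covers.\<close>

definition diag_index :: "nat \<Rightarrow> nat" where
  "diag_index = rec_nat 0 (\<lambda>i r. if triangle (Suc r) - Suc i = 0 then Suc r else r)"

lemma diag_index_bounds: "triangle (diag_index z) \<le> z \<and> z < triangle (Suc (diag_index z))"
  by (induction z) (auto simp: diag_index_def)

lemma triangle_mono: "i \<le> j \<Longrightarrow> triangle i \<le> triangle j"
  by (induction j) (auto simp: le_Suc_eq)

lemma diag_index_prod_encode: "diag_index (prod_encode (a, b)) = a + b"
proof -
  let ?z = "prod_encode (a, b)" and ?d = "diag_index (prod_encode (a, b))"
  have z: "triangle (a + b) \<le> ?z" "?z < triangle (Suc (a + b))" by (auto simp: prod_encode_def)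
  have d: "triangle ?d \<le> ?z" "?z < triangle (Suc ?d)" using diag_index_bounds by auto
  have "\<not> ?d < a + b" using triangle_mono[of "Suc ?d" "a + b"] z d by auto
  moreover have "\<not> a + b < ?d" using triangle_mono[of "Suc (a + b)" ?d] z d by auto
  ultimately show ?thesis by simp
qed

definition pfst :: "nat \<Rightarrow> nat" where "pfst z = z - triangle (diag_index z)"
definition psnd :: "nat \<Rightarrow> nat" where "psnd z = diag_index z - pfst z"

lemma pfst_prod_encode [simp]: "pfst (prod_encode (a, b)) = a"
  by (simp add: pfst_def diag_index_prod_encode) (simp add: prod_encode_def)

lemma psnd_prod_encode [simp]: "psnd (prod_encode (a, b)) = b"
  by (simp add: psnd_def diag_index_prod_encode)

lemma recfn_diag_index: "recfn n f \<Longrightarrow> recfn n (\<lambda>xs. diag_index (f xs))"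
proof -
  have "recfn 1 (\<lambda>xs. rec_nat 0 (\<lambda>i r. (\<lambda>ys. if triangle (Suc (ys ! 1)) - Suc (ys ! 0) = 0
      then Suc (ys ! 1) else ys ! 1) (i # r # xs)) (xs ! 0))"
    by (intro recfn_prim recfn_nth recfn_const recfn_if0 recfn_diff recfn_triangle recfn_Suc) auto
  then have "recfn 1 (\<lambda>xs. diag_index (xs ! 0))"
    by (simp add: diag_index_def del: triangle_Suc cong: if_cong)
  then show "recfn n f \<Longrightarrow> recfn n (\<lambda>xs. diag_index (f xs))" by (rule recfn_comp1)
qed

lemma recfn_pfst: "recfn n f \<Longrightarrow> recfn n (\<lambda>xs. pfst (f xs))"
  unfolding pfst_def by (intro recfn_diff recfn_triangle recfn_diag_index)

lemma recfn_psnd: "recfn n f \<Longrightarrow> recfn n (\<lambda>xs. psnd (f xs))"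
  unfolding psnd_def by (intro recfn_diff recfn_diag_index recfn_pfst)

section \<open>Compiling recursive functions to counter programs\<close>

datatype com = INC nat | SEQ com com | LOOP nat com

inductive exec :: "com \<Rightarrow> (nat \<Rightarrow> nat) \<Rightarrow> (nat \<Rightarrow> nat) \<Rightarrow> bool" where
  exec_INC: "exec (INC r) s (s(r := Suc (s r)))"
| exec_SEQ: "exec c s s' \<Longrightarrow> exec d s' t \<Longrightarrow> exec (SEQ c d) s t"
| exec_LOOP0: "s r = 0 \<Longrightarrow> exec (LOOP r c) s s"
| exec_LOOPS: "s r = Suc m \<Longrightarrow> exec c (s(r := m)) s' \<Longrightarrow> exec (LOOP r c) s' t \<Longrightarrow> exec (LOOP r c) s t"

text \<open>In the commands below, \<open>t\<close> is a scratch register that is zero before and after execution.\<close>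

definition NOP :: "nat \<Rightarrow> com" where "NOP t = LOOP t (INC t)"
definition CLEAR :: "nat \<Rightarrow> nat \<Rightarrow> com" where "CLEAR a t = LOOP a (NOP t)"
definition MOVE :: "nat \<Rightarrow> nat \<Rightarrow> com" where "MOVE a b = LOOP a (INC b)"
definition COPY :: "nat \<Rightarrow> nat \<Rightarrow> nat \<Rightarrow> com" where
  "COPY a b t = SEQ (LOOP a (SEQ (INC b) (INC t))) (MOVE t a)"

lemma exec_SEQ_eq: "exec c s s' \<Longrightarrow> exec d s' t' \<Longrightarrow> t' = t \<Longrightarrow> exec (SEQ c d) s t"
  using exec_SEQ by blast

lemma exec_NOP: "s t = 0 \<Longrightarrow> exec (NOP t) s s"
  by (simp add: NOP_def exec_LOOP0)

lemma exec_CLEAR: "s t = 0 \<Longrightarrow> a \<noteq> t \<Longrightarrow> exec (CLEAR a t) s (s(a := 0))"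
proof (induction "s a" arbitrary: s)
  case 0
  then have "s(a := 0) = s" by auto
  then show ?case using 0 by (metis CLEAR_def exec_LOOP0)
next
  case (Suc m)
  have "exec (CLEAR a t) (s(a := m)) ((s(a := m))(a := 0))" using Suc by (intro Suc.hyps) auto
  then show ?case using Suc unfolding CLEAR_def
    by (intro exec_LOOPS[of s a m]) (auto intro!: exec_NOP)
qed

lemma exec_MOVE: "a \<noteq> b \<Longrightarrow> exec (MOVE a b) s (s(a := 0, b := s b + s a))"
proof (induction "s a" arbitrary: s)
  case 0
  then have "s(a := 0, b := s b + s a) = s" by auto
  then show ?case using 0 by (metis MOVE_def exec_LOOP0)
next
  case (Suc m)
  let ?s = "s(a := m, b := Suc (s b))"
  have "exec (MOVE a b) ?s (?s(a := 0, b := ?s b + ?s a))" using Suc by (intro Suc.hyps) auto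
  moreover have "?s(a := 0, b := ?s b + ?s a) = s(a := 0, b := s b + s a)"
    using Suc by (auto simp: fun_eq_iff)
  moreover have "exec (INC b) (s(a := m)) ?s"
    using exec_INC[of b "s(a := m)"] Suc.prems by simp
  ultimately show ?case using Suc unfolding MOVE_def by (metis exec_LOOPS)
qed

lemma exec_COPY:
  assumes "a \<noteq> b" "a \<noteq> t" "b \<noteq> t" "s t = 0"
  shows "exec (COPY a b t) s (s(b := s b + s a))"
proof -
  have *: "exec (LOOP a (SEQ (INC b) (INC t))) s (s(a := 0, b := s b + s a, t := s t + s a))" for s
  proof (induction "s a" arbitrary: s)
    case 0
    then have "s(a := 0, b := s b + s a, t := s t + s a) = s" by auto
    then show ?case using 0 by (metis exec_LOOP0)
  next
    case (Suc m)
    let ?s = "s(a := m, b := Suc (s b), t := Suc (s t))"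
    have "exec (LOOP a (SEQ (INC b) (INC t))) ?s (?s(a := 0, b := ?s b + ?s a, t := ?s t + ?s a))"
      using Suc assms by (intro Suc.hyps) auto
    moreover have "?s(a := 0, b := ?s b + ?s a, t := ?s t + ?s a) = s(a := 0, b := s b + s a, t := s t + s a)"
      using Suc assms by (auto simp: fun_eq_iff)
    moreover have "exec (SEQ (INC b) (INC t)) (s(a := m)) ?s"
      using exec_SEQ[OF exec_INC[of b "s(a := m)"] exec_INC[of t]] assms by simp
    ultimately show ?case using Suc by (metis exec_LOOPS)
  qed
  show ?thesis unfolding COPY_def
    by (rule exec_SEQ_eq[OF *[of s] exec_MOVE]) (use assms in \<open>auto simp: fun_eq_iff\<close>)
qed

text \<open>Calling convention: the code adds the result to register \<open>out\<close>; the registers from \<open>b\<close> on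
  are scratch, zero before and after execution.\<close>

fun eval_args :: "(nat list \<Rightarrow> nat \<Rightarrow> nat \<Rightarrow> com) list \<Rightarrow> nat list \<Rightarrow> nat \<Rightarrow> nat \<Rightarrow> com" where
  "eval_args [] as i b = NOP b"
| "eval_args (g # gs) as i b = SEQ (g as i b) (eval_args gs as (Suc i) b)"

fun clear_range :: "nat \<Rightarrow> nat \<Rightarrow> nat \<Rightarrow> com" where
  "clear_range i 0 t = NOP t"
| "clear_range i (Suc n) t = SEQ (CLEAR i t) (clear_range (Suc i) n t)"

primrec code_recf :: "recf \<Rightarrow> nat list \<Rightarrow> nat \<Rightarrow> nat \<Rightarrow> com" where
  "code_recf Zf = (\<lambda>as out b. NOP b)"
| "code_recf Sf = (\<lambda>as out b. SEQ (COPY (hd as) out b) (INC out))"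
| "code_recf (Idf i) = (\<lambda>as out b. COPY (as ! i) out b)"
| "code_recf (Cnf f gs) = (\<lambda>as out b. let m = length gs in
     SEQ (eval_args (map code_recf gs) as b (b + m))
       (SEQ (code_recf f [b..<b + m] out (b + m)) (clear_range b m (b + m))))"
| "code_recf (Prf f g) = (\<lambda>as out b.
     SEQ (COPY (hd as) b (b + 4))
       (SEQ (code_recf f (tl as) (b + 2) (b + 4))
         (SEQ (LOOP b
            (SEQ (code_recf g ((b + 1) # (b + 2) # tl as) (b + 3) (b + 4))
              (SEQ (CLEAR (b + 2) (b + 4)) (SEQ (MOVE (b + 3) (b + 2)) (INC (b + 1))))))
           (SEQ (MOVE (b + 2) out) (CLEAR (b + 1) (b + 4))))))"
| "code_recf (Mnf f) = (\<lambda>as out b.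
     SEQ (code_recf f (b # as) (b + 1) (b + 2))
       (SEQ (LOOP (b + 1) (SEQ (CLEAR (b + 1) (b + 2))
              (SEQ (INC b) (code_recf f (b # as) (b + 1) (b + 2)))))
         (MOVE b out)))"

text \<open>Only convergent evaluations are described: the compiled code is run solely on an input
  where the decider has a value. Since the result is added to \<open>out\<close>, the condition
  \<open>out \<notin> set as\<close> is what leaves the arguments intact.\<close>

definition correct_code :: "recf \<Rightarrow> (nat list \<Rightarrow> nat \<Rightarrow> nat \<Rightarrow> com) \<Rightarrow> bool" where
  "correct_code f c \<longleftrightarrow> (\<forall>as out b s v. rec_eval f (map s as) v \<longrightarrow> set as \<subseteq> {..<b} \<longrightarrow> out < b \<longrightarrow>
     out \<notin> set as \<longrightarrow> (\<forall>r\<ge>b. s r = 0) \<longrightarrow> exec (c as out b) s (s(out := s out + v)))"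

lemma correct_codeD:
  "correct_code f c \<Longrightarrow> rec_eval f xs v \<Longrightarrow> xs = map s as \<Longrightarrow> set as \<subseteq> {..<b} \<Longrightarrow> out < b \<Longrightarrow>
   out \<notin> set as \<Longrightarrow> (\<And>r. r \<ge> b \<Longrightarrow> s r = 0) \<Longrightarrow> t = s(out := s out + v) \<Longrightarrow> exec (c as out b) s t"
  unfolding correct_code_def by blast

lemma exec_clear_range:
  "i + n \<le> t \<Longrightarrow> s t = 0 \<Longrightarrow>
   exec (clear_range i n t) s (\<lambda>r. if i \<le> r \<and> r < i + n then 0 else s r)"
proof (induction n arbitrary: i s)
  case 0
  moreover have "(\<lambda>r. if i \<le> r \<and> r < i + 0 then 0 else s r) = s" by auto
  ultimately show ?case by (simp add: exec_NOP)
next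
  case (Suc n)
  show ?case unfolding clear_range.simps
    by (rule exec_SEQ_eq[OF exec_CLEAR Suc.IH]) (use Suc.prems in \<open>auto simp: fun_eq_iff\<close>)
qed

text \<open>During the induction \<open>i0\<close> stays fixed while \<open>i\<close> moves: the
  registers from \<open>i0\<close> up to \<open>i\<close> hold the results already computed, and all
  arguments lie below \<open>i0\<close>, so no argument is overwritten.\<close>

lemma exec_eval_args:
  assumes "list_all2 correct_code fs gs" "length vs = length fs"
    "\<forall>i<length fs. rec_eval (fs ! i) (map s as) (vs ! i)"
    "set as \<subseteq> {..<i0}" "i0 + length fs \<le> b" "\<And>r. r \<ge> i0 \<Longrightarrow> s r = 0 \<or> r < i"  "i0 \<le> i"
    "i + length fs = b"
  shows "exec (eval_args gs as i b) s (\<lambda>r. if i \<le> r \<and> r < b then vs ! (r - i) else s r)"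
  using assms
proof (induction fs gs arbitrary: i s vs rule: list_all2_induct)
  case Nil
  then have "exec (NOP b) s s" by (intro exec_NOP) force
  moreover have "(\<lambda>r. if i \<le> r \<and> r < b then vs ! (r - i) else s r) = s" using Nil by auto
  ultimately show ?case by simp
next
  case (Cons f fs g gs)
  obtain v vs' where vs: "vs = v # vs'" using Cons.prems by (cases vs) auto
  have v: "rec_eval f (map s as) v" using Cons.prems(2) vs by force
  let ?s = "s(i := s i + v)"
  have as: "map ?s as = map s as" using Cons.prems by (intro map_cong) auto
  have "s i = 0" using Cons.prems(5)[of i] Cons.prems by auto
  have 1: "exec (g as i b) s ?s"
  proof (rule correct_codeD[OF Cons.hyps(1) v refl _ _ _ _ refl])
    show "s r = 0" if "r \<ge> b" for r using Cons.prems(5)[of r] Cons.prems(4,6,7) that by auto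
  qed (use Cons.prems(3-7) in auto)
  have 2: "exec (eval_args gs as (Suc i) b) ?s (\<lambda>r. if Suc i \<le> r \<and> r < b then vs' ! (r - Suc i) else ?s r)"
  proof (rule Cons.IH)
    show "\<forall>j<length fs. rec_eval (fs ! j) (map ?s as) (vs' ! j)"
      using Cons.prems(2) unfolding as vs by auto
    show "?s r = 0 \<or> r < Suc i" if "r \<ge> i0" for r
      using Cons.prems(5)[OF that] by auto
  qed (use Cons.prems vs in auto)
  show ?case unfolding eval_args.simps
    by (rule exec_SEQ_eq[OF 1 2]) (use \<open>s i = 0\<close> Cons.prems in \<open>auto simp: fun_eq_iff vs nth_Cons' Suc_diff_Suc\<close>)
qed

lemma rec_eval_Prf_inv: "rec_eval (Prf f g) (n # xs) v \<Longrightarrow>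
  (n = 0 \<and> rec_eval f xs v) \<or>
  (\<exists>m r. n = Suc m \<and> rec_eval (Prf f g) (m # xs) r \<and> rec_eval g (m # r # xs) v)"
  by (erule rec_eval.cases) auto

text \<open>Unfolds the derivation into the sequence of intermediate values, from which the loop
  invariant of the compiled recursion is read off.\<close>

lemma rec_eval_Prf_trace:
  assumes "rec_eval (Prf f g) (n # xs) v"
  obtains r where "rec_eval f xs (r 0)" "r n = v" "\<And>i. i < n \<Longrightarrow> rec_eval g (i # r i # xs) (r (Suc i))"
  using assms
proof (induction n arbitrary: v thesis)
  case 0
  then show ?case using rec_eval_Prf_inv[OF 0(2)] 0(1)[of "\<lambda>_. v"] by auto
next
  case (Suc n)
  obtain r' where r': "rec_eval (Prf f g) (n # xs) r'" "rec_eval g (n # r' # xs) v"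
    using rec_eval_Prf_inv[OF Suc.prems(2)] by auto
  obtain r where r: "rec_eval f xs (r 0)" "r n = r'"
      "\<And>i. i < n \<Longrightarrow> rec_eval g (i # r i # xs) (r (Suc i))"
    using Suc.IH[OF _ r'(1)] by blast
  show ?case
    by (rule Suc.prems(1)[of "r(Suc n := v)"]) (use r r' in \<open>auto simp: less_Suc_eq\<close>)
qed

lemma correct_code_recf: "correct_code f (code_recf f)"
proof (induction f)
  case Zf
  have "v = 0" if "rec_eval Zf xs v" for xs v using that by (auto elim: rec_eval.cases)
  then show ?case unfolding correct_code_def by (force intro!: exec_NOP)
next
  case Sf
  show ?case unfolding correct_code_def
  proof (intro allI impI, goal_cases)
    case (1 as out b s v)
    then obtain a as' where as: "as = a # as'" "v = Suc (s a)" by (auto elim: rec_eval.cases)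
    show ?case unfolding code_recf.simps as
      by (rule exec_SEQ_eq[OF exec_COPY exec_INC]) (use 1 as in \<open>auto simp: fun_eq_iff\<close>)
  qed
next
  case (Idf i)
  show ?case unfolding correct_code_def
  proof (intro allI impI, goal_cases)
    case (1 as out b s v)
    then have i: "i < length as" "v = s (as ! i)" by (auto elim: rec_eval.cases)
    then have "as ! i \<in> set as" by simp
    then have "as ! i < b" "as ! i \<noteq> out" using 1(2,4) by auto
    then show ?case unfolding code_recf.simps i using 1 by (intro exec_COPY) auto
  qed
next
  case (Cnf f gs)
  show ?case unfolding correct_code_def
  proof (intro allI impI, goal_cases)
    case (1 as out b s v)
    let ?m = "length gs"
    from 1(1) obtain ys where ys: "length ys = ?m" "\<forall>i<?m. rec_eval (gs ! i) (map s as) (ys ! i)"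
      "rec_eval f ys v" by (auto elim: rec_eval.cases)
    let ?s = "\<lambda>r. if b \<le> r \<and> r < b + ?m then ys ! (r - b) else s r"
    let ?t = "?s(out := ?s out + v)"
    have "list_all2 correct_code gs (map code_recf gs)"
      using Cnf.IH(2) by (simp add: list_all2_conv_all_nth)
    then have e1: "exec (eval_args (map code_recf gs) as b (b + ?m)) s ?s"
      by (rule exec_eval_args[where ?i0.0 = b]) (use 1 ys in auto)
    have e2: "exec (code_recf f [b..<b + ?m] out (b + ?m)) ?s ?t"
      by (rule correct_codeD[OF Cnf.IH(1) ys(3)])
        (use 1 ys in \<open>auto intro!: nth_equalityI\<close>)
    have e3: "exec (clear_range b ?m (b + ?m)) ?t (\<lambda>r. if b \<le> r \<and> r < b + ?m then 0 else ?t r)"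
      using 1 by (intro exec_clear_range) auto
    show ?case unfolding code_recf.simps Let_def
      by (rule exec_SEQ_eq[OF e1 exec_SEQ[OF e2 e3]]) (use 1 in \<open>auto simp: fun_eq_iff\<close>)
  qed
next
  case (Prf f g)
  show ?case unfolding correct_code_def
  proof (intro allI impI, goal_cases)
    case (1 as out b s v)
    then obtain a as' where as: "as = a # as'" by (cases as) (auto elim: rec_eval.cases)
    obtain r where r: "rec_eval f (map s as') (r 0)" "r (s a) = v"
      "\<And>i. i < s a \<Longrightarrow> rec_eval g (i # r i # map s as') (r (Suc i))"
      using rec_eval_Prf_trace[of f g "s a" "map s as'" v] 1(1) as by auto
    let ?body = "SEQ (code_recf g ((b + 1) # (b + 2) # as') (b + 3) (b + 4))
              (SEQ (CLEAR (b + 2) (b + 4)) (SEQ (MOVE (b + 3) (b + 2)) (INC (b + 1))))"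
    \<comment> \<open>State before round \<open>i\<close>: the rounds left in \<open>b\<close>, the
      index in \<open>b + 1\<close>, the current value in \<open>b + 2\<close>. Register
      \<open>b + 3\<close> only buffers the next value.\<close>
    let ?st = "\<lambda>i. s(b := s a - i, b + 1 := i, b + 2 := r i)"
    have as': "set as' \<subseteq> {..<b}" "out \<notin> set as'" "a < b" "a \<noteq> out" using 1 as by auto
    have z: "s c = 0" if "c \<ge> b" for c using 1 that by blast
    have body: "exec ?body ((?st i)(b := m)) (?st (Suc i))" if i: "s a - i = Suc m" for i m
    proof -
      let ?s1 = "(?st i)(b := m)"
      let ?s2 = "?s1(b + 3 := r (Suc i))"
      have e1: "exec (code_recf g ((b + 1) # (b + 2) # as') (b + 3) (b + 4)) ?s1 ?s2"
        by (rule correct_codeD[OF Prf.IH(2) r(3)[of i]])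
          (use i as' z in \<open>auto simp: subset_eq\<close>)
      show ?thesis
        by (rule exec_SEQ_eq[OF e1 exec_SEQ[OF exec_CLEAR exec_SEQ[OF exec_MOVE exec_INC]]])
          (use i z in \<open>auto simp: fun_eq_iff\<close>)
    qed
    have loop: "exec (LOOP b ?body) (?st i) (?st (s a))" if "i \<le> s a" for i
      using that
    proof (induction "s a - i" arbitrary: i)
      case 0
      then have "i = s a" by simp
      then show ?case by (auto intro!: exec_LOOP0)
    next
      case (Suc m)
      then have "exec (LOOP b ?body) (?st (Suc i)) (?st (s a))" by (intro Suc.hyps(1)) auto
      then show ?case using body[of i m] Suc.hyps(2) by - (rule exec_LOOPS[of _ b m], auto)
    qed
    have e1: "exec (COPY a b (b + 4)) s (s(b := s a))"
      using exec_COPY[of a b "b + 4" s] as' z by simp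
    have e2: "exec (code_recf f as' (b + 2) (b + 4)) (s(b := s a)) (?st 0)"
      by (rule correct_codeD[OF Prf.IH(1) r(1)])
        (use as' z in \<open>auto simp: subset_eq fun_eq_iff\<close>)
    show ?case unfolding code_recf.simps as list.sel
      by (rule exec_SEQ_eq[OF e1 exec_SEQ[OF e2 exec_SEQ[OF loop exec_SEQ[OF exec_MOVE exec_CLEAR]]]])
        (use as' z 1 r in \<open>auto simp: fun_eq_iff\<close>)
  qed
next
  case (Mnf f)
  show ?case unfolding correct_code_def
  proof (intro allI impI, goal_cases)
    case (1 as out b s v)
    let ?xs = "map s as"
    \<comment> \<open>\<open>w\<close> lists the values of \<open>f\<close> at all candidates up to
      \<open>v\<close>. They are positive except the last, so a loop on the register holding
      \<open>w i\<close> stops exactly at \<open>v\<close>.\<close>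
    obtain w where w: "\<And>z. z \<le> v \<Longrightarrow> rec_eval f (z # ?xs) (w z)" "\<And>z. z < v \<Longrightarrow> w z > 0" "w v = 0"
    proof -
      have v: "rec_eval f (v # ?xs) 0" "\<forall>z<v. \<exists>u. rec_eval f (z # ?xs) u \<and> 0 < u"
        using 1(1) by (auto elim: rec_eval.cases)
      from v(2) obtain w where "\<forall>z<v. rec_eval f (z # ?xs) (w z) \<and> 0 < w z" by metis
      then show thesis using v(1) by (intro that[of "w(v := 0)"]) (auto simp: le_less)
    qed
    have z: "s c = 0" if "c \<ge> b" for c using 1 that by blast
    let ?st = "\<lambda>i. s(b := i, b + 1 := w i)"
    let ?f = "code_recf f (b # as) (b + 1) (b + 2)"
    let ?body = "SEQ (CLEAR (b + 1) (b + 2)) (SEQ (INC b) ?f)"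
    have f: "exec ?f (s(b := i)) (?st i)" if "i \<le> v" for i
      by (rule correct_codeD[OF Mnf.IH w(1)[OF that]]) (use 1 z in \<open>auto simp: subset_eq fun_eq_iff\<close>)
    have body: "exec ?body ((?st i)(b + 1 := m)) (?st (Suc i))" if "i < v" for i m
    proof -
      have "exec ?f (((?st i)(b + 1 := m, b + 1 := 0))(b := Suc i)) (?st (Suc i))"
        using f[of "Suc i"] that z[of "b + 1"] by (auto simp: fun_upd_twist fun_upd_idem)
      then show ?thesis
        using exec_INC[of b "(?st i)(b + 1 := m, b + 1 := 0)"]
        by (intro exec_SEQ[OF exec_CLEAR exec_SEQ]) (use z in auto)
    qed
    have loop: "exec (LOOP (b + 1) ?body) (?st i) (?st v)" if "i \<le> v" for i
      using that
    proof (induction "v - i" arbitrary: i)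
      case 0
      then show ?case using w(3) by (auto intro!: exec_LOOP0)
    next
      case (Suc m)
      then have "exec (LOOP (b + 1) ?body) (?st (Suc i)) (?st v)" by (intro Suc.hyps(1)) auto
      moreover have "i < v" using Suc.hyps(2) by simp
      moreover from this obtain m' where "w i = Suc m'" using w(2)[of i] by (cases "w i") auto
      ultimately show ?case using body[of i m'] by - (rule exec_LOOPS[of _ "b + 1" m'], auto)
    qed
    have s: "s(b := 0) = s" using z by auto
    have e0: "exec ?f s (?st 0)" using f[of 0] unfolding s by simp
    show ?case unfolding code_recf.simps
      by (rule exec_SEQ_eq[OF e0 exec_SEQ[OF loop exec_MOVE]])
        (use z 1 w in \<open>auto simp: fun_eq_iff\<close>)
  qed
qed

section \<open>Queue transducers\<close>

inductive qstep :: "(nat \<Rightarrow> nat \<Rightarrow> nat list \<times> nat) \<Rightarrow> nat \<times> nat list \<Rightarrow> nat \<times> nat list \<Rightarrow> bool" for \<delta> where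
  "qstep \<delta> (s, b # W) (snd (\<delta> s b), W @ fst (\<delta> s b))"

text \<open>The output bound 2 keeps the set of pending outputs finite and is the source of the
  weight 3 in \<open>block_inv\<close>.\<close>

definition transducer :: "nat \<Rightarrow> nat \<Rightarrow> (nat \<Rightarrow> nat \<Rightarrow> nat list \<times> nat) \<Rightarrow> bool" where
  "transducer N n \<delta> \<longleftrightarrow> (\<forall>s<n. \<forall>b<N. set (fst (\<delta> s b)) \<subseteq> {..<N} \<and> length (fst (\<delta> s b)) \<le> 2 \<and> snd (\<delta> s b) < n)"

lemma qstep_intro: "\<delta> s b = (w, s') \<Longrightarrow> W' = W @ w \<Longrightarrow> qstep \<delta> (s, b # W) (s', W')"
  using qstep.intros[of \<delta> s b W] by simp

lemma qstep_det: "qstep \<delta> c d \<Longrightarrow> qstep \<delta> c e \<Longrightarrow> d = e"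
  by (auto elim!: qstep.cases)

lemma qsteps_rotate:
  assumes "\<And>b. b \<in> set U \<Longrightarrow> \<delta> s b = ([b], s)"
  shows "(qstep \<delta>)\<^sup>*\<^sup>* (s, U @ W) (s, W @ U)"
  using assms
proof (induction U arbitrary: W)
  case (Cons b U)
  have "qstep \<delta> (s, b # U @ W) (s, U @ W @ [b])"
    using Cons.prems by (intro qstep_intro[of _ _ _ "[b]"]) auto
  then show ?case using Cons.IH[of "W @ [b]"] Cons.prems by (auto intro: converse_rtranclp_into_rtranclp)
qed simp

datatype instr = Inc nat nat | Dec nat nat nat | Echo | Drain | Grow

fun flat_len :: "com \<Rightarrow> nat" where
  "flat_len (INC r) = 1"
| "flat_len (SEQ c d) = flat_len c + flat_len d"
| "flat_len (LOOP r c) = Suc (flat_len c)"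

text \<open>\<open>flat c i j\<close> is entered at label \<open>i\<close>, occupies the labels from \<open>i\<close> on, and exits to label \<open>j\<close>.\<close>

fun flat :: "com \<Rightarrow> nat \<Rightarrow> nat \<Rightarrow> instr list" where
  "flat (INC r) i j = [Inc r j]"
| "flat (SEQ c d) i j = flat c i (i + flat_len c) @ flat d (i + flat_len c) j"
| "flat (LOOP r c) i j = Dec r (Suc i) j # flat c (Suc i) i"

lemma length_flat [simp]: "length (flat c i j) = flat_len c"
  by (induction c i j rule: flat.induct) auto

fun regs :: "com \<Rightarrow> nat set" where
  "regs (INC r) = {r}"
| "regs (SEQ c d) = regs c \<union> regs d"
| "regs (LOOP r c) = insert r (regs c)"

lemma finite_regs [simp]: "finite (regs c)" by (induction c) auto

lemma flat_len_pos: "0 < flat_len c" by (induction c) auto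

lemma flat_instr:
  "x \<in> set (flat c i j) \<Longrightarrow>
    (\<exists>r q. x = Inc r q \<and> r \<in> regs c \<and> (q = j \<or> i \<le> q \<and> q < i + flat_len c)) \<or>
    (\<exists>r q z. x = Dec r q z \<and> r \<in> regs c \<and> (q = j \<or> i \<le> q \<and> q < i + flat_len c) \<and>
       (z = j \<or> i \<le> z \<and> z < i + flat_len c))"
proof (induction c i j rule: flat.induct)
  case (2 c d i j)
  then show ?case using flat_len_pos[of d] by fastforce
next
  case (3 r c i j)
  then show ?case using flat_len_pos[of c] by fastforce
qed auto

text \<open>The queue holds the register contents as an unordered word \<open>U\<close> (register \<open>r\<close> is the number of
  letters \<open>r\<close>) followed by the marker \<open>M\<close>; each instruction is one full rotation of the queue.
  State \<open>2 p\<close> executes the instruction at label \<open>p\<close>; state \<open>2 p + 1\<close> finishes the rotation of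
  a \<open>Dec\<close> that has already removed a letter.\<close>

fun scan :: "nat \<Rightarrow> instr \<Rightarrow> nat \<Rightarrow> nat \<Rightarrow> nat list \<times> nat" where
  "scan M (Inc r q) s b = (if b = M then ([r, M], 2 * q) else ([b], s))"
| "scan M (Dec r q z) s b = (if b = r then ([], Suc s) else if b = M then ([M], 2 * z) else ([b], s))"
| "scan M Echo s b = ([b], s)"
| "scan M Drain s b = ([], s)"
| "scan M Grow s b = ([b, b], s)"

fun finish :: "nat \<Rightarrow> instr \<Rightarrow> nat \<Rightarrow> nat \<Rightarrow> nat list \<times> nat" where
  "finish M (Dec r q z) s b = (if b = M then ([M], 2 * q) else ([b], s))"
| "finish M x s b = ([b], s)"

definition run_prog :: "nat \<Rightarrow> instr list \<Rightarrow> nat \<Rightarrow> nat \<Rightarrow> nat list \<times> nat" where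
  "run_prog M xs s b = (if even s then scan else finish) M (xs ! (s div 2)) s b"

lemma run_prog_even: "run_prog M xs (2 * p) b = scan M (xs ! p) (2 * p) b"
  and run_prog_odd: "run_prog M xs (Suc (2 * p)) b = finish M (xs ! p) (Suc (2 * p)) b"
  by (auto simp: run_prog_def)

definition represents :: "nat \<Rightarrow> (nat \<Rightarrow> nat) \<Rightarrow> nat list \<Rightarrow> bool" where
  "represents M s U \<longleftrightarrow> set U \<subseteq> {..<M} \<and> (\<forall>r<M. count_list U r = s r)"

lemma run_Inc:
  assumes "xs ! p = Inc r q" "represents M s U" "r < M"
  shows "\<exists>U'. (qstep (run_prog M xs))\<^sup>*\<^sup>* (2 * p, U @ [M]) (2 * q, U' @ [M]) \<and>
    represents M (s(r := Suc (s r))) U'"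
proof -
  have "(qstep (run_prog M xs))\<^sup>*\<^sup>* (2 * p, U @ [M]) (2 * p, [M] @ U)"
    by (rule qsteps_rotate) (use assms in \<open>auto simp: run_prog_even represents_def\<close>)
  moreover have "qstep (run_prog M xs) (2 * p, M # U) (2 * q, (U @ [r]) @ [M])"
    by (rule qstep_intro[of _ _ _ "[r, M]"]) (use assms in \<open>auto simp: run_prog_even\<close>)
  ultimately have "(qstep (run_prog M xs))\<^sup>*\<^sup>* (2 * p, U @ [M]) (2 * q, (U @ [r]) @ [M])" by auto
  moreover have "represents M (s(r := Suc (s r))) (U @ [r])"
    using assms by (auto simp: represents_def)
  ultimately show ?thesis by blast
qed

lemma run_Dec_zero:
  assumes "xs ! p = Dec r q z" "represents M s U" "r < M" "s r = 0"
  shows "(qstep (run_prog M xs))\<^sup>*\<^sup>* (2 * p, U @ [M]) (2 * z, U @ [M])"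
proof -
  have "count_list U r = 0" using assms by (simp add: represents_def)
  then have "r \<notin> set U" by (simp add: count_list_0_iff)
  then have "(qstep (run_prog M xs))\<^sup>*\<^sup>* (2 * p, U @ [M]) (2 * p, [M] @ U)"
    by (intro qsteps_rotate) (use assms in \<open>auto simp: run_prog_even represents_def\<close>)
  moreover have "qstep (run_prog M xs) (2 * p, M # U) (2 * z, U @ [M])"
    by (rule qstep_intro[of _ _ _ "[M]"]) (use assms in \<open>auto simp: run_prog_even\<close>)
  ultimately show ?thesis by auto
qed

lemma run_Dec_Suc:
  assumes "xs ! p = Dec r q z" "represents M s U" "r < M" "s r = Suc m"
  shows "\<exists>U'. (qstep (run_prog M xs))\<^sup>*\<^sup>* (2 * p, U @ [M]) (2 * q, U' @ [M]) \<and>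
    represents M (s(r := m)) U'"
proof -
  have "r \<in> set U" using assms by (metis count_notin nat.distinct(1) represents_def)
  then obtain U1 U2 where U: "U = U1 @ r # U2" "r \<notin> set U1" by (meson split_list_first)
  have "(qstep (run_prog M xs))\<^sup>*\<^sup>* (2 * p, U1 @ r # U2 @ [M]) (2 * p, (r # U2 @ [M]) @ U1)"
    by (rule qsteps_rotate) (use assms U in \<open>auto simp: run_prog_even represents_def\<close>)
  moreover have "qstep (run_prog M xs) (2 * p, r # U2 @ [M] @ U1) (Suc (2 * p), U2 @ [M] @ U1)"
    by (rule qstep_intro[of _ _ _ "[]"]) (use assms in \<open>auto simp: run_prog_even\<close>)
  moreover have "(qstep (run_prog M xs))\<^sup>*\<^sup>* (Suc (2 * p), U2 @ [M] @ U1) (Suc (2 * p), ([M] @ U1) @ U2)"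
    by (rule qsteps_rotate) (use assms U in \<open>auto simp: run_prog_odd represents_def\<close>)
  moreover have "qstep (run_prog M xs) (Suc (2 * p), M # U1 @ U2) (2 * q, (U1 @ U2) @ [M])"
    by (rule qstep_intro[of _ _ _ "[M]"]) (use assms in \<open>auto simp: run_prog_odd\<close>)
  ultimately have "(qstep (run_prog M xs))\<^sup>*\<^sup>* (2 * p, U @ [M]) (2 * q, (U1 @ U2) @ [M])"
    using U by (auto intro: rtranclp_trans rtranclp.rtrancl_into_rtrancl)
  moreover have "represents M (s(r := m)) (U1 @ U2)"
    using assms U by (auto simp: represents_def)
  ultimately show ?thesis by blast
qed

lemma run_flat:
  assumes "exec c s t" "regs c \<subseteq> {..<M}" "represents M s U"
    "\<And>p. p < flat_len c \<Longrightarrow> xs ! (i + p) = flat c i j ! p"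
  shows "\<exists>U'. (qstep (run_prog M xs))\<^sup>*\<^sup>* (2 * i, U @ [M]) (2 * j, U' @ [M]) \<and> represents M t U'"
  using assms
proof (induction arbitrary: U i j rule: exec.induct)
  case (exec_INC r s)
  then show ?case using exec_INC.prems(3)[of 0] by (intro run_Inc) auto
next
  case (exec_SEQ c s s' d t)
  have c: "xs ! (i + p) = flat c i (i + flat_len c) ! p" if "p < flat_len c" for p
    using exec_SEQ.prems(3)[of p] that by (simp add: nth_append)
  have d: "xs ! (i + flat_len c + p) = flat d (i + flat_len c) j ! p" if "p < flat_len d" for p
    using exec_SEQ.prems(3)[of "flat_len c + p"] that by (simp add: nth_append add.assoc)
  obtain U1 where U1: "(qstep (run_prog M xs))\<^sup>*\<^sup>* (2 * i, U @ [M]) (2 * (i + flat_len c), U1 @ [M])"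
      "represents M s' U1"
    using exec_SEQ.IH(1)[OF _ exec_SEQ.prems(2) c] exec_SEQ.prems(1) by auto
  obtain U2 where "(qstep (run_prog M xs))\<^sup>*\<^sup>* (2 * (i + flat_len c), U1 @ [M]) (2 * j, U2 @ [M])"
      "represents M t U2"
    using exec_SEQ.IH(2)[OF _ U1(2) d] exec_SEQ.prems(1) by auto
  then show ?case using U1 by (meson rtranclp_trans)
next
  case (exec_LOOP0 s r c)
  have "xs ! i = Dec r (Suc i) j" using exec_LOOP0.prems(3)[of 0] by simp
  then show ?case using run_Dec_zero[of xs i r _ j M s U] exec_LOOP0 by auto
next
  case (exec_LOOPS s r m c s' t)
  have x: "xs ! i = Dec r (Suc i) j" using exec_LOOPS.prems(3)[of 0] by simp
  have c: "xs ! (Suc i + p) = flat c (Suc i) i ! p" if "p < flat_len c" for p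
    using exec_LOOPS.prems(3)[of "Suc p"] that by simp
  obtain U1 where U1: "(qstep (run_prog M xs))\<^sup>*\<^sup>* (2 * i, U @ [M]) (2 * Suc i, U1 @ [M])"
      "represents M (s(r := m)) U1"
    using run_Dec_Suc[OF x exec_LOOPS.prems(2)] exec_LOOPS by auto
  obtain U2 where U2: "(qstep (run_prog M xs))\<^sup>*\<^sup>* (2 * Suc i, U1 @ [M]) (2 * i, U2 @ [M])"
      "represents M s' U2"
    using exec_LOOPS.IH(1)[OF _ U1(2) c] exec_LOOPS.prems(1) by auto
  obtain U3 where U3: "(qstep (run_prog M xs))\<^sup>*\<^sup>* (2 * i, U2 @ [M]) (2 * j, U3 @ [M])"
      "represents M t U3"
    using exec_LOOPS.IH(2)[OF exec_LOOPS.prems(1) U2(2) exec_LOOPS.prems(3)] by auto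
  show ?case using U1 U2 U3 by (meson rtranclp_trans)
qed

text \<open>\<open>N - 1\<close> is the marker. Its survival for \<open>g\<close> is asserted for
  all states and single steps, so it can be used even for a computation that never ends.\<close>

lemma recf_to_transducer:
  fixes h :: recf and g :: bool
  obtains N n \<delta> t0 t1 where "2 \<le> N" "0 < n" "transducer N n \<delta>"
    "\<And>b. \<delta> t0 b = ([b], t0)" "\<And>b. \<delta> t1 b = (if g then [b, b] else [], t1)"
    "\<And>s. g \<Longrightarrow> s < n \<Longrightarrow> N - 1 \<in> set (fst (\<delta> s (N - 1)))"
    "\<And>k v. rec_eval h [k] v \<Longrightarrow>
      \<exists>W. W \<noteq> [] \<and> (qstep \<delta>)\<^sup>*\<^sup>* (0, replicate k 0 @ [N - 1]) (if v = 0 then t0 else t1, W)"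
proof -
  define c where "c = code_recf h [0] 1 2"
  define e where "e = flat_len c"
  \<comment> \<open>The result is in register 1. The appended \<open>Dec\<close> jumps to
    \<open>e + 2\<close> if it is positive and to \<open>e + 1\<close> if it is zero.\<close>
  define xs where "xs = flat c 0 e @ [Dec 1 (e + 2) (e + 1), Echo, if g then Grow else Drain]"
  \<comment> \<open>Registers serve as letters, so the marker must exceed all of them; 1 is inserted
    because of the final test on register 1.\<close>
  define M where "M = Suc (Max (insert 1 (regs c)))"
  have M: "r < M" if "r \<in> regs c" for r unfolding M_def using that by (simp add: le_imp_less_Suc)
  have M1: "1 < M" unfolding M_def less_Suc_eq_le by (rule Max_ge) auto
  define \<delta> where "\<delta> = run_prog M xs"
  have xs: "length xs = e + 3" by (simp add: xs_def e_def)
  have xe: "xs ! e = Dec 1 (e + 2) (e + 1)" "xs ! (e + 1) = Echo" "xs ! (e + 2) = (if g then Grow else Drain)"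
    by (auto simp: xs_def e_def nth_append)
  have bounds: "case x of Inc r q \<Rightarrow> r < M \<and> q < e + 3 | Dec r q z \<Rightarrow> r < M \<and> q < e + 3 \<and> z < e + 3 | _ \<Rightarrow> True"
    if "x \<in> set xs" for x
  proof (cases "x \<in> set (flat c 0 e)")
    case True
    from flat_instr[OF this] show ?thesis using M by (auto simp: e_def)
  next
    case False
    then show ?thesis using that M1 by (auto simp: xs_def)
  qed
  have "transducer (M + 1) (2 * (e + 3)) \<delta>"
    unfolding transducer_def
  proof (intro allI impI)
    fix s b assume s: "s < 2 * (e + 3)" and b: "b < M + 1"
    let ?x = "xs ! (s div 2)"
    have ev: "even s \<Longrightarrow> Suc s < 2 * (e + 3)" using s by presburger
    have "?x \<in> set xs" using s xs by (intro nth_mem) auto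
    from bounds[OF this] show "set (fst (\<delta> s b)) \<subseteq> {..<M + 1} \<and> length (fst (\<delta> s b)) \<le> 2 \<and> snd (\<delta> s b) < 2 * (e + 3)"
      using s b ev unfolding \<delta>_def run_prog_def by (cases ?x) auto
  qed
  moreover have "M + 1 - 1 \<in> set (fst (\<delta> s (M + 1 - 1)))" if "g" "s < 2 * (e + 3)" for s
  proof -
    let ?x = "xs ! (s div 2)"
    have x: "?x \<in> set xs" using that xs by (intro nth_mem) auto
    \<comment> \<open>\<open>Drain\<close> is the only instruction that swallows the marker: a
      \<open>Dec r\<close> removes only \<open>r\<close>, and \<open>r < M\<close>.\<close>
    have "Drain \<notin> set xs" using that flat_instr[of Drain c 0 e] by (auto simp: xs_def)
    then have "?x \<noteq> Drain" using x by metis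
    then show ?thesis using bounds[OF x] unfolding \<delta>_def run_prog_def by (cases ?x) auto
  qed
  moreover have "\<delta> (2 * (e + 1)) b = ([b], 2 * (e + 1))" for b
    unfolding \<delta>_def run_prog_even xe by simp
  moreover have "\<delta> (2 * (e + 2)) b = (if g then [b, b] else [], 2 * (e + 2))" for b
    unfolding \<delta>_def run_prog_even xe by simp
  moreover have "\<exists>W. W \<noteq> [] \<and> (qstep \<delta>)\<^sup>*\<^sup>* (0, replicate k 0 @ [M + 1 - 1])
      (if v = 0 then 2 * (e + 1) else 2 * (e + 2), W)" if "rec_eval h [k] v" for k v
  proof -
    let ?s = "(\<lambda>_. 0)(0 := k) :: nat \<Rightarrow> nat" and ?t = "(\<lambda>_. 0)(0 := k, 1 := v) :: nat \<Rightarrow> nat"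
    have ex: "exec c ?s ?t"
      unfolding c_def by (rule correct_codeD[OF correct_code_recf that]) (auto simp: fun_eq_iff)
    have rep: "represents M ?s (replicate k 0)"
    proof -
      have "count_list (replicate k (0::nat)) r = (if r = 0 then k else 0)" for r by (induction k) auto
      then show ?thesis using M1 by (auto simp: represents_def)
    qed
    obtain U where U: "(qstep \<delta>)\<^sup>*\<^sup>* (2 * 0, replicate k 0 @ [M]) (2 * e, U @ [M])" "represents M ?t U"
      unfolding \<delta>_def
      using run_flat[OF ex _ rep, of xs 0 e] M by (auto simp: xs_def e_def nth_append)
    have "\<exists>W. (qstep \<delta>)\<^sup>*\<^sup>* (2 * e, U @ [M]) (if v = 0 then 2 * (e + 1) else 2 * (e + 2), W @ [M])"
    proof (cases v)
      case 0
      then show ?thesis using run_Dec_zero[OF xe(1) U(2) M1] by (auto simp: \<delta>_def)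
    next
      case (Suc m)
      then show ?thesis using run_Dec_Suc[OF xe(1) U(2) M1, of m] by (auto simp: \<delta>_def)
    qed
    then obtain W where "(qstep \<delta>)\<^sup>*\<^sup>* (2 * e, U @ [M]) (if v = 0 then 2 * (e + 1) else 2 * (e + 2), W @ [M])"
      by blast
    from rtranclp_trans[OF U(1) this] show ?thesis by (intro exI[of _ "W @ [M]"]) simp
  qed
  ultimately show thesis using M1 by (intro that[of "M + 1" "2 * (e + 3)" \<delta> "2 * (e + 1)" "2 * (e + 2)"]) auto
qed

section \<open>Wrapping an honest machine\<close>

text \<open>The honest part of a machine, with states from 6 on and letters below \<open>N\<close>, is completed in one of three
  ways. \<open>Reset\<close>: the letter \<open>N\<close>, which is never sent, leads back to the initial state. The other two add
  deviations and the end marks \<open>N\<close> (and \<open>N + 1\<close>). State 0 is entered by sending a wrong letter, 1 by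
  sending the end mark, 2 by receiving it. \<open>Flush\<close>: a deviating machine first completes its output and only
  then reads the rest of its input, so it never starves its partner. \<open>Block\<close>: a deviating machine first
  reads its input up to the second end mark, which neither machine sends before having received it;
  so it never sends again.\<close>

datatype mode = Reset | Flush | Block

definition dev :: "mode \<Rightarrow> nat \<Rightarrow> nat \<Rightarrow> nat \<Rightarrow> (nat \<times> act \<times> nat) set" where
  "dev m N p a = (if m = Reset then {} else {(p, Snd c, 0) | c. c < N \<and> c \<noteq> a} \<union> {(p, Snd N, 1)})"

definition sendT :: "mode \<Rightarrow> nat \<Rightarrow> nat \<times> nat \<times> nat \<Rightarrow> (nat \<times> act \<times> nat) set" where
  "sendT m N = (\<lambda>(p, a, q). insert (p, Snd a, q) (dev m N p a))"

definition recvT :: "mode \<Rightarrow> nat \<Rightarrow> nat \<Rightarrow> nat \<times> nat \<times> nat \<Rightarrow> (nat \<times> act \<times> nat) set" where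
  "recvT m N ini = (\<lambda>(p, b, q). {(p, Rcv b, q), (p, Rcv N, if m = Reset then ini else 2)})"

fun tailT :: "mode \<Rightarrow> nat \<Rightarrow> nat \<Rightarrow> (nat \<times> act \<times> nat) set" where
  "tailT Reset N ini = {}"
| "tailT Flush N ini = {(0, Snd a, 0) | a. a < N} \<union> {(1, Rcv b, 1) | b. b < N} \<union> {(2, Snd a, 2) | a. a < N}
     \<union> {(0, Snd N, 1), (1, Rcv N, ini), (2, Snd N, ini)}"
| "tailT Block N ini = {(0, Rcv b, 0) | b. b < N} \<union> {(1, Rcv b, 1) | b. b < N} \<union> {(3, Snd a, 3) | a. a < N}
     \<union> {(0, Rcv N, 2), (2, Rcv (Suc N), 3), (3, Snd N, 4), (4, Snd (Suc N), ini), (1, Rcv N, 5), (5, Rcv (Suc N), 4)}"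

fun tails :: "mode \<Rightarrow> nat set" where
  "tails Reset = {}"
| "tails Flush = {0, 1, 2}"
| "tails Block = {0, 1, 2, 3, 4, 5}"

definition wrapT :: "mode \<Rightarrow> nat \<Rightarrow> nat \<Rightarrow> (nat \<times> nat \<times> nat) set \<Rightarrow> (nat \<times> nat \<times> nat) set \<Rightarrow> (nat \<times> act \<times> nat) set" where
  "wrapT m N ini HS HR = \<Union> (sendT m N ` HS) \<union> \<Union> (recvT m N ini ` HR) \<union> tailT m N ini"

lemma wrapT_Snd: "(p, Snd c, q) \<in> wrapT m N ini HS HR \<longleftrightarrow> (p, c, q) \<in> HS \<or>
    (m \<noteq> Reset \<and> (\<exists>a q'. (p, a, q') \<in> HS \<and> (c < N \<and> c \<noteq> a \<and> q = 0 \<or> c = N \<and> q = 1))) \<or>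
    (p, Snd c, q) \<in> tailT m N ini"
  by (auto simp: wrapT_def sendT_def recvT_def dev_def Bex_def split: if_splits)

lemma wrapT_Rcv: "(p, Rcv c, q) \<in> wrapT m N ini HS HR \<longleftrightarrow> (p, c, q) \<in> HR \<or>
    (\<exists>b q'. (p, b, q') \<in> HR \<and> c = N \<and> q = (if m = Reset then ini else 2)) \<or>
    (p, Rcv c, q) \<in> tailT m N ini"
  by (auto simp: wrapT_def sendT_def recvT_def dev_def Bex_def split: if_splits)

definition ends :: "mode \<Rightarrow> nat \<Rightarrow> nat list" where
  "ends m N = (if m = Block then [N, Suc N] else [N])"

text \<open>The common loop language. The two components have the same number of rounds but
  otherwise unrelated words, so the language does not change when sending and receiving are
  exchanged.\<close>

inductive_set rounds :: "nat \<Rightarrow> nat list \<Rightarrow> (nat list \<times> nat list) set" for N E where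
  rounds_Nil: "([], []) \<in> rounds N E"
| rounds_step: "set u \<subseteq> {..<N} \<Longrightarrow> set v \<subseteq> {..<N} \<Longrightarrow> (x, y) \<in> rounds N E \<Longrightarrow> (u @ E @ x, v @ E @ y) \<in> rounds N E"

lemma rounds_swap: "(x, y) \<in> rounds N E \<Longrightarrow> (y, x) \<in> rounds N E"
  by (induction rule: rounds.induct) (auto intro: rounds.intros)

definition snds :: "act list \<Rightarrow> nat list" where "snds w = map msg (filter is_send w)"
definition rcvs :: "act list \<Rightarrow> nat list" where "rcvs w = map msg (filter (\<lambda>e. \<not> is_send e) w)"

lemma snds_rcvs_simps [simp]:
  "snds [] = []" "rcvs [] = []"
  "snds (Snd a # w) = a # snds w" "snds (Rcv a # w) = snds w"
  "rcvs (Snd a # w) = rcvs w" "rcvs (Rcv a # w) = a # rcvs w"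
  "snds (v @ w) = snds v @ snds w" "rcvs (v @ w) = rcvs v @ rcvs w"
  "snds (map Snd x) = x" "rcvs (map Snd x) = []" "snds (map Rcv x) = []" "rcvs (map Rcv x) = x"
  by (auto simp: snds_def rcvs_def filter_map comp_def)

lemma path_append: "path T p v q \<Longrightarrow> path T q w r \<Longrightarrow> path T p (v @ w) r"
  by (induction rule: path.induct) (auto intro: path.intros)

lemma path_single: "(p, e, q) \<in> T \<Longrightarrow> path T p [e] q"
  by (auto intro: path.intros)

lemma path_loop: "(\<And>a. a \<in> set u \<Longrightarrow> (p, f a, p) \<in> T) \<Longrightarrow> path T p (map f u) p"
  by (induction u) (auto intro: path.intros)

definition connects :: "(nat \<times> act \<times> nat) set \<Rightarrow> nat \<Rightarrow> nat \<Rightarrow> bool" where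
  "connects T p q \<longleftrightarrow> (\<exists>w. path T p w q)"

lemma connects_refl: "connects T p p"
  and connects_trans: "connects T p q \<Longrightarrow> connects T q r \<Longrightarrow> connects T p r"
  and connects_edge: "(p, e, q) \<in> T \<Longrightarrow> connects T p q"
  unfolding connects_def by (auto intro: path.intros path_append path_single)

lemma connects_step: "(p, e, q) \<in> T \<Longrightarrow> connects T q r \<Longrightarrow> connects T p r"
  by (meson connects_edge connects_trans)

text \<open>The condition \<open>q \<noteq> ini\<close> makes every loop at \<open>ini\<close> a
  sequence of whole rounds; \<open>mu\<close> excludes cycles of honest sends; two letters are
  required so that a wrong letter exists at each send state.\<close>

locale honest =
  fixes N :: nat and Q :: "nat set" and HS HR :: "(nat \<times> nat \<times> nat) set" and ini :: nat and mu :: "nat \<Rightarrow> nat"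
  assumes N2: "2 \<le> N"
    and fin: "finite Q"
    and Q_ge: "\<And>q. q \<in> Q \<Longrightarrow> 6 \<le> q"
    and ini_Q: "ini \<in> Q"
    and HS_D: "\<And>p a q. (p, a, q) \<in> HS \<Longrightarrow> p \<in> Q \<and> a < N \<and> q \<in> Q \<and> q \<noteq> ini"
    and HR_D: "\<And>p b q. (p, b, q) \<in> HR \<Longrightarrow> p \<in> Q \<and> b < N \<and> q \<in> Q \<and> q \<noteq> ini"
    and total: "\<And>p. p \<in> Q \<Longrightarrow> (\<exists>a q. (p, a, q) \<in> HS) \<or> (\<forall>b<N. \<exists>q. (p, b, q) \<in> HR)"
    and excl: "\<And>p a q b q'. (p, a, q) \<in> HS \<Longrightarrow> (p, b, q') \<notin> HR"
    and detS: "\<And>p a q a' q'. (p, a, q) \<in> HS \<Longrightarrow> (p, a', q') \<in> HS \<Longrightarrow> a' = a \<and> q' = q"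
    and detR: "\<And>p b q q'. (p, b, q) \<in> HR \<Longrightarrow> (p, b, q') \<in> HR \<Longrightarrow> q' = q"
    and mu: "\<And>p a q. (p, a, q) \<in> HS \<Longrightarrow> mu q < mu p"
    and sends: "HS \<noteq> {}"
    and reach: "\<And>q. q \<in> Q \<Longrightarrow> (\<lambda>p q. \<exists>a. (p, a, q) \<in> HS \<union> HR)\<^sup>*\<^sup>* ini q"
begin

abbreviation T where "T m \<equiv> wrapT m N ini HS HR"

lemma finite_HS_HR: "finite HS" "finite HR"
  by (rule finite_subset[of _ "Q \<times> {..<N} \<times> Q"]; use fin HS_D HR_D in auto)+

lemma finite_tailT: "finite (tailT m N ini)"
  by (cases m) auto

lemma finite_T: "finite (T m)"
  unfolding wrapT_def using finite_HS_HR finite_tailT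
  by (auto simp: sendT_def recvT_def dev_def)

lemma tailT_low: "(p, e, q) \<in> tailT m N ini \<Longrightarrow> p < 6 \<and> p \<in> tails m \<and> (q = ini \<or> q \<in> tails m) \<and> msg e < N + 2"
  by (cases m) auto

lemma T_low: "p < 6 \<Longrightarrow> (p, e, q) \<in> T m \<longleftrightarrow> (p, e, q) \<in> tailT m N ini"
proof -
  assume "p < 6"
  then have "(p, a, q') \<notin> HS" "(p, a, q') \<notin> HR" for a q' using HS_D HR_D Q_ge by force+
  then show ?thesis by (cases e) (auto simp: wrapT_Snd wrapT_Rcv)
qed

lemma T_Q_cases:
  assumes "(p, e, q) \<in> T m" "p \<in> Q"
  obtains (snd) a where "e = Snd a" "(p, a, q) \<in> HS"
  | (dev) a c q' where "m \<noteq> Reset" "e = Snd c" "c < N" "c \<noteq> a" "(p, a, q') \<in> HS" "q = 0"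
  | (dev_end) a q' where "m \<noteq> Reset" "e = Snd N" "(p, a, q') \<in> HS" "q = 1"
  | (rcv) b where "e = Rcv b" "(p, b, q) \<in> HR"
  | (rcv_end) b q' where "e = Rcv N" "(p, b, q') \<in> HR" "q = (if m = Reset then ini else 2)"
proof -
  have "(p, e, q) \<notin> tailT m N ini" using tailT_low[of p e q m] Q_ge[OF assms(2)] by auto
  then show thesis using assms that by (cases e) (auto simp: wrapT_Snd wrapT_Rcv)
qed

lemma T_snd: "(p, a, q) \<in> HS \<Longrightarrow> (p, Snd a, q) \<in> T m"
  and T_dev: "(p, a, q) \<in> HS \<Longrightarrow> m \<noteq> Reset \<Longrightarrow> c < N \<Longrightarrow> c \<noteq> a \<Longrightarrow> (p, Snd c, 0) \<in> T m"
  and T_dev_end: "(p, a, q) \<in> HS \<Longrightarrow> m \<noteq> Reset \<Longrightarrow> (p, Snd N, 1) \<in> T m"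
  and T_rcv: "(p, b, q) \<in> HR \<Longrightarrow> (p, Rcv b, q) \<in> T m"
  and T_rcv_end: "(p, b, q) \<in> HR \<Longrightarrow> m \<noteq> Reset \<Longrightarrow> (p, Rcv N, 2) \<in> T m"
  and T_reset: "(p, b, q) \<in> HR \<Longrightarrow> (p, Rcv N, ini) \<in> T Reset"
  and T_tail: "(p, e, q) \<in> tailT m N ini \<Longrightarrow> (p, e, q) \<in> T m"
  by (auto simp: wrapT_Snd wrapT_Rcv) (auto simp: wrapT_def)

lemma T_source: "(p, e, q) \<in> T m \<Longrightarrow> p \<in> Q \<or> p < 6 \<and> p \<in> tails m"
  by (cases e) (auto simp: wrapT_Snd wrapT_Rcv dest: HS_D HR_D tailT_low)

lemma tails_012: "m \<noteq> Reset \<Longrightarrow> 0 \<in> tails m \<and> 1 \<in> tails m \<and> 2 \<in> tails m"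
  by (cases m) auto

lemma T_target: "(p, e, q) \<in> T m \<Longrightarrow> q \<in> Q \<union> tails m"
  using ini_Q tails_012[of m]
  by (cases e) (auto simp: wrapT_Snd wrapT_Rcv dest: HS_D HR_D tailT_low split: if_splits)

lemma T_letters: "(p, e, q) \<in> T m \<Longrightarrow> msg e < N + 2"
  by (cases e) (auto simp: wrapT_Snd wrapT_Rcv dest: HS_D HR_D tailT_low)

lemma T_det: "(p, e, q1) \<in> T m \<Longrightarrow> (p, e, q2) \<in> T m \<Longrightarrow> q1 = q2"
proof (cases "p < 6")
  case True
  then show "(p, e, q1) \<in> T m \<Longrightarrow> (p, e, q2) \<in> T m \<Longrightarrow> q1 = q2"
    by (cases m) (auto simp: T_low)
next
  case False
  then have "(p, e, q) \<notin> tailT m N ini" for q using tailT_low by blast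
  then show "(p, e, q1) \<in> T m \<Longrightarrow> (p, e, q2) \<in> T m \<Longrightarrow> q1 = q2"
    by (cases e) (auto simp: wrapT_Snd wrapT_Rcv dest: HS_D HR_D detS detR)
qed

lemma T_send_or_recv: "(\<forall>b q. (p, Rcv b, q) \<notin> T m) \<or> (\<forall>b q. (p, Snd b, q) \<notin> T m)"
proof (cases "p < 6")
  case True
  then show ?thesis by (cases m) (auto simp: T_low)
next
  case False
  then have "(p, e, q) \<notin> tailT m N ini" for e q using tailT_low by blast
  then show ?thesis using excl by (auto simp: wrapT_Snd wrapT_Rcv)
qed

text \<open>Honest sends decrease \<open>mu\<close>, so following them ends in a state that
  receives. This is needed to enter state 2.\<close>

lemma HR_ex: "\<exists>p b q. (p, b, q) \<in> HR"
proof -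
  have "\<exists>q b q'. (q, b, q') \<in> HR" if "p \<in> Q" for p
    using that
  proof (induction "mu p" arbitrary: p rule: less_induct)
    case less
    from total[OF less.prems] show ?case
      using less.hyps mu HS_D N2 by (metis less_le_trans zero_less_numeral)
  qed
  then show ?thesis using ini_Q by blast
qed

lemma connects_honest: "q \<in> Q \<Longrightarrow> connects (T m) ini q"
proof -
  assume "q \<in> Q"
  from reach[OF this] show ?thesis
  proof (induction rule: rtranclp_induct)
    case (step p q)
    then show ?case by (metis Un_iff connects_edge connects_trans T_snd T_rcv)
  qed (rule connects_refl)
qed

lemma connects_tails_ini:
  assumes "p \<in> tails m"
  shows "connects (T m) p ini"
proof -
  note c = connects_step[OF T_tail] connects_refl
  show ?thesis
  proof (cases m)
    case Flush
    then have "connects (T m) 1 ini" "connects (T m) 2 ini" by (auto intro: c)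
    moreover from this(1) Flush have "connects (T m) 0 ini" by (auto intro: c)
    ultimately show ?thesis using assms Flush by auto
  next
    case Block
    then have 4: "connects (T m) 4 ini" by (auto intro: c)
    then have 3: "connects (T m) 3 ini" using Block by (auto intro: c)
    then have 2: "connects (T m) 2 ini" using Block by (auto intro: c)
    then have 0: "connects (T m) 0 ini" using Block by (auto intro: c)
    have 5: "connects (T m) 5 ini" using Block 4 by (auto intro: c)
    then have 1: "connects (T m) 1 ini" using Block by (auto intro: c)
    show ?thesis using assms Block 0 1 2 3 4 5 by auto
  qed (use assms in auto)
qed

text \<open>Under \<open>Reset\<close> the sends run out by \<open>mu\<close>, and the receive state
  then reached has the edge for \<open>N\<close>. In the other modes a single end mark leads into a
  tail.\<close>

lemma connects_Q_ini:
  assumes "p \<in> Q"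
  shows "connects (T m) p ini"
proof (cases "m = Reset")
  case True
  show ?thesis
    using assms
  proof (induction "mu p" arbitrary: p rule: less_induct)
    case less
    from total[OF less.prems] show ?case
    proof
      assume "\<exists>a q. (p, a, q) \<in> HS"
      then obtain a q where q: "(p, a, q) \<in> HS" by blast
      show ?thesis using less.hyps[OF mu[OF q]] HS_D[OF q] connects_step[OF T_snd[OF q]] by blast
    next
      assume "\<forall>b<N. \<exists>q. (p, b, q) \<in> HR"
      then obtain q where "(p, 0, q) \<in> HR" using N2 by force
      then show ?thesis using T_reset connects_edge True by blast
    qed
  qed
next
  case False
  then have t: "1 \<in> tails m" "2 \<in> tails m" by (cases m; simp)+
  from total[OF assms] show ?thesis
  proof
    assume "\<exists>a q. (p, a, q) \<in> HS"
    then show ?thesis using T_dev_end False connects_step connects_tails_ini[OF t(1)] by blast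
  next
    assume "\<forall>b<N. \<exists>q. (p, b, q) \<in> HR"
    then obtain q where "(p, 0, q) \<in> HR" using N2 by force
    then show ?thesis using T_rcv_end False connects_step connects_tails_ini[OF t(2)] by blast
  qed
qed

lemma connects_ini_tails:
  assumes "p \<in> tails m"
  shows "connects (T m) ini p"
proof -
  have m: "m \<noteq> Reset" using assms by auto
  obtain q a q' where q: "(q, a, q') \<in> HS" using sends by auto
  then have iq: "connects (T m) ini q" using connects_honest HS_D by blast
  obtain r b r' where r: "(r, b, r') \<in> HR" using HR_ex by blast
  then have ir: "connects (T m) ini r" using connects_honest HR_D by blast
  \<comment> \<open>State 0 is entered only by a wrong letter below \<open>N\<close>; here
    \<open>N2\<close> provides one.\<close>
  obtain c where "c < N" "c \<noteq> a" using N2 by (metis less_le_trans one_less_numeral_iff semiring_norm(76) zero_less_numeral zero_neq_one)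
  then have 0: "connects (T m) ini 0" using T_dev[OF q m] iq connects_edge connects_trans by blast
  have 1: "connects (T m) ini 1" using T_dev_end[OF q m] iq connects_edge connects_trans by blast
  have 2: "connects (T m) ini 2" using T_rcv_end[OF r m] ir connects_edge connects_trans by blast
  have c: "connects (T m) ini y" if "connects (T m) ini x" "(x, e, y) \<in> tailT m N ini" for x e y
    using that T_tail connects_edge connects_trans by blast
  show ?thesis
  proof (cases m)
    case Block
    have 3: "connects (T m) ini 3" using Block by (intro c[OF 2]) auto
    have 4: "connects (T m) ini 4" using Block by (intro c[OF 3]) auto
    have 5: "connects (T m) ini 5" using Block by (intro c[OF 1]) auto
    show ?thesis using assms 0 1 2 3 4 5 Block by auto
  qed (use assms 0 1 2 in auto)
qed

lemma strongly_connected: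
  assumes "p \<in> Q \<union> tails m" "q \<in> Q \<union> tails m"
  shows "connects (T m) p q"
  using assms connects_ini_tails connects_honest connects_tails_ini connects_Q_ini
  by (meson Un_iff connects_trans)

text \<open>Under \<open>Reset\<close> all sends are honest and lower \<open>mu\<close>. The tails
  of the other modes do contain send loops.\<close>

lemma no_send_cycle: "path (T Reset) p w q \<Longrightarrow> list_all is_send w \<Longrightarrow> w = [] \<and> p = q \<or> mu q < mu p"
proof (induction rule: path.induct)
  case (path_cons p e q w r)
  then obtain a where "e = Snd a" by (cases e) auto
  then have "(p, a, q) \<in> HS" using path_cons(1) by (simp add: wrapT_Snd)
  then show ?case using mu[of p a q] path_cons by auto
qed simp

end

section \<open>The loops of a wrapped machine are exactly the sequences of rounds\<close>

context honest
begin

abbreviation (input) E where "E m \<equiv> ends m N"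
abbreviation (input) R where "R m \<equiv> rounds N (E m)"

definition full_words :: "mode \<Rightarrow> nat list set" where
  "full_words m = {u @ E m | u. set u \<subseteq> {..<N}}"

text \<open>\<open>A\<close> and \<open>B\<close> describe what is left to send and to receive in
  the current round; complete rounds follow.\<close>

definition lang :: "mode \<Rightarrow> nat list set \<Rightarrow> nat list set \<Rightarrow> (nat list \<times> nat list) set" where
  "lang m A B = {(a @ x, b @ y) | a b x y. a \<in> A \<and> b \<in> B \<and> (x, y) \<in> R m}"

lemma lang_Nil: "lang m {[]} {[]} = R m" by (auto simp: lang_def)

lemma lang_full: "lang m (full_words m) (full_words m) \<subseteq> R m"
  by (auto simp: lang_def full_words_def intro: rounds_step)

lemma ends_Cons: "E m = N # tl (E m)" by (simp add: ends_def)

lemma lang_left: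
  "(x, y) \<in> lang m A B \<Longrightarrow> (\<And>w. w \<in> A \<Longrightarrow> a # w \<in> A') \<Longrightarrow> (a # x, y) \<in> lang m A' B"
  unfolding lang_def mem_Collect_eq prod.inject by (metis append_Cons)

lemma lang_right:
  "(x, y) \<in> lang m A B \<Longrightarrow> (\<And>w. w \<in> B \<Longrightarrow> a # w \<in> B') \<Longrightarrow> (x, a # y) \<in> lang m A B'"
  unfolding lang_def mem_Collect_eq prod.inject by (metis append_Cons)

lemma full_words_letter: "w \<in> full_words m \<Longrightarrow> a < N \<Longrightarrow> a # w \<in> full_words m"
  unfolding full_words_def mem_Collect_eq by (metis append_Cons insert_subset lessThan_iff list.simps(15))

lemma full_words_end: "N # tl (E m) \<in> full_words m"
  unfolding full_words_def using ends_Cons[of m] by (auto intro!: exI[of _ "[]"])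

lemma lang_intros:
  "(x, y) \<in> lang m (full_words m) B \<Longrightarrow> a < N \<Longrightarrow> (a # x, y) \<in> lang m (full_words m) B"
  "(x, y) \<in> lang m {tl (E m)} B \<Longrightarrow> (N # x, y) \<in> lang m (full_words m) B"
  "(x, y) \<in> lang m {[]} B \<Longrightarrow> (a # x, y) \<in> lang m {[a]} B"
  "(x, y) \<in> lang m A (full_words m) \<Longrightarrow> a < N \<Longrightarrow> (x, a # y) \<in> lang m A (full_words m)"
  "(x, y) \<in> lang m A {tl (E m)} \<Longrightarrow> (x, N # y) \<in> lang m A (full_words m)"
  "(x, y) \<in> lang m A {[]} \<Longrightarrow> (x, a # y) \<in> lang m A {[a]}"
  using full_words_letter full_words_end
  by - ((erule lang_left | erule lang_right); force)+

text \<open>An upper bound for the pairs (sent, received) along paths from \<open>p\<close> to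
  \<open>ini\<close>. On a side whose end mark \<open>N\<close> has passed, \<open>tl (E m)\<close>
  is left; \<open>[]\<close> stands for a side that is finished.\<close>

definition cont :: "mode \<Rightarrow> nat \<Rightarrow> (nat list \<times> nat list) set" where
  "cont m p = (let A = full_words m; B = {tl (E m)} in
     if p = ini then R m
     else if p = 0 \<or> p \<in> Q then lang m A A
     else if p = 1 then lang m B A
     else if p = 2 then lang m A B
     else if p = 3 then lang m A {[]}
     else if p = 4 then lang m B {[]}
     else lang m B B)"

lemma cont_Q: "p \<in> Q \<Longrightarrow> p \<noteq> ini \<Longrightarrow> cont m p = lang m (full_words m) (full_words m)"
  by (simp add: cont_def Let_def)

lemma cont_low:
  "cont m 0 = lang m (full_words m) (full_words m)"
  "cont m 1 = lang m {tl (E m)} (full_words m)"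
  "cont m 2 = lang m (full_words m) {tl (E m)}"
  "cont m 3 = lang m (full_words m) {[]}"
  "cont m 4 = lang m {tl (E m)} {[]}"
  "cont m 5 = lang m {tl (E m)} {tl (E m)}"
  "cont m ini = R m"
  using ini_Q Q_ge by (force simp: cont_def Let_def)+

text \<open>All honest states other than \<open>ini\<close> carry the same language, that of an
  arbitrary unfinished round, and \<open>cont m ini\<close> contains it. Hence honest edges can be
  treated without any knowledge of the simulation.\<close>

lemma cont_step:
  assumes "m \<noteq> Reset" "(p, e, q) \<in> T m" "(x, y) \<in> cont m q"
  shows "(if is_send e then (msg e # x, y) else (x, msg e # y)) \<in> cont m p"
proof (cases "p < 6")
  case True
  then have t: "(p, e, q) \<in> tailT m N ini" using assms T_low by blast
  show ?thesis
  proof (cases m)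
    case Flush
    have E: "tl (E Flush) = []" by (simp add: ends_def)
    show ?thesis using t assms(3) unfolding Flush
      by (auto simp: cont_low[unfolded One_nat_def] E simp flip: lang_Nil
          intro: lang_intros(1,4) lang_intros(2,5)[of _ _ Flush, unfolded E])
  next
    case Block
    have E: "tl (E Block) = [Suc N]" by (simp add: ends_def)
    show ?thesis using t assms(3) unfolding Block
      by (auto simp: cont_low[unfolded One_nat_def] E simp flip: lang_Nil
          intro: lang_intros(1,3,4,6) lang_intros(2,5)[of _ _ Block, unfolded E])
  qed (use assms in auto)
next
  case False
  then have p: "p \<in> Q" using T_source[OF assms(2)] by auto
  have sub: "lang m (full_words m) (full_words m) \<subseteq> cont m p"
    using lang_full cont_Q[OF p] cont_low(7) by (cases "p = ini") auto
  from assms(2) p have "(if is_send e then (msg e # x, y) else (x, msg e # y)) \<in> lang m (full_words m) (full_words m)"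
  proof (cases rule: T_Q_cases)
    case (snd a)
    then have "q \<in> Q" "q \<noteq> ini" "a < N" using HS_D by auto
    then show ?thesis using snd assms(3) cont_Q[of q m] by (auto intro!: lang_intros(1))
  next
    case (dev a c q')
    then show ?thesis using assms(3) cont_low(1)[of m] by (auto intro!: lang_intros(1))
  next
    case (dev_end a q')
    then show ?thesis using assms(3) cont_low(2)[of m] by (auto intro!: lang_intros(2))
  next
    case (rcv b)
    then have "q \<in> Q" "q \<noteq> ini" "b < N" using HR_D by auto
    then show ?thesis using rcv assms(3) cont_Q[of q m] by (auto intro!: lang_intros(4))
  next
    case (rcv_end b q')
    then show ?thesis using assms(1,3) cont_low(3)[of m] by (auto intro!: lang_intros(5))
  qed
  then show ?thesis using sub by blast
qed

lemma path_cont: "path (T m) p w q \<Longrightarrow> m \<noteq> Reset \<Longrightarrow> q = ini \<Longrightarrow> (snds w, rcvs w) \<in> cont m p"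
proof (induction rule: path.induct)
  case (path_nil p)
  then show ?case by (simp add: cont_low rounds_Nil)
next
  case (path_cons p e q w r)
  then show ?case using cont_step[of m p e q "snds w" "rcvs w"] by (cases e) auto
qed

lemma tail_words:
  assumes m: "m \<noteq> Reset" and u: "set u \<subseteq> {..<N}" and v: "set v \<subseteq> {..<N}"
  shows "\<exists>w. path (T m) 0 w ini \<and> snds w = u @ E m \<and> rcvs w = v @ E m" (is ?A)
    and "\<exists>w. path (T m) 1 w ini \<and> snds w = tl (E m) \<and> rcvs w = v @ E m" (is ?B)
    and "\<exists>w. path (T m) 2 w ini \<and> snds w = u @ E m \<and> rcvs w = tl (E m)" (is ?C)
proof -
  have s: "path (T m) p (map Snd u) p" if "\<And>a. a < N \<Longrightarrow> (p, Snd a, p) \<in> tailT m N ini" for p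
    using u that by (intro path_loop T_tail) auto
  have r: "path (T m) p (map Rcv v) p" if "\<And>a. a < N \<Longrightarrow> (p, Rcv a, p) \<in> tailT m N ini" for p
    using v that by (intro path_loop T_tail) auto
  note ap = path_append[OF _ path_cons[OF T_tail]]
  have "?A \<and> ?B \<and> ?C"
  proof (cases m)
    case Flush
    have 1: "path (T m) 1 (map Rcv v @ [Rcv N]) ini"
      by (rule ap[OF r _ path_nil]) (auto simp: Flush)
    have 0: "path (T m) 0 (map Snd u @ Snd N # map Rcv v @ [Rcv N]) ini"
      by (rule ap[OF s _ 1]) (auto simp: Flush)
    have 2: "path (T m) 2 (map Snd u @ [Snd N]) ini"
      by (rule ap[OF s _ path_nil]) (auto simp: Flush)
    show ?thesis by (intro conjI; intro exI conjI; (rule 0 1 2)?) (auto simp: ends_def Flush)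
  next
    case Block
    have 4: "path (T m) 4 [Snd (Suc N)] ini"
      by (rule path_single[OF T_tail]) (auto simp: Block)
    have 3: "path (T m) 3 (map Snd u @ Snd N # [Snd (Suc N)]) ini"
      by (rule ap[OF s _ 4]) (auto simp: Block)
    have 2: "path (T m) 2 (Rcv (Suc N) # map Snd u @ Snd N # [Snd (Suc N)]) ini"
      by (rule path_cons[OF T_tail 3]) (auto simp: Block)
    have 0: "path (T m) 0 (map Rcv v @ Rcv N # Rcv (Suc N) # map Snd u @ Snd N # [Snd (Suc N)]) ini"
      by (rule ap[OF r _ 2]) (auto simp: Block)
    have 5: "path (T m) 5 (Rcv (Suc N) # [Snd (Suc N)]) ini"
      by (rule path_cons[OF T_tail 4]) (auto simp: Block)
    have 1: "path (T m) 1 (map Rcv v @ Rcv N # Rcv (Suc N) # [Snd (Suc N)]) ini"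
      by (rule ap[OF r _ 5]) (auto simp: Block)
    show ?thesis by (intro conjI; intro exI conjI; (rule 0 1 2)?) (auto simp: ends_def Block)
  qed (use m in simp)
  then show ?A ?B ?C by auto
qed

text \<open>The honest machine is followed as long as its prescribed send agrees with the next
  letter of \<open>u\<close>; at the first disagreement a deviation is taken and a tail completes
  both words. Receive states accept every letter of \<open>v\<close>. Each honest step uses up a
  letter, so eventually an exhausted word calls for the end mark.\<close>

lemma round_words:
  assumes "m \<noteq> Reset" "set u \<subseteq> {..<N}" "set v \<subseteq> {..<N}" "p \<in> Q"
  shows "\<exists>w. path (T m) p w ini \<and> snds w = u @ E m \<and> rcvs w = v @ E m"
  using assms
proof (induction "length u + length v" arbitrary: u v p rule: less_induct)
  case less
  note tw = tail_words[OF less.prems(1)]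
  from total[OF less.prems(4)] show ?case
  proof
    assume "\<exists>a q. (p, a, q) \<in> HS"
    then obtain a q where q: "(p, a, q) \<in> HS" by blast
    show ?thesis
    proof (cases u)
      case Nil
      obtain w where "path (T m) 1 w ini" "snds w = tl (E m)" "rcvs w = v @ E m"
        using tw(2) less.prems by blast
      then show ?thesis using T_dev_end[OF q less.prems(1)] Nil ends_Cons[of m]
        by (intro exI[of _ "Snd N # w"]) (auto intro: path.intros)
    next
      case (Cons c u')
      show ?thesis
      proof (cases "c = a")
        case True
        obtain w where "path (T m) q w ini" "snds w = u' @ E m" "rcvs w = v @ E m"
          using less.hyps[of u' v q] less.prems HS_D[OF q] Cons by auto
        then show ?thesis using T_snd[OF q] Cons True
          by (intro exI[of _ "Snd a # w"]) (auto intro: path.intros)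
      next
        case False
        obtain w where "path (T m) 0 w ini" "snds w = u' @ E m" "rcvs w = v @ E m"
          using tw(1)[of u' v] less.prems Cons by auto
        then show ?thesis using T_dev[OF q less.prems(1), of c] Cons False less.prems
          by (intro exI[of _ "Snd c # w"]) (auto intro: path.intros)
      qed
    qed
  next
    assume r: "\<forall>b<N. \<exists>q. (p, b, q) \<in> HR"
    show ?thesis
    proof (cases v)
      case Nil
      obtain q where q: "(p, 0, q) \<in> HR" using r N2 by force
      obtain w where "path (T m) 2 w ini" "snds w = u @ E m" "rcvs w = tl (E m)"
        using tw(3) less.prems by blast
      then show ?thesis using T_rcv_end[OF q less.prems(1)] Nil ends_Cons[of m]
        by (intro exI[of _ "Rcv N # w"]) (auto intro: path.intros)
    next
      case (Cons b v')
      then obtain q where q: "(p, b, q) \<in> HR" using r less.prems by auto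
      obtain w where "path (T m) q w ini" "snds w = u @ E m" "rcvs w = v' @ E m"
        using less.hyps[of u v' q] less.prems HR_D[OF q] Cons by auto
      then show ?thesis using T_rcv[OF q] Cons
        by (intro exI[of _ "Rcv b # w"]) (auto intro: path.intros)
    qed
  qed
qed

text \<open>The right-hand side mentions only \<open>N\<close> and the mode. This is why two
  machines with quite different honest parts become affine.\<close>

lemma loop_words:
  assumes "m \<noteq> Reset"
  shows "{(snds w, rcvs w) | w. path (T m) ini w ini} = rounds N (ends m N)"
proof -
  have "\<exists>w. path (T m) ini w ini \<and> snds w = x \<and> rcvs w = y" if "(x, y) \<in> R m" for x y
    using that
  proof (induction rule: rounds.induct)
    case rounds_Nil
    show ?case by (intro exI[of _ "[]"]) (auto intro: path.intros)
  next
    case (rounds_step u v x y)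
    obtain w1 where w1: "path (T m) ini w1 ini" "snds w1 = u @ E m" "rcvs w1 = v @ E m"
      using round_words[OF assms _ _ ini_Q] rounds_step by blast
    obtain w2 where w2: "path (T m) ini w2 ini" "snds w2 = x" "rcvs w2 = y" using rounds_step by blast
    show ?case using path_append[OF w1(1) w2(1)] w1 w2 by (intro exI[of _ "w1 @ w2"]) auto
  qed
  moreover have "(snds w, rcvs w) \<in> R m" if "path (T m) ini w ini" for w
    using path_cont[OF that assms refl] cont_low(7) by simp
  ultimately show ?thesis by fast
qed

end

section \<open>Disjoint concrete alphabets: even letters for the channel from \<open>F0\<close> to
  \<open>F1\<close>, odd letters for the other one\<close>

fun cz :: "nat \<Rightarrow> act \<Rightarrow> act" where
  "cz j (Snd a) = Snd (2 * a + j)"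
| "cz j (Rcv b) = Rcv (2 * b + (1 - j))"

definition conc :: "nat \<Rightarrow> (nat \<times> act \<times> nat) set \<Rightarrow> (nat \<times> act \<times> nat) set" where
  "conc j T = (\<lambda>(p, e, q). (p, cz j e, q)) ` T"

lemma inj_cz: "cz j e = cz j f \<Longrightarrow> e = f" by (cases e; cases f) auto

lemma is_send_cz [simp]: "is_send (cz j e) = is_send e" by (cases e) auto

lemma conc_iff: "(p, e, q) \<in> conc j T \<longleftrightarrow> (\<exists>e'. e = cz j e' \<and> (p, e', q) \<in> T)"
  by (auto simp: conc_def image_iff) force

lemma path_conc: "path (conc j T) p w q \<longleftrightarrow> (\<exists>w'. w = map (cz j) w' \<and> path T p w' q)"
proof
  assume "path (conc j T) p w q"
  then show "\<exists>w'. w = map (cz j) w' \<and> path T p w' q"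
  proof (induction rule: path.induct)
    case (path_nil p)
    then show ?case by (auto intro: path.intros)
  next
    case (path_cons p e q w r)
    then obtain e' w' where "e = cz j e'" "(p, e', q) \<in> T" "w = map (cz j) w'" "path T q w' r"
      by (auto simp: conc_iff)
    then show ?case by (intro exI[of _ "e' # w'"]) (auto intro: path.intros)
  qed
next
  assume "\<exists>w'. w = map (cz j) w' \<and> path T p w' q"
  then obtain w' where "w = map (cz j) w'" "path T p w' q" by blast
  from this(2) have "path (conc j T) p (map (cz j) w') q"
  proof (induction rule: path.induct)
    case (path_cons p e q w r)
    then have "(p, cz j e, q) \<in> conc j T" by (auto simp: conc_iff)
    then show ?case using path_cons by (auto intro: path.intros)
  qed (auto intro: path.intros)
  then show "path (conc j T) p w q" using \<open>w = _\<close> by simp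
qed

definition alphabet :: "nat \<Rightarrow> nat \<Rightarrow> nat set" where
  "alphabet N j = (\<lambda>a. 2 * a + j) ` {..<N + 2}"

lemma alphabet_disjoint: "alphabet N 0 \<inter> alphabet N 1 = {}"
proof -
  have "2 * a \<noteq> Suc (2 * b)" for a b :: nat by presburger
  then show ?thesis by (auto simp: alphabet_def)
qed

lemma proj_conc:
  assumes "j \<le> 1" "\<And>e. e \<in> set w \<Longrightarrow> msg e < N + 2"
  shows "proj (alphabet N j) (map (cz j) w) = map (\<lambda>a. 2 * a + j) (snds w)"
    and "proj (alphabet N (1 - j)) (map (cz j) w) = map (\<lambda>a. 2 * a + (1 - j)) (rcvs w)"
proof -
  have "2 * a \<noteq> Suc (2 * b)" "Suc (2 * b) \<noteq> 2 * a" for a b :: nat by presburger+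
  then have *: "msg (cz j e) \<in> alphabet N j \<longleftrightarrow> is_send e" "msg (cz j e) \<in> alphabet N (1 - j) \<longleftrightarrow> \<not> is_send e"
    if "msg e < N + 2" for e
    using that assms(1) by (cases e; auto simp: alphabet_def le_Suc_eq image_iff)+
  have 1: "msg (cz j e) = 2 * msg e + j" if "is_send e" for e using that by (cases e) auto
  have 2: "msg (cz j e) = 2 * msg e + (1 - j)" if "\<not> is_send e" for e using that by (cases e) auto
  show "proj (alphabet N j) (map (cz j) w) = map (\<lambda>a. 2 * a + j) (snds w)"
    using assms(2) by (induction w) (auto simp: proj_def snds_def * 1 simp del: One_nat_def)
  show "proj (alphabet N (1 - j)) (map (cz j) w) = map (\<lambda>a. 2 * a + (1 - j)) (rcvs w)"
    using assms(2) by (induction w) (auto simp: proj_def rcvs_def * 2 simp del: One_nat_def)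
qed

context honest
begin

lemma SR_machine_conc:
  assumes "trans F = conc j (T m)" "states F = Q \<union> tails m" "init F = ini"
  shows "SR_machine (alphabet N j) (alphabet N (1 - j)) F"
proof -
  have 1: "(case cz j e of Snd b \<Rightarrow> b \<in> alphabet N j | Rcv b \<Rightarrow> b \<in> alphabet N (1 - j))"
    if "(p, e, q) \<in> T m" for p e q
    using T_letters[OF that] by (cases e) (auto simp: alphabet_def)
  have 2: "p \<in> Q \<union> tails m" "q \<in> Q \<union> tails m" if "(p, e, q) \<in> T m" for p e q
    using T_source[OF that] T_target[OF that] by auto
  have 3: "send_state F p \<or> recv_state F p" for p
  proof -
    from T_send_or_recv[of p m] show ?thesis
    proof
      assume "\<forall>b q. (p, Rcv b, q) \<notin> T m"
      then have "send_state F p" unfolding send_state_def assms conc_iff by (metis act.distinct(1) cz.simps(1) msg.cases)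
      then show ?thesis ..
    next
      assume "\<forall>b q. (p, Snd b, q) \<notin> T m"
      then have "recv_state F p" unfolding recv_state_def assms conc_iff by (metis act.distinct(1) cz.simps(2) msg.cases)
      then show ?thesis ..
    qed
  qed
  have 4: "\<exists>w. path (trans F) p w q" if "p \<in> states F" "q \<in> states F" for p q
    using strongly_connected[of p m q] that unfolding assms connects_def path_conc by blast
  have 5: "q1 = q2" if "(p, e, q1) \<in> trans F" "(p, e, q2) \<in> trans F" for p e q1 q2
    using that inj_cz T_det unfolding assms conc_iff by metis
  have 6: "p \<in> states F \<and> q \<in> states F \<and>
      (case e of Snd b \<Rightarrow> b \<in> alphabet N j | Rcv b \<Rightarrow> b \<in> alphabet N (1 - j))" if "(p, e, q) \<in> trans F" for p e q
    using that 1 2 unfolding assms conc_iff by blast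
  show ?thesis unfolding SR_machine_def
    using 3 4 5 6 ini_Q assms(2,3) by blast
qed

lemma no_send_cycle_conc: "trans F = conc j (T Reset) \<Longrightarrow> \<not> has_send_cycle F"
  using no_send_cycle unfolding has_send_cycle_def
  by (fastforce simp: path_conc list.pred_map comp_def)

lemma loop_projs:
  assumes "m \<noteq> Reset" "j \<le> 1"
  shows "{(proj (alphabet N j) w, proj (alphabet N (1 - j)) w) | w. path (conc j (T m)) ini w ini} =
     {(map (\<lambda>a. 2 * a + j) x, map (\<lambda>a. 2 * a + (1 - j)) y) | x y. (x, y) \<in> rounds N (ends m N)}"
proof -
  have l: "msg e < N + 2" if "path (T m) p w q" "e \<in> set w" for p w q e
    using that by (induction rule: path.induct) (auto dest: T_letters)
  have "{(proj (alphabet N j) w, proj (alphabet N (1 - j)) w) | w. path (conc j (T m)) ini w ini} =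
     {(map (\<lambda>a. 2 * a + j) (snds w), map (\<lambda>a. 2 * a + (1 - j)) (rcvs w)) | w. path (T m) ini w ini}"
  proof -
    have "(proj (alphabet N j) (map (cz j) w), proj (alphabet N (1 - j)) (map (cz j) w)) =
        (map (\<lambda>a. 2 * a + j) (snds w), map (\<lambda>a. 2 * a + (1 - j)) (rcvs w))" if "path (T m) ini w ini" for w
      using proj_conc[OF assms(2), of w N] l[OF that] by simp
    then show ?thesis unfolding path_conc by (auto simp del: One_nat_def) (metis+)
  qed
  also have "\<dots> = {(map (\<lambda>a. 2 * a + j) x, map (\<lambda>a. 2 * a + (1 - j)) y) | x y.
      (x, y) \<in> {(snds w, rcvs w) | w. path (T m) ini w ini}}" by blast
  finally show ?thesis unfolding loop_words[OF assms(1)] .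
qed

end

section \<open>The simulating machine and the echo machine\<close>

text \<open>\<open>pd w s\<close> is the state that has to send \<open>w\<close> before it becomes transducer state \<open>s\<close>; \<open>ch i\<close> has to
  send the rest \<open>0\<^sup>i\<close> of the input and the marker. The names \<open>ch i\<close> are explicit because they have to be
  computed from \<open>i\<close> by a recursive function.\<close>

definition pd :: "nat list \<Rightarrow> nat \<Rightarrow> nat" where "pd w s = 2 * prod_encode (list_encode w, s) + 9"
definition ch :: "nat \<Rightarrow> nat" where "ch i = 2 * i + 8"

lemma pd_eq [simp]: "pd w s = pd w' s' \<longleftrightarrow> w = w' \<and> s = s'"
  by (auto simp: pd_def prod_encode_eq list_encode_eq)

lemma ch_eq [simp]: "ch i = ch j \<longleftrightarrow> i = j" by (simp add: ch_def)

lemma pd_ch_neq [simp]: "pd w s \<noteq> ch i" "ch i \<noteq> pd w s"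
  unfolding pd_def ch_def by presburger+

lemma pd_ch_ge [simp]: "pd w s \<noteq> 7" "7 \<noteq> pd w s" "ch i \<noteq> 7" "7 \<noteq> ch i" "6 \<le> pd w s" "6 \<le> ch i"
  by (auto simp: pd_def ch_def)

locale queue =
  fixes N n :: nat and \<delta> :: "nat \<Rightarrow> nat \<Rightarrow> nat list \<times> nat" and k :: nat
  assumes N_ge: "2 \<le> N" and n_pos: "0 < n" and td: "transducer N n \<delta>"
begin

text \<open>Transducer states outside this set are dropped, since with them the diagram could fail
  to be strongly connected.\<close>

definition S :: "nat set" where
  "S = {s. (\<lambda>s s'. \<exists>b<N. s' = snd (\<delta> s b))\<^sup>*\<^sup>* 0 s}"

text \<open>All suffixes of outputs occur, because a pending word is sent letter by letter.\<close>

definition outs :: "(nat list \<times> nat) set" where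
  "outs = {(w, snd (\<delta> s b)) | w s b. s \<in> S \<and> b < N \<and> (\<exists>y. fst (\<delta> s b) = y @ w)}"

text \<open>The suffix \<open>_fix\<close> marks the parts that do not depend on \<open>k\<close>;
  they are the ones that may be coded into \<open>k\<close>.\<close>

definition HS_fix :: "(nat \<times> nat \<times> nat) set" where
  "HS_fix = insert (ch 0, N - 1, pd [] 0) {(pd (x # w) s, x, pd w s) | x w s. (x # w, s) \<in> outs}"

definition HS0 :: "(nat \<times> nat \<times> nat) set" where
  "HS0 = insert (7, 0, ch k) ({(ch (Suc i), 0, ch i) | i. i < k} \<union> HS_fix)"

definition HR0 :: "(nat \<times> nat \<times> nat) set" where
  "HR0 = {(pd [] s, b, pd (fst (\<delta> s b)) (snd (\<delta> s b))) | s b. s \<in> S \<and> b < N}"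

definition Q_fix :: "nat set" where
  "Q_fix = insert 7 (insert (ch 0) (insert (pd [] 0) {pd w s | w s. (w, s) \<in> outs}))"

definition Q0 :: "nat set" where
  "Q0 = Q_fix \<union> {ch (Suc i) | i. i < k}"

text \<open>The letters that a state still owes to the queue, read off from its name: apart from 7,
  even names are \<open>ch\<close> states and odd names are \<open>pd\<close> states.\<close>

definition pend :: "nat \<Rightarrow> nat list" where
  "pend p = (if p = 7 then replicate (Suc k) 0 @ [N - 1] else
     if even p then replicate ((p - 8) div 2) 0 @ [N - 1]
     else list_decode (fst (prod_decode ((p - 9) div 2))))"

definition base :: "nat \<Rightarrow> nat" where
  "base p = (if p = 7 \<or> even p then 0 else snd (prod_decode ((p - 9) div 2)))"

lemma pend_simps [simp]: "pend 7 = replicate (Suc k) 0 @ [N - 1]"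
  "pend (ch i) = replicate i 0 @ [N - 1]" "pend (pd w s) = w"
  by (auto simp: pend_def ch_def pd_def)

lemma base_simps [simp]: "base 7 = 0" "base (ch i) = 0" "base (pd w s) = s"
  by (auto simp: base_def ch_def pd_def)

lemma S_0: "0 \<in> S" by (simp add: S_def)

lemma S_step: "s \<in> S \<Longrightarrow> b < N \<Longrightarrow> snd (\<delta> s b) \<in> S"
  unfolding S_def mem_Collect_eq by (erule rtranclp.rtrancl_into_rtrancl) blast

lemma S_lt: "s \<in> S \<Longrightarrow> s < n"
  unfolding S_def mem_Collect_eq
  by (induction rule: rtranclp_induct) (use n_pos td in \<open>auto simp: transducer_def\<close>)

lemma outs_S: "(w, s) \<in> outs \<Longrightarrow> s \<in> S" by (auto simp: outs_def S_step)

lemma outs_letters: "(w, s) \<in> outs \<Longrightarrow> set w \<subseteq> {..<N} \<and> length w \<le> 2"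
proof -
  assume "(w, s) \<in> outs"
  then obtain t b y where "t \<in> S" "b < N" "fst (\<delta> t b) = y @ w" by (auto simp: outs_def)
  moreover have "set (fst (\<delta> t b)) \<subseteq> {..<N}" "length (fst (\<delta> t b)) \<le> 2"
    using td S_lt[OF \<open>t \<in> S\<close>] \<open>b < N\<close> by (auto simp: transducer_def)
  ultimately show ?thesis by auto
qed

lemma outs_tl: "(x # w, s) \<in> outs \<Longrightarrow> (w, s) \<in> outs"
  unfolding outs_def by clarsimp (metis append.assoc append_Cons append_Nil)

lemma outs_step: "s \<in> S \<Longrightarrow> b < N \<Longrightarrow> (fst (\<delta> s b), snd (\<delta> s b)) \<in> outs"
  unfolding outs_def mem_Collect_eq by blast

lemma finite_outs: "finite outs"
proof (rule finite_subset)
  show "outs \<subseteq> {w. set w \<subseteq> {..<N} \<and> length w \<le> 2} \<times> {..<n}"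
    using outs_letters outs_S S_lt by auto
  show "finite ({w. set w \<subseteq> {..<N} \<and> length w \<le> 2} \<times> {..<n})"
    by (intro finite_cartesian_product finite_lists_length_le) auto
qed

lemma finite_Q_fix: "finite Q_fix"
proof -
  have "{pd w s | w s. (w, s) \<in> outs} = (\<lambda>(w, s). pd w s) ` outs" by auto
  then show ?thesis using finite_outs by (simp add: Q_fix_def)
qed

lemma HS0_pend: "(p, a, q) \<in> HS0 \<Longrightarrow> pend p = a # pend q \<and> base q = base p"
  by (auto simp: HS0_def HS_fix_def)

lemma HR0_pend: "(p, b, q) \<in> HR0 \<Longrightarrow> pend p = [] \<and> pend q = fst (\<delta> (base p) b) \<and> base q = snd (\<delta> (base p) b)"
  by (auto simp: HR0_def)

lemma Q0_S: "p \<in> Q0 \<Longrightarrow> base p \<in> S"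
  by (auto simp: Q0_def Q_fix_def S_0 outs_S)

lemma Q0_pend_Nil: "p \<in> Q0 \<Longrightarrow> pend p = [] \<Longrightarrow> p = pd [] (base p)"
  by (auto simp: Q0_def Q_fix_def)

lemma Q0_pend_Cons: "p \<in> Q0 \<Longrightarrow> pend p = a # w \<Longrightarrow> \<exists>q. (p, a, q) \<in> HS0"
proof -
  assume p: "p \<in> Q0" "pend p = a # w"
  then consider "p = 7" | "p = ch 0" | s where "p = pd (a # w) s" "(a # w, s) \<in> outs"
    | i where "p = ch (Suc i)" "i < k"
    by (auto simp: Q0_def Q_fix_def)
  then show ?thesis by cases (use p in \<open>auto simp: HS0_def HS_fix_def\<close>)
qed

lemma Q0_recv: "p \<in> Q0 \<Longrightarrow> pend p = [] \<Longrightarrow> b < N \<Longrightarrow> \<exists>q. (p, b, q) \<in> HR0"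
  using Q0_pend_Nil[of p] Q0_S[of p] by (auto simp: HR0_def)

lemma ch_Q0: "i \<le> k \<Longrightarrow> ch i \<in> Q0"
  by (cases i) (auto simp: Q0_def Q_fix_def)

lemma HS0_D: "(p, a, q) \<in> HS0 \<Longrightarrow> p \<in> Q0 \<and> a < N \<and> q \<in> Q0 \<and> q \<noteq> 7"
proof -
  assume "(p, a, q) \<in> HS0"
  then consider "p = 7" "a = 0" "q = ch k" | i where "i < k" "p = ch (Suc i)" "a = 0" "q = ch i"
    | "p = ch 0" "a = N - 1" "q = pd [] 0"
    | x w s where "p = pd (x # w) s" "a = x" "q = pd w s" "(x # w, s) \<in> outs"
    by (auto simp: HS0_def HS_fix_def)
  then show ?thesis
  proof cases
    case 1
    then show ?thesis using N_ge ch_Q0[of k] by (auto simp: Q0_def Q_fix_def)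
  next
    case 2
    then show ?thesis using N_ge ch_Q0[of i] ch_Q0[of "Suc i"] by auto
  next
    case 3
    then show ?thesis using N_ge by (auto simp: Q0_def Q_fix_def)
  next
    case 4
    then show ?thesis using outs_tl[of x w s] outs_letters[of "x # w" s] by (auto simp: Q0_def Q_fix_def)
  qed
qed

lemma pd_Nil_Q0: "s \<in> S \<Longrightarrow> pd [] s \<in> Q0"
proof -
  assume "s \<in> S"
  then have "s = 0 \<or> ([], s) \<in> outs"
    unfolding S_def mem_Collect_eq
  proof (induction rule: rtranclp_induct)
    case (step t s)
    then obtain b where "b < N" "s = snd (\<delta> t b)" by blast
    moreover have "t \<in> S" using step(1) by (simp add: S_def)
    ultimately show ?case by (auto simp: outs_def)
  qed simp
  then show ?thesis by (auto simp: Q0_def Q_fix_def)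
qed

lemma HR0_D: "(p, b, q) \<in> HR0 \<Longrightarrow> p \<in> Q0 \<and> b < N \<and> q \<in> Q0 \<and> q \<noteq> 7"
  using pd_Nil_Q0 outs_step by (fastforce simp: HR0_def Q0_def Q_fix_def)

lemma Q0_reach: "q \<in> Q0 \<Longrightarrow> (\<lambda>p q. \<exists>a. (p, a, q) \<in> HS0 \<union> HR0)\<^sup>*\<^sup>* 7 q"
proof -
  let ?R = "\<lambda>p q. \<exists>a. (p, a, q) \<in> HS0 \<union> HR0"
  have chain: "?R\<^sup>*\<^sup>* 7 (ch i)" if "i \<le> k" for i
    using that
  proof (induction "k - i" arbitrary: i)
    case 0
    then have "i = k" by simp
    moreover have "?R 7 (ch k)" by (auto simp: HS0_def)
    ultimately show ?case by blast
  next
    case (Suc d)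
    then have "?R\<^sup>*\<^sup>* 7 (ch (Suc i))" by (intro Suc.hyps(1)) auto
    moreover have "?R (ch (Suc i)) (ch i)" using Suc by (auto simp: HS0_def)
    ultimately show ?case by (rule rtranclp.rtrancl_into_rtrancl)
  qed
  have "?R (ch 0) (pd [] 0)" by (auto simp: HS0_def HS_fix_def)
  with chain[of 0] have start: "?R\<^sup>*\<^sup>* 7 (pd [] 0)" by (auto intro: rtranclp.rtrancl_into_rtrancl)
  have suff: "?R\<^sup>*\<^sup>* (pd (y @ w) s) (pd w s)" if "(y @ w, s) \<in> outs" for y w s
    using that
  proof (induction y)
    case (Cons x y)
    have "?R (pd (x # y @ w) s) (pd (y @ w) s)" using Cons.prems by (auto simp: HS0_def HS_fix_def)
    moreover have "?R\<^sup>*\<^sup>* (pd (y @ w) s) (pd w s)" using Cons outs_tl by auto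
    ultimately show ?case by (simp add: converse_rtranclp_into_rtranclp)
  qed simp
  have out: "?R\<^sup>*\<^sup>* 7 (pd w (snd (\<delta> t b)))"
    if "?R\<^sup>*\<^sup>* 7 (pd [] t)" "t \<in> S" "b < N" "fst (\<delta> t b) = y @ w" for t b y w
  proof -
    have "(pd [] t, b, pd (fst (\<delta> t b)) (snd (\<delta> t b))) \<in> HR0" using that(2,3) by (auto simp: HR0_def)
    then have "?R (pd [] t) (pd (fst (\<delta> t b)) (snd (\<delta> t b)))" by blast
    moreover have "?R\<^sup>*\<^sup>* (pd (y @ w) (snd (\<delta> t b))) (pd w (snd (\<delta> t b)))"
      using suff outs_step[of t b] that by simp
    ultimately show ?thesis using that by (metis (no_types, lifting) rtranclp.rtrancl_into_rtrancl rtranclp_trans)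
  qed
  have states: "?R\<^sup>*\<^sup>* 7 (pd [] s)" if "s \<in> S" for s
    using that unfolding S_def mem_Collect_eq
  proof (induction rule: rtranclp_induct)
    case (step t s)
    then show ?case using out[of t _ "fst (\<delta> t _)" "[]"] by (auto simp: S_def)
  qed (rule start)
  assume "q \<in> Q0"
  then consider "q = 7" | i where "i \<le> k" "q = ch i" | "q = pd [] 0" | w s where "(w, s) \<in> outs" "q = pd w s"
    by (auto simp: Q0_def Q_fix_def)
  then show ?thesis
  proof cases
    case 4
    then show ?thesis using out states by (auto simp: outs_def)
  qed (use chain start in auto)
qed

text \<open>Each send shortens the pending word, so its length serves as \<open>mu\<close>.\<close>

sublocale f0: honest N Q0 HS0 HR0 7 "\<lambda>p. length (pend p)"
proof
  show "finite Q0" using finite_Q_fix by (auto simp: Q0_def)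
  show "6 \<le> q" if "q \<in> Q0" for q using that by (auto simp: Q0_def Q_fix_def)
  show "7 \<in> Q0" by (simp add: Q0_def Q_fix_def)
  show "(\<exists>a q. (p, a, q) \<in> HS0) \<or> (\<forall>b<N. \<exists>q. (p, b, q) \<in> HR0)" if "p \<in> Q0" for p
    using that Q0_pend_Cons[of p] Q0_recv[of p] by (cases "pend p") blast+
  show "(p, b, q') \<notin> HR0" if "(p, a, q) \<in> HS0" for p a q b q'
    using HS0_pend[OF that] HR0_pend[of p b q'] by auto
  show "a' = a \<and> q' = q" if "(p, a, q) \<in> HS0" "(p, a', q') \<in> HS0" for p a q a' q'
    using that by (auto simp: HS0_def HS_fix_def)
  show "q' = q" if "(p, b, q) \<in> HR0" "(p, b, q') \<in> HR0" for p b q q'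
    using that by (auto simp: HR0_def)
  show "length (pend q) < length (pend p)" if "(p, a, q) \<in> HS0" for p a q
    using HS0_pend[OF that] by simp
  show "HS0 \<noteq> {}" by (simp add: HS0_def)
qed (use N_ge HS0_D HR0_D Q0_reach in blast)+

end

text \<open>State \<open>b + 8\<close> holds the letter \<open>b\<close>. States 6 and 7 both wait
  for a letter; 6 is a copy of 7 that is used only as initial state, because honest steps must not
  return there.\<close>

definition HS1 :: "nat \<Rightarrow> (nat \<times> nat \<times> nat) set" where "HS1 N = {(b + 8, b, 7) | b. b < N}"
definition HR1 :: "nat \<Rightarrow> (nat \<times> nat \<times> nat) set" where "HR1 N = {(p, b, b + 8) | p b. (p = 6 \<or> p = 7) \<and> b < N}"
definition Q1 :: "nat \<Rightarrow> nat set" where "Q1 N = {6..<N + 8}"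

definition hand :: "nat \<Rightarrow> nat list" where "hand p = (if 8 \<le> p then [p - 8] else [])"

lemma HS1_hand: "(p, a, q) \<in> HS1 N \<Longrightarrow> hand p = [a] \<and> hand q = []"
  by (auto simp: HS1_def hand_def)

lemma HR1_hand: "(p, b, q) \<in> HR1 N \<Longrightarrow> hand p = [] \<and> hand q = [b]"
  by (auto simp: HR1_def hand_def)

lemma honest_echo: "2 \<le> N \<Longrightarrow> honest N (Q1 N) (HS1 N) (HR1 N) 6 (\<lambda>p. length (hand p))"
proof
  assume N: "2 \<le> N"
  show "(\<exists>a q. (p, a, q) \<in> HS1 N) \<or> (\<forall>b<N. \<exists>q. (p, b, q) \<in> HR1 N)" if "p \<in> Q1 N" for p
  proof (cases "p < 8")
    case True
    then show ?thesis using that by (auto simp: HR1_def Q1_def)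
  next
    case False
    then have "p = (p - 8) + 8" "p - 8 < N" using that by (auto simp: Q1_def)
    then show ?thesis unfolding HS1_def by blast
  qed
  show "(\<lambda>p q. \<exists>a. (p, a, q) \<in> HS1 N \<union> HR1 N)\<^sup>*\<^sup>* 6 q" if "q \<in> Q1 N" for q
  proof -
    let ?R = "\<lambda>p q. \<exists>a. (p, a, q) \<in> HS1 N \<union> HR1 N"
    have 8: "?R\<^sup>*\<^sup>* 6 (b + 8)" if "b < N" for b using that by (intro r_into_rtranclp) (auto simp: HR1_def)
    have "?R 8 7" using N by (auto simp: HS1_def intro!: exI[of _ 0])
    then have 7: "?R\<^sup>*\<^sup>* 6 7" using 8[of 0] N by (auto intro: rtranclp.rtrancl_into_rtrancl)
    have "q = 6 \<or> q = 7 \<or> (\<exists>b<N. q = b + 8)" using that by (auto simp: Q1_def intro!: exI[of _ "q - 8"])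
    then show ?thesis using 7 8 by auto
  qed
  show "HS1 N \<noteq> {}" using N by (auto simp: HS1_def intro!: exI[of _ 0])
qed (auto simp: HS1_def HR1_def Q1_def hand_def)

section \<open>Global behaviour\<close>

type_synonym config = "nat \<times> nat \<times> nat list \<times> nat list"

inductive cstep :: "(nat \<times> act \<times> nat) set \<Rightarrow> (nat \<times> act \<times> nat) set \<Rightarrow> config \<Rightarrow> config \<Rightarrow> bool" for T0 T1 where
  snd0: "(p0, Snd b, q0) \<in> T0 \<Longrightarrow> cstep T0 T1 (p0, p1, ua, ub) (q0, p1, ua @ [b], ub)"
| rcv0: "(p0, Rcv b, q0) \<in> T0 \<Longrightarrow> cstep T0 T1 (p0, p1, ua, b # ub) (q0, p1, ua, ub)"
| snd1: "(p1, Snd b, q1) \<in> T1 \<Longrightarrow> cstep T0 T1 (p0, p1, ua, ub) (p0, q1, ua, ub @ [b])"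
| rcv1: "(p1, Rcv b, q1) \<in> T1 \<Longrightarrow> cstep T0 T1 (p0, p1, b # ua, ub) (p0, q1, ua, ub)"

fun gconf :: "config \<Rightarrow> gstate" where
  "gconf (p0, p1, ua, ub) = ((p0, p1), (map (\<lambda>a. 2 * a) ua, map (\<lambda>b. Suc (2 * b)) ub))"

lemma conc_Snd: "(p, Snd b, q) \<in> conc j T \<longleftrightarrow> (\<exists>a. b = 2 * a + j \<and> (p, Snd a, q) \<in> T)"
  unfolding conc_iff
proof (rule iffI)
  assume "\<exists>e'. Snd b = cz j e' \<and> (p, e', q) \<in> T"
  then obtain e' where "Snd b = cz j e'" "(p, e', q) \<in> T" by blast
  then show "\<exists>a. b = 2 * a + j \<and> (p, Snd a, q) \<in> T" by (cases e') auto
qed (metis cz.simps(1))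

lemma conc_Rcv: "(p, Rcv b, q) \<in> conc j T \<longleftrightarrow> (\<exists>a. b = 2 * a + (1 - j) \<and> (p, Rcv a, q) \<in> T)"
  unfolding conc_iff
proof (rule iffI)
  assume "\<exists>e'. Rcv b = cz j e' \<and> (p, e', q) \<in> T"
  then obtain e' where "Rcv b = cz j e'" "(p, e', q) \<in> T" by blast
  then show "\<exists>a. b = 2 * a + (1 - j) \<and> (p, Rcv a, q) \<in> T" by (cases e') auto
qed (metis cz.simps(2))

locale conc_pair =
  fixes P :: sr_pair and T0 T1 :: "(nat \<times> act \<times> nat) set" and i0 i1 :: nat
  assumes t0: "trans (F0 P) = conc 0 T0" and t1: "trans (F1 P) = conc 1 T1"
    and i0: "init (F0 P) = i0" and i1: "init (F1 P) = i1"
begin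

abbreviation reach where "reach \<equiv> (cstep T0 T1)\<^sup>*\<^sup>* (i0, i1, [], [])"

lemma gstep_gconf: "gstep P (gconf c) s \<Longrightarrow> \<exists>d. s = gconf d \<and> cstep T0 T1 c d"
proof -
  obtain p0 p1 ua ub where c: "c = (p0, p1, ua, ub)" by (metis prod_cases4)
  assume "gstep P (gconf c) s"
  then have "gstep P ((p0, p1), (map (\<lambda>a. 2 * a) ua, map (\<lambda>b. Suc (2 * b)) ub)) s" by (simp add: c)
  then show ?thesis
  proof (cases rule: gstep.cases)
    case (send0 b q0)
    then obtain a where "b = 2 * a" "(p0, Snd a, q0) \<in> T0" unfolding t0 conc_Snd by auto
    then show ?thesis using send0 by (intro exI[of _ "(q0, p1, ua @ [a], ub)"]) (auto simp: c intro: cstep.intros)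
  next
    case (recv0 b q0 xb)
    then obtain a where "b = 2 * a + 1" "(p0, Rcv a, q0) \<in> T0" unfolding t0 conc_Rcv by auto
    moreover obtain a' ub' where "ub = a' # ub'" "b = Suc (2 * a')" "xb = map (\<lambda>b. Suc (2 * b)) ub'" using recv0 by auto
    ultimately show ?thesis using recv0 by (intro exI[of _ "(q0, p1, ua, ub')"]) (auto simp: c intro: cstep.intros)
  next
    case (send1 b q1)
    then obtain a where "b = 2 * a + 1" "(p1, Snd a, q1) \<in> T1" unfolding t1 conc_Snd by auto
    then show ?thesis using send1 by (intro exI[of _ "(p0, q1, ua, ub @ [a])"]) (auto simp: c intro: cstep.intros)
  next
    case (recv1 b q1 xa)
    then obtain a where "b = 2 * a" "(p1, Rcv a, q1) \<in> T1" unfolding t1 conc_Rcv by auto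
    moreover obtain a' ua' where "ua = a' # ua'" "b = 2 * a'" "xa = map (\<lambda>b. 2 * b) ua'" using recv1 by auto
    ultimately show ?thesis using recv1 by (intro exI[of _ "(p0, q1, ua', ub)"]) (auto simp: c intro: cstep.intros)
  qed
qed

lemma cstep_gconf: "cstep T0 T1 c d \<Longrightarrow> gstep P (gconf c) (gconf d)"
proof (induction rule: cstep.induct)
  case (snd0 p0 b q0 p1 ua ub)
  then have "(p0, Snd (2 * b), q0) \<in> trans (F0 P)" unfolding t0 conc_Snd by auto
  from gstep.send0[OF this] show ?case by simp
next
  case (rcv0 p0 b q0 p1 ua ub)
  then have "(p0, Rcv (Suc (2 * b)), q0) \<in> trans (F0 P)" unfolding t0 conc_Rcv by auto
  from gstep.recv0[OF this] show ?case by simp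
next
  case (snd1 p1 b q1 p0 ua ub)
  then have "(p1, Snd (Suc (2 * b)), q1) \<in> trans (F1 P)" unfolding t1 conc_Snd by auto
  from gstep.send1[OF this] show ?case by simp
next
  case (rcv1 p1 b q1 p0 ua ub)
  then have "(p1, Rcv (2 * b), q1) \<in> trans (F1 P)" unfolding t1 conc_Rcv by auto
  from gstep.recv1[OF this] show ?case by simp
qed

lemma reachable_iff: "reachable P s \<longleftrightarrow> (\<exists>c. reach c \<and> s = gconf c)"
proof
  have init: "initial P = gconf (i0, i1, [], [])" by (simp add: initial_def i0 i1)
  show "\<exists>c. reach c \<and> s = gconf c" if "reachable P s"
    using that unfolding reachable_def
  proof (induction rule: rtranclp_induct)
    case base
    then show ?case using init by blast
  next
    case (step s t)
    then show ?case using gstep_gconf by (meson rtranclp.rtrancl_into_rtrancl)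
  qed
  assume "\<exists>c. reach c \<and> s = gconf c"
  then obtain c where c: "reach c" "s = gconf c" by blast
  from c(1) show "reachable P s" unfolding reachable_def init c(2)
  proof (induction rule: rtranclp_induct)
    case (step c d)
    show ?case using step.IH cstep_gconf[OF step(2)] by (rule rtranclp.rtrancl_into_rtrancl)
  qed simp
qed

lemma recv_state_iff:
  "recv_state (F0 P) p \<longleftrightarrow> (\<forall>b q. (p, Snd b, q) \<notin> T0)"
  "recv_state (F1 P) p \<longleftrightarrow> (\<forall>b q. (p, Snd b, q) \<notin> T1)"
  unfolding recv_state_def t0 t1 conc_Snd by blast+

lemma deadlock_free_iff: "deadlock_free P \<longleftrightarrow>
   \<not> (\<exists>p0 p1. reach (p0, p1, [], []) \<and> (\<forall>b q. (p0, Snd b, q) \<notin> T0) \<and> (\<forall>b q. (p1, Snd b, q) \<notin> T1))"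
proof -
  have "deadlocked P (gconf c) \<longleftrightarrow> (\<exists>p0 p1. c = (p0, p1, [], []) \<and> (\<forall>b q. (p0, Snd b, q) \<notin> T0) \<and> (\<forall>b q. (p1, Snd b, q) \<notin> T1))" for c
    by (cases c rule: gconf.cases) (auto simp: deadlocked_def recv_state_iff)
  then show ?thesis unfolding deadlock_free_def reachable_iff by metis
qed

lemma bounded_channel_iff: "bounded_channel P \<longleftrightarrow>
   (\<exists>B. \<forall>p0 p1 ua ub. reach (p0, p1, ua, ub) \<longrightarrow> length ua + length ub \<le> B)"
proof -
  have "(\<forall>s. reachable P s \<longrightarrow> length (fst (snd s)) + length (snd (snd s)) \<le> B) \<longleftrightarrow>
      (\<forall>c. reach c \<longrightarrow> length (fst (snd (gconf c))) + length (snd (snd (gconf c))) \<le> B)" for B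
    unfolding reachable_iff by blast
  also have "\<dots> B \<longleftrightarrow> (\<forall>p0 p1 ua ub. reach (p0, p1, ua, ub) \<longrightarrow> length ua + length ub \<le> B)" for B
    by (simp add: split_paired_All)
  finally show ?thesis unfolding bounded_channel_def by simp
qed

end

locale sim = queue N n \<delta> k + conc_pair P "wrapT m N 7 HS0 HR0" "wrapT m N 6 (HS1 N) (HR1 N)" 7 6
  for N n \<delta> k m P

sublocale queue \<subseteq> f1: honest N "Q1 N" "HS1 N" "HR1 N" 6 "\<lambda>p. length (hand p)"
  using honest_echo N_ge .

context sim
begin

abbreviation A0 where "A0 \<equiv> wrapT m N 7 HS0 HR0"
abbreviation A1 where "A1 \<equiv> wrapT m N 6 (HS1 N) (HR1 N)"
abbreviation W0 where "W0 \<equiv> replicate (Suc k) 0 @ [N - 1]"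
abbreviation qreach where "qreach \<equiv> (qstep \<delta>)\<^sup>*\<^sup>* (0, W0)"

lemma qreach_letters: "qreach c \<Longrightarrow> fst c \<in> S \<and> set (snd c) \<subseteq> {..<N}"
proof (induction rule: rtranclp_induct)
  case base
  then show ?case using N_ge S_0 by auto
next
  case (step c d)
  obtain s b W where c: "c = (s, b # W)" and d: "d = (snd (\<delta> s b), W @ fst (\<delta> s b))"
    using step(2) by (auto elim: qstep.cases)
  then have "s \<in> S" "b < N" using step.IH by auto
  then show ?case using S_step outs_letters[OF outs_step] step.IH c d by auto
qed

text \<open>The circular queue consists of the channel \<open>ub\<close>, the letter held by the echo machine, the channel
  \<open>ua\<close> and the letters still to be sent by the simulating machine. It only changes when the latter
  receives a letter.\<close>

definition good :: "config \<Rightarrow> bool" where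
  "good = (\<lambda>(p0, p1, ua, ub). p0 \<in> Q0 \<and> p1 \<in> Q1 N \<and> qreach (base p0, ub @ hand p1 @ ua @ pend p0))"

lemma good_init: "good (7, 6, [], [])"
  using f0.ini_Q f1.ini_Q by (simp add: good_def hand_def)

lemma good_letters: "good (p0, p1, ua, ub) \<Longrightarrow> set ua \<subseteq> {..<N} \<and> set ub \<subseteq> {..<N}"
  using qreach_letters[of "(base p0, ub @ hand p1 @ ua @ pend p0)"] by (simp add: good_def)

definition deviates :: "nat \<Rightarrow> nat \<Rightarrow> bool" where
  "deviates c q \<longleftrightarrow> m \<noteq> Reset \<and> (c < N \<and> q = 0 \<or> c = N \<and> q = 1)"

text \<open>An honest send only moves the head of \<open>pend p0\<close> to the end of
  \<open>ua\<close>, which leaves the circular word as it is.\<close>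

lemma good_snd0:
  assumes "good (p0, p1, ua, ub)" "(p0, Snd c, q0) \<in> A0"
  shows "good (q0, p1, ua @ [c], ub) \<or> deviates c q0"
proof -
  have "p0 \<in> Q0" using assms by (simp add: good_def)
  with assms(2) show ?thesis
  proof (cases rule: f0.T_Q_cases)
    case (snd a)
    then show ?thesis using assms(1) HS0_pend[of p0 a q0] HS0_D[of p0 a q0] by (simp add: good_def)
  qed (auto simp: deviates_def)
qed

lemma good_snd1:
  assumes "good (p0, p1, ua, ub)" "(p1, Snd c, q1) \<in> A1"
  shows "good (p0, q1, ua, ub @ [c]) \<or> deviates c q1"
proof -
  have "p1 \<in> Q1 N" using assms by (simp add: good_def)
  with assms(2) show ?thesis
  proof (cases rule: f1.T_Q_cases)
    case (snd a)
    then show ?thesis using assms(1) HS1_hand[of p1 a q1] f1.HS_D[of p1 a q1] by (simp add: good_def)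
  qed (auto simp: deviates_def)
qed

text \<open>The received letter is the head of the circular word, so an honest receive is exactly
  one \<open>qstep\<close>. The end mark is ruled out because all letters of a good configuration
  are below \<open>N\<close>.\<close>

lemma good_rcv0:
  assumes "good (p0, p1, ua, c # ub)" "(p0, Rcv c, q0) \<in> A0"
  shows "good (q0, p1, ua, ub)"
proof -
  have p: "p0 \<in> Q0" using assms by (simp add: good_def)
  have "c < N" using good_letters[OF assms(1)] by simp
  from assms(2) p show ?thesis
  proof (cases rule: f0.T_Q_cases)
    case (rcv b)
    then have "(p0, c, q0) \<in> HR0" by simp
    note h = HR0_pend[OF this] HR0_D[OF this]
    have "qreach (base p0, c # ub @ hand p1 @ ua)" using assms(1) h by (simp add: good_def)
    moreover have "qstep \<delta> (base p0, c # ub @ hand p1 @ ua) (base q0, ub @ hand p1 @ ua @ pend q0)"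
      using h by (intro qstep_intro) auto
    ultimately have "qreach (base q0, ub @ hand p1 @ ua @ pend q0)" by (rule rtranclp.rtrancl_into_rtrancl)
    then show ?thesis using assms(1) h by (simp add: good_def)
  qed (use \<open>c < N\<close> in auto)
qed

lemma good_rcv1:
  assumes "good (p0, p1, c # ua, ub)" "(p1, Rcv c, q1) \<in> A1"
  shows "good (p0, q1, ua, ub)"
proof -
  have p: "p1 \<in> Q1 N" using assms by (simp add: good_def)
  have "c < N" using good_letters[OF assms(1)] by simp
  from assms(2) p show ?thesis
  proof (cases rule: f1.T_Q_cases)
    case (rcv b)
    then show ?thesis using assms(1) HR1_hand[of p1 b q1] f1.HR_D[of p1 b q1] by (simp add: good_def)
  qed (use \<open>c < N\<close> in auto)
qed

lemma good_reset: "reach c \<Longrightarrow> m = Reset \<Longrightarrow> good c"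
proof (induction rule: rtranclp_induct)
  case (step c d)
  have c: "good c" using step by simp
  have nd: "\<not> deviates c q" for c q unfolding deviates_def using step.prems by blast
  from step(2) show ?case
  proof cases
    case snd0
    then show ?thesis using c good_snd0 nd by blast
  next
    case rcv0
    then show ?thesis using c good_rcv0 by blast
  next
    case snd1
    then show ?thesis using c good_snd1 nd by blast
  next
    case rcv1
    then show ?thesis using c good_rcv1 by blast
  qed
qed (use good_init in auto)

lemma recv_Q0: "p \<in> Q0 \<Longrightarrow> \<forall>b q. (p, Snd b, q) \<notin> A0 \<Longrightarrow> pend p = []"
proof -
  assume p: "p \<in> Q0" "\<forall>b q. (p, Snd b, q) \<notin> A0"
  then have "\<nexists>a q. (p, a, q) \<in> HS0" using f0.T_snd by blast
  then have "\<forall>b<N. \<exists>q. (p, b, q) \<in> HR0" using f0.total[OF p(1)] by blast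
  then obtain q where "(p, 0, q) \<in> HR0" using N_ge by fastforce
  then show ?thesis using HR0_pend by blast
qed

lemma recv_Q1: "p \<in> Q1 N \<Longrightarrow> \<forall>b q. (p, Snd b, q) \<notin> A1 \<Longrightarrow> hand p = []"
proof -
  assume p: "p \<in> Q1 N" "\<forall>b q. (p, Snd b, q) \<notin> A1"
  then have "\<nexists>a q. (p, a, q) \<in> HS1 N" using f1.T_snd by blast
  then have "\<forall>b<N. \<exists>q. (p, b, q) \<in> HR1 N" using f1.total[OF p(1)] by blast
  then obtain q where "(p, 0, q) \<in> HR1 N" using N_ge by fastforce
  then show ?thesis using HR1_hand by blast
qed

text \<open>Receive states have nothing pending and nothing in hand, so with empty channels the
  circular word is empty.\<close>

lemma good_deadlock:
  assumes "good (p0, p1, [], [])" "\<forall>b q. (p0, Snd b, q) \<notin> A0" "\<forall>b q. (p1, Snd b, q) \<notin> A1"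
  shows "qreach (base p0, [])"
  using assms recv_Q0[of p0] recv_Q1[of p1] by (simp add: good_def)

lemma send_all:
  assumes "reach (p0, p1, ua, ub)" "p0 \<in> Q0"
  shows "reach (pd [] (base p0), p1, ua @ pend p0, ub)"
  using assms
proof (induction "pend p0" arbitrary: p0 ua)
  case Nil
  then show ?case using Q0_pend_Nil[of p0] by simp
next
  case (Cons a w)
  obtain q where q: "(p0, a, q) \<in> HS0" using Q0_pend_Cons Cons by metis
  have "reach (q, p1, ua @ [a], ub)"
    using Cons.prems(1) cstep.snd0[OF f0.T_snd[OF q]] by (rule rtranclp.rtrancl_into_rtrancl)
  from Cons.hyps(1)[OF _ this] show ?case
    using HS0_pend[OF q] HS0_D[OF q] Cons.hyps(2) by auto
qed

lemma echo_all:
  assumes "reach (p0, p1, ua, ub)" "p1 = 6 \<or> p1 = 7" "set ua \<subseteq> {..<N}"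
  shows "\<exists>p1'. (p1' = 6 \<or> p1' = 7) \<and> reach (p0, p1', [], ub @ ua)"
  using assms
proof (induction ua arbitrary: p1 ub)
  case (Cons b ua)
  have r: "(p1, b, b + 8) \<in> HR1 N" "(b + 8, b, 7) \<in> HS1 N" using Cons.prems by (auto simp: HR1_def HS1_def)
  have "reach (p0, b + 8, ua, ub)"
    using Cons.prems(1) cstep.rcv1[OF f1.T_rcv[OF r(1)]] by (rule rtranclp.rtrancl_into_rtrancl)
  then have "reach (p0, 7, ua, ub @ [b])"
    using cstep.snd1[OF f1.T_snd[OF r(2)]] by (rule rtranclp.rtrancl_into_rtrancl)
  from Cons.IH[OF this] show ?case using Cons.prems by auto
qed auto

text \<open>A canonical schedule: after each receive the simulating machine sends all it owes and
  the echo machine passes all of \<open>ua\<close> on, so that the whole queue lies in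
  \<open>ub\<close> again.\<close>

lemma qreach_reach: "qreach c \<Longrightarrow> \<exists>p1. (p1 = 6 \<or> p1 = 7) \<and> reach (pd [] (fst c), p1, [], snd c)"
proof (induction rule: rtranclp_induct)
  case base
  have "reach (pd [] 0, 6, W0, [])" using send_all[OF _ f0.ini_Q, of 6 "[]" "[]"] by simp
  moreover have "set W0 \<subseteq> {..<N}" using N_ge by auto
  ultimately show ?case using echo_all[of "pd [] 0" 6 W0 "[]"] by simp
next
  case (step c d)
  obtain s b W where c: "c = (s, b # W)" and d: "d = (snd (\<delta> s b), W @ fst (\<delta> s b))"
    using step(2) by (auto elim: qstep.cases)
  obtain p1 where p1: "p1 = 6 \<or> p1 = 7" "reach (pd [] s, p1, [], b # W)" using step.IH c by auto
  have sb: "s \<in> S" "b < N" using qreach_letters[OF step(1)] c by auto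
  then have r: "(pd [] s, b, pd (fst (\<delta> s b)) (snd (\<delta> s b))) \<in> HR0" by (auto simp: HR0_def)
  have "reach (pd (fst (\<delta> s b)) (snd (\<delta> s b)), p1, [], W)"
    using p1(2) cstep.rcv0[OF f0.T_rcv[OF r]] by (rule rtranclp.rtrancl_into_rtrancl)
  from send_all[OF this] have "reach (pd [] (snd (\<delta> s b)), p1, fst (\<delta> s b), W)"
    using HR0_D[OF r] by simp
  from echo_all[OF this p1(1)] show ?case using outs_letters[OF outs_step[OF sb]] d by auto
qed

lemma qreach_deadlock: "qreach (s, []) \<Longrightarrow> \<not> deadlock_free P"
proof -
  assume q: "qreach (s, [])"
  then obtain p1 where p1: "p1 = 6 \<or> p1 = 7" "reach (pd [] s, p1, [], [])" using qreach_reach by fastforce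
  have s: "s \<in> S" using qreach_letters[OF q] by simp
  obtain q where "(pd [] s, 0, q) \<in> HR0" using Q0_recv[OF pd_Nil_Q0[OF s], of 0] N_ge by auto
  then have "(pd [] s, Snd b, q) \<notin> A0" for b q
    using f0.T_send_or_recv[of "pd [] s" m] f0.T_rcv[of "pd [] s" 0 _ m] by blast
  moreover have "(p1, 0, 0 + 8) \<in> HR1 N" using p1 N_ge by (auto simp: HR1_def)
  then have "(p1, Snd b, q) \<notin> A1" for b q
    using f1.T_send_or_recv[of p1 m] f1.T_rcv[of p1 0 _ m] by blast
  ultimately show ?thesis using p1 unfolding deadlock_free_iff by blast
qed

lemma qreach_unbounded: "bounded_channel P \<Longrightarrow> \<exists>B. \<forall>s W. qreach (s, W) \<longrightarrow> length W \<le> B"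
proof -
  assume "bounded_channel P"
  then obtain B where B: "\<And>p0 p1 ua ub. reach (p0, p1, ua, ub) \<Longrightarrow> length ua + length ub \<le> B"
    unfolding bounded_channel_iff by blast
  have "length W \<le> B" if q: "qreach (s, W)" for s W
  proof -
    obtain p1 where "reach (pd [] s, p1, [], W)" using qreach_reach[OF q] by auto
    from B[OF this] show ?thesis by simp
  qed
  then show ?thesis by blast
qed

lemma reset_deadlock_free: "m = Reset \<Longrightarrow> (\<And>s. \<not> qreach (s, [])) \<Longrightarrow> deadlock_free P"
  unfolding deadlock_free_iff using good_reset good_deadlock by blast

lemma reset_bounded: "m = Reset \<Longrightarrow> (\<And>s W. qreach (s, W) \<Longrightarrow> length W \<le> B) \<Longrightarrow> bounded_channel P"
proof -
  assume m: "m = Reset" and B: "\<And>s W. qreach (s, W) \<Longrightarrow> length W \<le> B"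
  have "length ua + length ub \<le> B" if "reach (p0, p1, ua, ub)" for p0 p1 ua ub
  proof -
    have "qreach (base p0, ub @ hand p1 @ ua @ pend p0)" using good_reset[OF that m] by (simp add: good_def)
    from B[OF this] show ?thesis by simp
  qed
  then show ?thesis unfolding bounded_channel_iff by blast
qed

end

section \<open>Single steps of a machine in the modes \<open>Flush\<close> and
  \<open>Block\<close>\<close>

context honest
begin

text \<open>In \<open>Flush\<close> mode, \<open>u\<close> can be the part of the output channel written in the current round.\<close>

definition chan :: "nat \<Rightarrow> nat list \<Rightarrow> bool" where
  "chan p u \<longleftrightarrow> (p \<in> Q \<or> p = 0) \<and> set u \<subseteq> {..<N} \<or> p = 1 \<and> (\<exists>v. u = v @ [N] \<and> set v \<subseteq> {..<N})"

lemma low_notin_Q: "p < 6 \<Longrightarrow> p \<notin> Q"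
  using Q_ge by force

text \<open>States 0 and 1 have no send edge back into \<open>Q\<close>; hence a send that ends in
  \<open>Q\<close> started there and was honest, which keeps \<open>good\<close> alive.\<close>

lemma flush_snd:
  assumes "(p, Snd a, q) \<in> T Flush" "chan p u"
  shows "chan q (u @ [a]) \<and> (q \<in> Q \<longrightarrow> (p, a, q) \<in> HS)"
proof (cases "p \<in> Q")
  case True
  have u: "set u \<subseteq> {..<N}" using assms(2) True low_notin_Q[of 1] by (auto simp: chan_def)
  from assms(1) True show ?thesis
    by (cases rule: T_Q_cases) (use u low_notin_Q[of 0] low_notin_Q[of 1] HS_D in \<open>auto simp: chan_def\<close>)
next
  case False
  then have "p = 0 \<or> p = 1" using assms(2) by (auto simp: chan_def)
  moreover from this have "(p, Snd a, q) \<in> tailT Flush N ini" using assms(1) T_low by auto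
  ultimately show ?thesis using assms(2) low_notin_Q[of 0] low_notin_Q[of 1] by (auto simp: chan_def)
qed

lemma flush_rcv:
  assumes "(p, Rcv b, q) \<in> T Flush" "chan p u"
  shows "b < N \<and> ((p, b, q) \<in> HR \<or> p = 1 \<and> q = 1) \<or> b = N \<and> (p \<in> Q \<and> q = 2 \<or> p = 1 \<and> q = ini)"
proof (cases "p \<in> Q")
  case True
  from assms(1) True show ?thesis
    by (cases rule: T_Q_cases) (use True HR_D in auto)
next
  case False
  then have "p = 0 \<or> p = 1" using assms(2) by (auto simp: chan_def)
  moreover from this have "(p, Rcv b, q) \<in> tailT Flush N ini" using assms(1) T_low by auto
  ultimately show ?thesis by auto
qed

lemma flush_2: "(2, e, q) \<in> T Flush \<Longrightarrow> (\<exists>a<N. e = Snd a \<and> q = 2) \<or> e = Snd N \<and> q = ini"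
  using T_low[of 2 e q Flush] by auto

lemma flush_1: "(1, e, q) \<in> T Flush \<Longrightarrow> (\<exists>a<N. e = Rcv a \<and> q = 1) \<or> e = Rcv N \<and> q = ini"
  using T_low[of 1 e q Flush] by auto

lemma chan_Cons: "chan p (b # u) \<Longrightarrow> b < N \<Longrightarrow> chan p u"
  by (auto simp: chan_def Cons_eq_append_conv)

lemma chan_Cons_end: "chan p (N # u) \<Longrightarrow> p = 1 \<and> u = []"
  by (auto simp: chan_def Cons_eq_append_conv)

lemma chan_1: "chan 1 u \<longleftrightarrow> (\<exists>v. u = v @ [N] \<and> set v \<subseteq> {..<N})"
  using low_notin_Q[of 0] low_notin_Q[of 1] by (auto simp: chan_def)

lemma chan_Q: "p \<in> Q \<Longrightarrow> chan p u \<longleftrightarrow> set u \<subseteq> {..<N}"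
  using low_notin_Q[of 0] low_notin_Q[of 1] by (auto simp: chan_def)

lemma chan_cases: "chan p u \<Longrightarrow> p \<in> Q \<or> p = 0 \<or> p = 1"
  by (auto simp: chan_def)

text \<open>These four states only receive, and only the letter \<open>Suc N\<close> leads out of
  them. Since neither machine ever sends it, a machine in one of them is stuck there.\<close>

lemma block_waiting:
  assumes "(p, e, q) \<in> T Block" "p \<in> {0, 1, 2, 5}"
  shows "\<exists>b. e = Rcv b \<and> (b \<le> N \<longrightarrow> q \<in> {0, 1, 2, 5})"
proof -
  have "p < 6" using assms(2) by auto
  then have "(p, e, q) \<in> tailT Block N ini" using assms(1) T_low by blast
  then show ?thesis using assms(2) by auto
qed

lemma block_snd:
  assumes "(p, Snd a, q) \<in> T Block" "p \<in> Q"
  shows "a \<le> N \<and> ((p, a, q) \<in> HS \<or> q \<in> {0, 1, 2, 5} \<and> (\<exists>a' q'. (p, a', q') \<in> HS))"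
  using assms by (cases rule: T_Q_cases) (use HS_D in fastforce)+

lemma block_rcv:
  assumes "(p, Rcv b, q) \<in> T Block" "p \<in> Q"
  shows "(p, b, q) \<in> HR \<or> q \<in> {0, 1, 2, 5} \<and> (\<exists>b' q'. (p, b', q') \<in> HR)"
  using assms by (cases rule: T_Q_cases) auto

end

section \<open>Deadlock-freedom in mode \<open>Flush\<close> and bounded channels in mode
  \<open>Block\<close>\<close>

context sim
begin

text \<open>The disjuncts of the invariant: both machines are in the same round and neither has received an end
  mark; one of them is completing its output after having received the end mark; one of them has
  already started the next round.\<close>

definition flush_inv :: "config \<Rightarrow> bool" where
  "flush_inv = (\<lambda>(p0, p1, ua, ub).
     f0.chan p0 ua \<and> f1.chan p1 ub \<and> (p0 \<in> Q0 \<longrightarrow> p1 \<in> Q1 N \<longrightarrow> good (p0, p1, ua, ub)) \<or>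
     p0 = 2 \<and> p1 = 1 \<and> set ua \<subseteq> {..<N} \<and> ub = [] \<or>
     p0 = 1 \<and> p1 = 2 \<and> ua = [] \<and> set ub \<subseteq> {..<N} \<or>
     p0 = 1 \<and> p1 = 6 \<and> ua = [] \<and> (\<exists>v. ub = v @ [N] \<and> set v \<subseteq> {..<N}) \<or>
     p1 = 1 \<and> ub = [] \<and> (\<exists>x y. ua = x @ N # y \<and> set x \<subseteq> {..<N} \<and> f0.chan p0 y \<and>
       (p0 \<in> Q0 \<longrightarrow> base p0 = 0 \<and> y @ pend p0 = W0)))"

lemma flush_inv_cases:
  assumes "flush_inv (p0, p1, ua, ub)"
  obtains (same) "f0.chan p0 ua" "f1.chan p1 ub" "p0 \<in> Q0 \<Longrightarrow> p1 \<in> Q1 N \<Longrightarrow> good (p0, p1, ua, ub)"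
  | (end0) "p0 = 2" "p1 = 1" "set ua \<subseteq> {..<N}" "ub = []"
  | (end1) "p0 = 1" "p1 = 2" "ua = []" "set ub \<subseteq> {..<N}"
  | (ahead1) v where "p0 = 1" "p1 = 6" "ua = []" "ub = v @ [N]" "set v \<subseteq> {..<N}"
  | (ahead0) x y where "p1 = 1" "ub = []" "ua = x @ N # y" "set x \<subseteq> {..<N}" "f0.chan p0 y"
      "p0 \<in> Q0 \<Longrightarrow> base p0 = 0 \<and> y @ pend p0 = W0"
  using assms unfolding flush_inv_def by auto

lemma flush_inv_same:
  "f0.chan p0 ua \<Longrightarrow> f1.chan p1 ub \<Longrightarrow> (p0 \<in> Q0 \<Longrightarrow> p1 \<in> Q1 N \<Longrightarrow> good (p0, p1, ua, ub)) \<Longrightarrow> flush_inv (p0, p1, ua, ub)"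
  unfolding flush_inv_def by simp

lemma flush_inv_ahead0:
  "f0.chan p0 y \<Longrightarrow> set x \<subseteq> {..<N} \<Longrightarrow> (p0 \<in> Q0 \<Longrightarrow> base p0 = 0 \<and> y @ pend p0 = W0) \<Longrightarrow> flush_inv (p0, 1, x @ N # y, [])"
  unfolding flush_inv_def by auto

lemma low_Q: "0 \<notin> Q0" "1 \<notin> Q0" "2 \<notin> Q0" "0 \<notin> Q1 N" "1 \<notin> Q1 N" "2 \<notin> Q1 N"
  using f0.low_notin_Q f1.low_notin_Q by auto

text \<open>The echo machine begins a round by receiving, so if it is ahead it must wait in state 6.
  Only the simulating machine can write into the next round early, which explains the asymmetry of
  \<open>flush_inv\<close>.\<close>

lemma no_snd_6: "(6, Snd a, q) \<notin> A1"
proof -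
  have "(6, 0, 8) \<in> HR1 N" using N_ge by (auto simp: HR1_def)
  from f1.T_rcv[OF this, of m] show ?thesis using f1.T_send_or_recv[of 6 m] by blast
qed

lemma flush_inv_ini0: "flush_inv (7, 1, x @ [N], [])" if "set x \<subseteq> {..<N}"
  using that f0.ini_Q flush_inv_ahead0[of 7 "[]" x] by (simp add: f0.chan_Q)

text \<open>The end mark is the last letter of a round: if it is received while both machines are in
  the same round, \<open>chan\<close> forces the sender to be in state 1 with nothing left in its
  output channel.\<close>

lemma flush_inv_step:
  assumes m: "m = Flush" and inv: "flush_inv c" and step: "cstep A0 A1 c d"
  shows "flush_inv d"
  using step
proof cases
  case (snd0 p0 b q0 p1 ua ub)
  have t: "(p0, Snd b, q0) \<in> f0.T Flush" using snd0 m by simp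
  from inv[unfolded snd0(1)] have "flush_inv (q0, p1, ua @ [b], ub)"
  proof (cases rule: flush_inv_cases)
    case same
    note q = f0.flush_snd[OF t same(1)]
    show ?thesis
    proof (rule flush_inv_same)
      assume "q0 \<in> Q0" "p1 \<in> Q1 N"
      then have "p0 \<in> Q0" using q HS0_D by blast
      then have "good (q0, p1, ua @ [b], ub) \<or> deviates b q0" using good_snd0 snd0(3) same \<open>p1 \<in> Q1 N\<close> by blast
      then show "good (q0, p1, ua @ [b], ub)" using \<open>q0 \<in> Q0\<close> low_Q unfolding deviates_def by blast
    qed (use q same in auto)
  next
    case end0
    then have "b < N \<and> q0 = 2 \<or> b = N \<and> q0 = 7" using f0.flush_2[of "Snd b" q0] t by auto
    then show ?thesis
    proof
      assume "b < N \<and> q0 = 2"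
      then show ?thesis using end0 by (simp add: flush_inv_def)
    next
      assume "b = N \<and> q0 = 7"
      then show ?thesis using end0 flush_inv_ini0 by simp
    qed
  next
    case end1
    then show ?thesis using f0.flush_1[of "Snd b" q0] t by auto
  next
    case (ahead1 v)
    then show ?thesis using f0.flush_1[of "Snd b" q0] t by auto
  next
    case (ahead0 x y)
    note q = f0.flush_snd[OF t ahead0(5)]
    have "flush_inv (q0, 1, x @ N # (y @ [b]), [])"
    proof (rule flush_inv_ahead0)
      assume "q0 \<in> Q0"
      then have "(p0, b, q0) \<in> HS0" using q by blast
      then show "base q0 = 0 \<and> (y @ [b]) @ pend q0 = W0" using HS0_pend HS0_D ahead0(6) by fastforce
    qed (use q ahead0 in auto)
    then show ?thesis using ahead0 by simp
  qed
  then show ?thesis using snd0(2) by simp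
next
  case (rcv0 p0 b q0 p1 ua ub)
  have t: "(p0, Rcv b, q0) \<in> f0.T Flush" using rcv0 m by simp
  from inv[unfolded rcv0(1)] have "flush_inv (q0, p1, ua, ub)"
  proof (cases rule: flush_inv_cases)
    case same
    from f0.flush_rcv[OF t same(1)] show ?thesis
    proof (elim disjE conjE)
      assume b: "b < N" and h: "(p0, b, q0) \<in> HR0"
      show ?thesis
      proof (rule flush_inv_same)
        show "f0.chan q0 ua" using same(1) HR0_D[OF h] by (simp add: f0.chan_Q)
        show "f1.chan p1 ub" using f1.chan_Cons[OF same(2) b] .
        show "good (q0, p1, ua, ub)" if "p1 \<in> Q1 N"
          using good_rcv0[OF same(3)] that rcv0(3) HR0_D[OF h] by blast
      qed
    next
      assume b: "b < N" and "p0 = 1" "q0 = 1"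
      then show ?thesis using same f1.chan_Cons low_Q by (intro flush_inv_same) auto
    next
      assume b: "b = N" and p: "p0 \<in> Q0" "q0 = 2"
      then have "p1 = 1" "ub = []" using f1.chan_Cons_end same by auto
      then show ?thesis using p same(1) by (simp add: flush_inv_def f0.chan_Q)
    next
      assume b: "b = N" and p: "p0 = 1" "q0 = 7"
      then have "p1 = 1" "ub = []" using f1.chan_Cons_end same by auto
      then show ?thesis using p same(1) flush_inv_ini0 by (auto simp: f0.chan_1 simp del: One_nat_def)
    qed
  next
    case end1
    then show ?thesis using f0.flush_1[of "Rcv b" q0] t by (auto simp: flush_inv_def)
  next
    case (ahead1 v)
    then consider "b < N" "q0 = 1" | "b = N" "q0 = 7" using f0.flush_1[of "Rcv b" q0] t by auto
    then show ?thesis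
    proof cases
      case 1
      then obtain v' where "v = b # v'" using ahead1 by (cases v) auto
      then show ?thesis using ahead1 1 by (auto simp: flush_inv_def)
    next
      case 2
      then have "v = []" using ahead1 by (cases v) auto
      then show ?thesis using ahead1 2 good_init f0.ini_Q f1.ini_Q
        by (auto intro!: flush_inv_same simp: f0.chan_Q f1.chan_Q)
    qed
  qed auto
  then show ?thesis using rcv0(2) by simp
next
  case (snd1 p1 b q1 p0 ua ub)
  have t: "(p1, Snd b, q1) \<in> f1.T Flush" using snd1 m by simp
  from inv[unfolded snd1(1)] have "flush_inv (p0, q1, ua, ub @ [b])"
  proof (cases rule: flush_inv_cases)
    case same
    note q = f1.flush_snd[OF t same(2)]
    show ?thesis
    proof (rule flush_inv_same)
      assume "q1 \<in> Q1 N" "p0 \<in> Q0"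
      then have "p1 \<in> Q1 N" using q f1.HS_D by blast
      then have "good (p0, q1, ua, ub @ [b]) \<or> deviates b q1" using good_snd1 snd1(3) same \<open>p0 \<in> Q0\<close> by blast
      then show "good (p0, q1, ua, ub @ [b])" using \<open>q1 \<in> Q1 N\<close> low_Q unfolding deviates_def by blast
    qed (use q same in auto)
  next
    case end0
    then show ?thesis using f1.flush_1[of "Snd b" q1] t by auto
  next
    case end1
    then have "b < N \<and> q1 = 2 \<or> b = N \<and> q1 = 6" using f1.flush_2[of "Snd b" q1] t by auto
    then show ?thesis using end1 by (auto simp: flush_inv_def)
  next
    case (ahead1 v)
    then show ?thesis using no_snd_6 snd1(3) by simp
  next
    case (ahead0 x y)
    then show ?thesis using f1.flush_1[of "Snd b" q1] t by auto
  qed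
  then show ?thesis using snd1(2) by simp
next
  case (rcv1 p1 b q1 p0 ua ub)
  have t: "(p1, Rcv b, q1) \<in> f1.T Flush" using rcv1 m by simp
  from inv[unfolded rcv1(1)] have "flush_inv (p0, q1, ua, ub)"
  proof (cases rule: flush_inv_cases)
    case same
    from f1.flush_rcv[OF t same(2)] show ?thesis
    proof (elim disjE conjE)
      assume b: "b < N" and h: "(p1, b, q1) \<in> HR1 N"
      show ?thesis
      proof (rule flush_inv_same)
        show "f1.chan q1 ub" using same(2) f1.HR_D[OF h] by (simp add: f1.chan_Q)
        show "f0.chan p0 ua" using f0.chan_Cons[OF same(1) b] .
        show "good (p0, q1, ua, ub)" if "p0 \<in> Q0"
          using good_rcv1[OF same(3)] that rcv1(3) f1.HR_D[OF h] by blast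
      qed
    next
      assume b: "b < N" and "p1 = 1" "q1 = 1"
      then show ?thesis using same f0.chan_Cons low_Q by (intro flush_inv_same) auto
    next
      assume b: "b = N" and p: "p1 \<in> Q1 N" "q1 = 2"
      then have "p0 = 1" "ua = []" using f0.chan_Cons_end same by auto
      then show ?thesis using p same(2) by (simp add: flush_inv_def f1.chan_Q)
    next
      assume b: "b = N" and p: "p1 = 1" "q1 = 6"
      then have "p0 = 1" "ua = []" using f0.chan_Cons_end same by auto
      then show ?thesis using p same(2) by (auto simp: flush_inv_def f1.chan_1 simp del: One_nat_def)
    qed
  next
    case end0
    then show ?thesis using f1.flush_1[of "Rcv b" q1] t by (auto simp: flush_inv_def)
  next
    case (ahead0 x y)
    then consider "b < N" "q1 = 1" | "b = N" "q1 = 6" using f1.flush_1[of "Rcv b" q1] t by auto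
    then show ?thesis
    proof cases
      case 1
      then obtain x' where "x = b # x'" "ua = x' @ N # y" using ahead0 by (cases x) auto
      then show ?thesis using ahead0 1 flush_inv_ahead0[of p0 y x'] by simp
    next
      case 2
      then have "x = []" "ua = y" using ahead0 by (cases x; auto)+
      \<comment> \<open>Both machines are now in the new round. Its queue is still the initial word
        \<open>W0\<close>, of which \<open>y\<close> has already been sent.\<close>
      moreover have "good (p0, 6, y, [])" if "p0 \<in> Q0"
        using ahead0(6)[OF that] that f1.ini_Q by (simp add: good_def hand_def)
      ultimately show ?thesis using ahead0 2 f1.ini_Q by (auto intro!: flush_inv_same simp: f1.chan_Q)
    qed
  qed auto
  then show ?thesis using rcv1(2) by simp
qed

lemma flush_reach: "reach c \<Longrightarrow> m = Flush \<Longrightarrow> flush_inv c"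
proof (induction rule: rtranclp_induct)
  case base
  then show ?case using good_init f0.ini_Q f1.ini_Q by (intro flush_inv_same) (simp_all add: f0.chan_Q f1.chan_Q)
next
  case (step c d)
  then show ?case using flush_inv_step by blast
qed

text \<open>States 0 and 2 can send. If a machine is in state 1, then by the invariant an end mark
  is in a channel or the partner is in state 2. So a deadlock could only involve two honest states
  and an empty queue.\<close>

lemma flush_deadlock_free:
  assumes m: "m = Flush" and q: "\<And>s. \<not> qreach (s, [])"
  shows "deadlock_free P"
  unfolding deadlock_free_iff
proof safe
  fix p0 p1 assume r: "reach (p0, p1, [], [])"
    and s: "\<forall>b q. (p0, Snd b, q) \<notin> A0" "\<forall>b q. (p1, Snd b, q) \<notin> A1"
  have z: "(0, Snd N, 1) \<in> A0" "(0, Snd N, 1) \<in> A1" "(2, Snd N, 7) \<in> A0" "(2, Snd N, 6) \<in> A1"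
    using m by (auto intro: f0.T_tail f1.T_tail)
  have "flush_inv (p0, p1, [], [])" using flush_reach[OF r m] .
  then show False
  proof (cases rule: flush_inv_cases)
    case same
    then have "p0 \<in> Q0" "p1 \<in> Q1 N"
      using s z f0.chan_cases[of p0 "[]"] f1.chan_cases[of p1 "[]"] f0.chan_1[of "[]"] f1.chan_1[of "[]"] by auto
    then show False using good_deadlock[OF same(3) s] q by blast
  qed (use s z in auto)
qed

text \<open>The simulating machine sends at most two letters for each letter received, the echo machine one; hence
  the weights in these bounds.\<close>

definition block_inv :: "nat \<Rightarrow> config \<Rightarrow> bool" where
  "block_inv B = (\<lambda>(p0, p1, ua, ub). good (p0, p1, ua, ub) \<or>
     set ua \<subseteq> {..N} \<and> set ub \<subseteq> {..N} \<and>
     (p0 \<in> Q0 \<and> p1 \<in> {0, 1, 2, 5} \<and> 3 * length ub + length ua + length (pend p0) \<le> 3 * B + 3 \<or>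
      p0 \<in> {0, 1, 2, 5} \<and> p1 \<in> Q1 N \<union> {0, 1, 2, 5} \<and> length ua + length ub + length (hand p1) \<le> 3 * B + 4))"

lemma block_inv_cases:
  assumes "block_inv B (p0, p1, ua, ub)"
  obtains (good) "good (p0, p1, ua, ub)"
  | (dev1) "set ua \<subseteq> {..N}" "set ub \<subseteq> {..N}" "p0 \<in> Q0" "p1 \<in> {0, 1, 2, 5}"
      "3 * length ub + length ua + length (pend p0) \<le> 3 * B + 3"
  | (dev0) "set ua \<subseteq> {..N}" "set ub \<subseteq> {..N}" "p0 \<in> {0, 1, 2, 5}" "p1 \<in> Q1 N \<union> {0, 1, 2, 5}"
      "length ua + length ub + length (hand p1) \<le> 3 * B + 4"
  using assms unfolding block_inv_def by blast

lemma block_inv_good: "good c \<Longrightarrow> block_inv B c"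
  by (cases c) (simp add: block_inv_def)

lemma block_inv_dev1:
  "set ua \<subseteq> {..N} \<Longrightarrow> set ub \<subseteq> {..N} \<Longrightarrow> p0 \<in> Q0 \<Longrightarrow> p1 \<in> {0, 1, 2, 5} \<Longrightarrow>
    3 * length ub + length ua + length (pend p0) \<le> 3 * B + 3 \<Longrightarrow> block_inv B (p0, p1, ua, ub)"
  unfolding block_inv_def by blast

lemma block_inv_dev0:
  "set ua \<subseteq> {..N} \<Longrightarrow> set ub \<subseteq> {..N} \<Longrightarrow> p0 \<in> {0, 1, 2, 5} \<Longrightarrow> p1 \<in> Q1 N \<union> {0, 1, 2, 5} \<Longrightarrow>
    length ua + length ub + length (hand p1) \<le> 3 * B + 4 \<Longrightarrow> block_inv B (p0, p1, ua, ub)"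
  unfolding block_inv_def by blast

lemma hand_low: "p \<in> {0, 1, 2, 5} \<Longrightarrow> hand p = []" by (auto simp: hand_def)

lemma pend_rcv_length: "(p, b, q) \<in> HR0 \<Longrightarrow> length (pend q) \<le> 2"
  using HR0_pend[of p b q] HR0_D[of p b q] Q0_S[of p] outs_letters[OF outs_step, of "base p" b] by simp

text \<open>No channel ever contains \<open>Suc N\<close>, so a deviation is final. The first wrong
  send of \<open>F1\<close> raises the weighted sum from at most \<open>3 * B\<close> to at most
  \<open>3 * B + 3\<close>; afterwards \<open>F0\<close> gains at most two pending letters for each
  letter taken from \<open>ub\<close>, so the sum does not grow. A wrong send of \<open>F0\<close>
  adds one letter, giving \<open>3 * B + 4\<close>; from then on letters only move through the hand
  of the echo machine.\<close>

lemma block_inv_step: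
  assumes m: "m = Block" and B: "\<And>s W. qreach (s, W) \<Longrightarrow> length W \<le> B"
    and inv: "block_inv B c" and step: "cstep A0 A1 c d"
  shows "block_inv B d"
proof -
  have gB: "length ua + length ub + length (hand p1) + length (pend p0) \<le> B" "set ua \<subseteq> {..N}" "set ub \<subseteq> {..N}"
    "p0 \<in> Q0" "p1 \<in> Q1 N"
    if "good (p0, p1, ua, ub)" for p0 p1 ua ub
  proof -
    show "length ua + length ub + length (hand p1) + length (pend p0) \<le> B"
      using B[of "base p0" "ub @ hand p1 @ ua @ pend p0"] that by (simp add: good_def)
    show "set ua \<subseteq> {..N}" "set ub \<subseteq> {..N}" using good_letters[OF that] by force+
    show "p0 \<in> Q0" "p1 \<in> Q1 N" using that by (auto simp: good_def)
  qed
  show ?thesis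
    using step
  proof cases
    case (snd0 p0 b q0 p1 ua ub)
    have t: "(p0, Snd b, q0) \<in> f0.T Block" using snd0 m by simp
    from inv[unfolded snd0(1)] have "block_inv B (q0, p1, ua @ [b], ub)"
    proof (cases rule: block_inv_cases)
      case good
      note g = gB[OF good]
      from good_snd0[OF good snd0(3)] show ?thesis
      proof
        assume "deviates b q0"
        then have "b \<le> N" "q0 \<in> {0, 1, 2, 5}" by (auto simp: deviates_def)
        then show ?thesis using g by (intro block_inv_dev0) auto
      qed (rule block_inv_good)
    next
      case dev1
      from f0.block_snd[OF t dev1(3)] have b: "b \<le> N" by blast
      from f0.block_snd[OF t dev1(3)] consider "(p0, b, q0) \<in> HS0" | a q where "(p0, a, q) \<in> HS0" "q0 \<in> {0, 1, 2, 5}" by blast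
      then show ?thesis
      proof cases
        case 1
        then show ?thesis using dev1 b HS0_pend[OF 1] HS0_D[OF 1] by (intro block_inv_dev1) auto
      next
        case 2
        then show ?thesis using dev1 b hand_low[OF dev1(4)] by (intro block_inv_dev0) auto
      qed
    next
      case dev0
      then show ?thesis using f0.block_waiting[OF t] by auto
    qed
    then show ?thesis using snd0(2) by simp
  next
    case (rcv0 p0 b q0 p1 ua ub)
    have t: "(p0, Rcv b, q0) \<in> f0.T Block" using rcv0 m by simp
    from inv[unfolded rcv0(1)] have "block_inv B (q0, p1, ua, ub)"
    proof (cases rule: block_inv_cases)
      case good
      then show ?thesis using good_rcv0 rcv0(3) block_inv_good by blast
    next
      case dev1
      from f0.block_rcv[OF t dev1(3)] consider "(p0, b, q0) \<in> HR0" | "q0 \<in> {0, 1, 2, 5}" by blast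
      then show ?thesis
      proof cases
        case 1
        then show ?thesis using dev1 HR0_D[OF 1] pend_rcv_length[OF 1] by (intro block_inv_dev1) auto
      next
        case 2
        then show ?thesis using dev1 hand_low[OF dev1(4)] by (intro block_inv_dev0) auto
      qed
    next
      case dev0
      then have "q0 \<in> {0, 1, 2, 5}" using f0.block_waiting[OF t] by auto
      then show ?thesis using dev0 by (intro block_inv_dev0) auto
    qed
    then show ?thesis using rcv0(2) by simp
  next
    case (snd1 p1 b q1 p0 ua ub)
    have t: "(p1, Snd b, q1) \<in> f1.T Block" using snd1 m by simp
    from inv[unfolded snd1(1)] have "block_inv B (p0, q1, ua, ub @ [b])"
    proof (cases rule: block_inv_cases)
      case good
      note g = gB[OF good]
      from good_snd1[OF good snd1(3)] show ?thesis
      proof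
        assume "deviates b q1"
        then have "b \<le> N" "q1 \<in> {0, 1, 2, 5}" by (auto simp: deviates_def)
        then show ?thesis using g by (intro block_inv_dev1) auto
      qed (rule block_inv_good)
    next
      case dev1
      then show ?thesis using f1.block_waiting[OF t] by auto
    next
      case dev0
      then have p: "p1 \<in> Q1 N" using f1.block_waiting[OF t] by auto
      from f1.block_snd[OF t p] have b: "b \<le> N" by blast
      from f1.block_snd[OF t p] obtain a q where a: "(p1, a, q) \<in> HS1 N" by blast
      have "q1 \<in> Q1 N \<union> {0, 1, 2, 5}" "hand q1 = []"
        using f1.block_snd[OF t p] f1.HS_D[of p1 b q1] HS1_hand[of p1 b q1] hand_low[of q1] by blast+
      then show ?thesis using dev0 b HS1_hand[OF a] by (intro block_inv_dev0) auto
    qed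
    then show ?thesis using snd1(2) by simp
  next
    case (rcv1 p1 b q1 p0 ua ub)
    have t: "(p1, Rcv b, q1) \<in> f1.T Block" using rcv1 m by simp
    from inv[unfolded rcv1(1)] have "block_inv B (p0, q1, ua, ub)"
    proof (cases rule: block_inv_cases)
      case good
      then show ?thesis using good_rcv1 rcv1(3) block_inv_good by blast
    next
      case dev1
      then have "q1 \<in> {0, 1, 2, 5}" using f1.block_waiting[OF t] by auto
      then show ?thesis using dev1 by (intro block_inv_dev1) auto
    next
      case dev0
      have "q1 \<in> Q1 N \<union> {0, 1, 2, 5} \<and> length (hand q1) \<le> 1"
      proof (cases "p1 \<in> Q1 N")
        case True
        from f1.block_rcv[OF t True] show ?thesis
          using f1.HR_D[of p1 b q1] by (auto simp: hand_def)
      next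
        case False
        then have "q1 \<in> {0, 1, 2, 5}" using dev0 f1.block_waiting[OF t] by auto
        then show ?thesis by (auto simp: hand_def)
      qed
      then show ?thesis using dev0 by (intro block_inv_dev0) auto
    qed
    then show ?thesis using rcv1(2) by simp
  qed
qed

lemma block_bounded:
  assumes m: "m = Block" and B: "\<And>s W. qreach (s, W) \<Longrightarrow> length W \<le> B"
  shows "bounded_channel P"
proof -
  have inv: "block_inv B c" if "reach c" for c
    using that
  proof (induction rule: rtranclp_induct)
    case base
    show ?case using block_inv_good[OF good_init] .
  next
    case (step c d)
    show ?case using block_inv_step[OF m _ step.IH step.hyps(2)] B by blast
  qed
  have "length ua + length ub \<le> 3 * B + 4" if "reach (p0, p1, ua, ub)" for p0 p1 ua ub
    using inv[OF that]
  proof (cases rule: block_inv_cases)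
    case good
    then show ?thesis using B[of "base p0" "ub @ hand p1 @ ua @ pend p0"] by (simp add: good_def)
  qed auto
  then show ?thesis unfolding bounded_channel_iff by blast
qed

end

section \<open>Diagonalisation\<close>

lemma qsteps_drain: "(\<And>b. \<delta> t b = ([], t)) \<Longrightarrow> (qstep \<delta>)\<^sup>*\<^sup>* (t, W) (t, [])"
proof (induction W)
  case (Cons b W)
  then have "qstep \<delta> (t, b # W) (t, W)" by (intro qstep_intro[of _ _ _ "[]"]) auto
  then show ?case using Cons by (auto intro: converse_rtranclp_into_rtranclp)
qed simp

lemma qsteps_grow:
  assumes "\<And>b. \<delta> t b = ([b, b], t)" "W \<noteq> []"
  shows "\<exists>W'. W' \<noteq> [] \<and> B \<le> length W' \<and> (qstep \<delta>)\<^sup>*\<^sup>* (t, W) (t, W')"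
proof (induction B)
  case 0
  then show ?case using assms(2) by blast
next
  case (Suc B)
  then obtain b W' where W: "B \<le> length (b # W')" "(qstep \<delta>)\<^sup>*\<^sup>* (t, W) (t, b # W')"
    by (metis neq_Nil_conv)
  have "qstep \<delta> (t, b # W') (t, W' @ [b, b])" using assms(1) by (intro qstep_intro[of _ _ _ "[b, b]"]) auto
  with W(2) have "(qstep \<delta>)\<^sup>*\<^sup>* (t, W) (t, W' @ [b, b])" by (rule rtranclp.rtrancl_into_rtrancl)
  then show ?case using W(1) by (intro exI[of _ "W' @ [b, b]"]) auto
qed

text \<open>By determinism every configuration reachable from \<open>c\<close> lies before or after
  \<open>(t, W)\<close>. The finitely many earlier ones still make a step, so their words are
  nonempty; the later ones keep the length of \<open>W\<close>.\<close>

lemma qsteps_echo: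
  assumes "(qstep \<delta>)\<^sup>*\<^sup>* c (t, W)" "\<And>b. \<delta> t b = ([b], t)" "W \<noteq> []"
  shows "\<exists>B. \<forall>d. (qstep \<delta>)\<^sup>*\<^sup>* c d \<longrightarrow> snd d \<noteq> [] \<and> length (snd d) \<le> B"
  using assms(1)
proof (induction rule: converse_rtranclp_induct)
  case base
  have "fst d = t \<and> length (snd d) = length W" if "(qstep \<delta>)\<^sup>*\<^sup>* (t, W) d" for d
    using that
  proof (induction rule: rtranclp_induct)
    case (step d e)
    then show ?case using assms(2) by (auto elim!: qstep.cases)
  qed simp
  then show ?case using assms(3) by (intro exI[of _ "length W"]) fastforce
next
  case (step c c')
  then obtain B where B: "\<And>d. (qstep \<delta>)\<^sup>*\<^sup>* c' d \<Longrightarrow> snd d \<noteq> [] \<and> length (snd d) \<le> B" by blast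
  have "snd d \<noteq> [] \<and> length (snd d) \<le> max B (length (snd c))" if "(qstep \<delta>)\<^sup>*\<^sup>* c d" for d
    using that
  proof (cases rule: converse_rtranclpE)
    case base
    then show ?thesis using step(1) by (auto elim: qstep.cases)
  next
    case (step e)
    then have "e = c'" using qstep_det \<open>qstep \<delta> c c'\<close> by blast
    then show ?thesis using B[of d] step by auto
  qed
  then show ?case by blast
qed

section \<open>Explicit lists for the pair, and its code as a recursive function\<close>

definition link_target :: "nat \<Rightarrow> nat \<Rightarrow> nat \<Rightarrow> nat" where
  "link_target L i j = (if j = 0 then ch i else if L - Suc j = 0 then 1 else 0)"

text \<open>The edges of one chain state in a fixed order: letter 0 is the honest send, and in the
  deviating modes the last letter is the end mark. A fixed order is what makes the code of the list
  computable.\<close>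

primrec link :: "nat \<Rightarrow> nat \<Rightarrow> nat \<Rightarrow> (nat \<times> act \<times> nat) list \<Rightarrow> (nat \<times> act \<times> nat) list" where
  "link L i 0 ts = ts"
| "link L i (Suc j) ts = (ch (Suc i), Snd (2 * j), link_target L i j) # link L i j ts"

primrec chain :: "nat \<Rightarrow> nat \<Rightarrow> (nat \<times> act \<times> nat) list \<Rightarrow> (nat \<times> act \<times> nat) list" where
  "chain L 0 ts = ts"
| "chain L (Suc i) ts = link L i L (chain L i ts)"

primrec chain_states :: "nat \<Rightarrow> nat list \<Rightarrow> nat list" where
  "chain_states 0 qs = qs"
| "chain_states (Suc i) qs = ch (Suc i) # chain_states i qs"

lemma set_link: "set (link L i j ts) = {(ch (Suc i), Snd (2 * j'), link_target L i j') | j'. j' < j} \<union> set ts"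
  by (induction j) (auto simp: less_Suc_eq)

lemma set_chain: "set (chain L k ts) = {(ch (Suc i), Snd (2 * j), link_target L i j) | i j. i < k \<and> j < L} \<union> set ts"
  by (induction k) (auto simp: set_link less_Suc_eq)

lemma set_chain_states: "set (chain_states k qs) = {ch (Suc i) | i. i < k} \<union> set qs"
  by (induction k) (auto simp: less_Suc_eq)

definition links :: "mode \<Rightarrow> nat \<Rightarrow> nat" where "links m N = (if m = Reset then 1 else Suc N)"

lemma sendT_link: "0 < N \<Longrightarrow> conc 0 (sendT m N (ch (Suc i), 0, ch i)) =
    {(ch (Suc i), Snd (2 * j), link_target (links m N) i j) | j. j < links m N}"
proof -
  assume "0 < N"
  then have "sendT m N (ch (Suc i), 0, ch i) =
      {(ch (Suc i), Snd j, link_target (links m N) i j) | j. j < links m N}"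
    by (cases "m = Reset") (auto simp: sendT_def dev_def links_def link_target_def less_Suc_eq)
  then show ?thesis by (simp add: conc_def setcompr_eq_image image_image)
qed

text \<open>An arbitrary enumeration suffices for the parts that enter the code of the pair as
  constants.\<close>

definition list_of :: "'a set \<Rightarrow> 'a list" where "list_of A = (SOME l. set l = A)"

lemma set_list_of: "finite A \<Longrightarrow> set (list_of A) = A"
  unfolding list_of_def by (rule someI_ex) (rule finite_list)

lemma conc_Un: "conc j (A \<union> B) = conc j A \<union> conc j B"
  and conc_insert: "conc j (insert (p, e, q) A) = insert (p, cz j e, q) (conc j A)"
  and conc_UN: "conc j (\<Union> (f ` I)) = (\<Union>i\<in>I. conc j (f i))"
  unfolding conc_def by (simp_all add: image_Un image_UN)

context queue
begin

text \<open>Everything except the edges that leave the chain states \<open>ch (Suc i)\<close> and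
  the honest edge into the chain. The deviations at 7 belong here because their targets do not
  mention \<open>k\<close>.\<close>

definition T_fix :: "mode \<Rightarrow> (nat \<times> act \<times> nat) set" where
  "T_fix m = dev m N 7 0 \<union> \<Union> (sendT m N ` HS_fix) \<union> \<Union> (recvT m N 7 ` HR0) \<union> tailT m N 7"

definition trans_fix :: "mode \<Rightarrow> (nat \<times> act \<times> nat) list" where
  "trans_fix m = list_of (conc 0 (T_fix m))"

definition states_fix :: "mode \<Rightarrow> nat list" where
  "states_fix m = list_of (Q_fix \<union> tails m)"

definition machine1 :: "mode \<Rightarrow> fsm" where
  "machine1 m = (list_of (Q1 N \<union> tails m), list_of (conc 1 (wrapT m N 6 (HS1 N) (HR1 N))), 6)"

definition letters :: "nat \<Rightarrow> nat list" where "letters j = map (\<lambda>a. 2 * a + j) [0..<N + 2]"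

definition sim_pair :: "mode \<Rightarrow> sr_pair" where
  "sim_pair m = (letters 0, letters 1,
     (chain_states k (states_fix m), (7, Snd 0, ch k) # chain (links m N) k (trans_fix m), 7), machine1 m)"

lemma finite_tails: "finite (tails m)" by (cases m) auto

lemma T0_split: "wrapT m N 7 HS0 HR0 =
    insert (7, Snd 0, ch k) (\<Union> ((\<lambda>i. sendT m N (ch (Suc i), 0, ch i)) ` {..<k}) \<union> T_fix m)"
proof -
  have "HS0 = insert (7, 0, ch k) ((\<lambda>i. (ch (Suc i), 0, ch i)) ` {..<k} \<union> HS_fix)"
    by (auto simp: HS0_def)
  moreover have "sendT m N (7, 0, ch k) = insert (7, Snd 0, ch k) (dev m N 7 0)"
    by (simp add: sendT_def)
  ultimately show ?thesis unfolding wrapT_def T_fix_def by auto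
qed

lemma set_trans_fix: "set (trans_fix m) = conc 0 (T_fix m)"
proof -
  have "T_fix m \<subseteq> wrapT m N 7 HS0 HR0" unfolding T0_split by blast
  then have "finite (T_fix m)" using f0.finite_T finite_subset by blast
  then show ?thesis unfolding trans_fix_def by (intro set_list_of) (simp add: conc_def)
qed

lemma sim_pair_F0:
  "trans (F0 (sim_pair m)) = conc 0 (wrapT m N 7 HS0 HR0)"
  "states (F0 (sim_pair m)) = Q0 \<union> tails m" "init (F0 (sim_pair m)) = 7"
proof -
  have "conc 0 (wrapT m N 7 HS0 HR0) = insert (7, Snd 0, ch k)
      ((\<Union>i<k. conc 0 (sendT m N (ch (Suc i), 0, ch i))) \<union> conc 0 (T_fix m))"
    unfolding T0_split conc_insert conc_Un conc_UN by simp
  also have "\<dots> = set ((7, Snd 0, ch k) # chain (links m N) k (trans_fix m))"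
    using N_ge sendT_link[of N m] by (auto simp: set_chain set_trans_fix)
  finally show "trans (F0 (sim_pair m)) = conc 0 (wrapT m N 7 HS0 HR0)"
    by (simp add: trans_def F0_def sim_pair_def)
  have "set (states_fix m) = Q_fix \<union> tails m"
    unfolding states_fix_def using finite_Q_fix finite_tails by (intro set_list_of) simp
  then show "states (F0 (sim_pair m)) = Q0 \<union> tails m"
    by (auto simp: states_def F0_def sim_pair_def set_chain_states Q0_def)
  show "init (F0 (sim_pair m)) = 7" by (simp add: init_def F0_def sim_pair_def)
qed

lemma sim_pair_F1:
  "trans (F1 (sim_pair m)) = conc 1 (wrapT m N 6 (HS1 N) (HR1 N))"
  "states (F1 (sim_pair m)) = Q1 N \<union> tails m" "init (F1 (sim_pair m)) = 6"
proof -
  have "finite (conc 1 (wrapT m N 6 (HS1 N) (HR1 N)))" using f1.finite_T by (simp add: conc_def)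
  then show "trans (F1 (sim_pair m)) = conc 1 (wrapT m N 6 (HS1 N) (HR1 N))"
    by (simp add: trans_def F1_def sim_pair_def machine1_def set_list_of)
  show "states (F1 (sim_pair m)) = Q1 N \<union> tails m"
    using finite_tails f1.fin by (simp add: states_def F1_def sim_pair_def machine1_def set_list_of)
  show "init (F1 (sim_pair m)) = 6" by (simp add: init_def F1_def sim_pair_def machine1_def)
qed

lemma sim_pair_alphabets: "Malpha (sim_pair m) = alphabet N 0" "Mbeta (sim_pair m) = alphabet N 1"
  unfolding Malpha_def Mbeta_def sim_pair_def letters_def alphabet_def fst_conv snd_conv set_map
    set_upt atLeast0LessThan by (rule refl)+

lemma SR_pair_sim: "SR_pair (sim_pair m)"
  unfolding SR_pair_def sim_pair_alphabets
  using alphabet_disjoint f0.SR_machine_conc[OF sim_pair_F0] f1.SR_machine_conc[OF sim_pair_F1]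
  by simp

lemma no_send_cycle_sim: "\<not> has_send_cycle (F0 (sim_pair Reset))" "\<not> has_send_cycle (F1 (sim_pair Reset))"
  using f0.no_send_cycle_conc[OF sim_pair_F0(1)] f1.no_send_cycle_conc[OF sim_pair_F1(1)] by auto

text \<open>Both loop sets are images of the same \<open>rounds\<close>. \<open>F1\<close> sends
  what \<open>F0\<close> receives, so the components are exchanged, and \<open>rounds\<close> is
  symmetric.\<close>

lemma affine_sim:
  assumes "m \<noteq> Reset"
  shows "affine (sim_pair m)"
proof -
  let ?R = "rounds N (ends m N)"
  have swap: "{(f x, g y) | x y. (y, x) \<in> A} = prod.swap ` {(g y, f x) | x y. (y, x) \<in> A}"
    for f :: "nat list \<Rightarrow> nat list" and g :: "nat list \<Rightarrow> nat list" and A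
    by force
  have "Zset (sim_pair m) (F0 (sim_pair m)) = {(map (\<lambda>a. 2 * a) x, map (\<lambda>a. 2 * a + 1) y) | x y. (x, y) \<in> ?R}"
    unfolding Zset_def sim_pair_alphabets sim_pair_F0 using f0.loop_projs[OF assms, of 0] by simp
  also have "\<dots> = {(map (\<lambda>a. 2 * a) x, map (\<lambda>a. 2 * a + 1) y) | x y. (y, x) \<in> ?R}"
    using rounds_swap by blast
  also have "\<dots> = prod.swap ` {(map (\<lambda>a. 2 * a + 1) y, map (\<lambda>a. 2 * a) x) | x y. (y, x) \<in> ?R}"
    by (rule swap)
  also have "\<dots> = prod.swap ` {(proj (alphabet N 1) w, proj (alphabet N 0) w) | w. path (conc 1 (f1.T m)) 6 w 6}"
  proof -
    have "{(map (\<lambda>a. 2 * a + 1) y, map (\<lambda>a. 2 * a) x) | x y. (y, x) \<in> ?R} =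
        {(map (\<lambda>a. 2 * a + 1) y, map (\<lambda>a. 2 * a) x) | y x. (y, x) \<in> ?R}" by blast
    then show ?thesis using f1.loop_projs[OF assms, of 1] by simp
  qed
  also have "\<dots> = Zset (sim_pair m) (F1 (sim_pair m))"
    unfolding Zset_def sim_pair_alphabets sim_pair_F1 by (auto simp: image_iff)
  finally show ?thesis unfolding affine_def .
qed

lemma sim_sim_pair: "sim N n \<delta> k m (sim_pair m)"
  by unfold_locales (use sim_pair_F0 sim_pair_F1 in auto)

end

text \<open>\<open>4 * j\<close> is the code of sending the concrete letter \<open>2 * j\<close>,
  and \<open>2 * i + 8\<close> is \<open>ch i\<close>; plain arithmetic is used so that the
  \<open>recfn\<close> rules apply.\<close>

definition encode_link :: "nat \<Rightarrow> nat \<Rightarrow> nat \<Rightarrow> nat" where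
  "encode_link L i r = rec_nat r (\<lambda>j r. Suc (prod_encode (prod_encode (2 * Suc i + 8,
     prod_encode (4 * j, if j = 0 then 2 * i + 8 else if L - Suc j = 0 then 1 else 0)), r))) L"

lemma list_encode_link:
  "list_encode (map encode_trans (link L i L ts)) = encode_link L i (list_encode (map encode_trans ts))"
proof -
  have "list_encode (map encode_trans (link L i j ts)) = rec_nat (list_encode (map encode_trans ts))
      (\<lambda>j r. Suc (prod_encode (prod_encode (2 * Suc i + 8,
     prod_encode (4 * j, if j = 0 then 2 * i + 8 else if L - Suc j = 0 then 1 else 0)), r))) j" for j
    by (induction j) (auto simp: encode_trans_def ch_def link_target_def)
  then show ?thesis by (simp only: encode_link_def)
qed

lemma list_encode_chain:
  "list_encode (map encode_trans (chain L k ts)) = rec_nat (list_encode (map encode_trans ts)) (encode_link L) k"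
  by (induction k) (auto simp: list_encode_link)

lemma list_encode_chain_states:
  "list_encode (chain_states k qs) = rec_nat (list_encode qs) (\<lambda>i r. Suc (prod_encode (2 * Suc i + 8, r))) k"
  by (induction k) (auto simp: ch_def)

text \<open>The number \<open>c\<close> plays two roles: it stores the parts of the pair that do not depend on the length
  of the input chain, and it is that length.\<close>

definition self_pair :: "nat \<Rightarrow> nat" where
  "self_pair c = (let a = pfst c; c1 = psnd c; b = pfst c1; c2 = psnd c1; f = pfst c2; c3 = psnd c2;
      qs = pfst c3; c4 = psnd c3; ts = pfst c4; L = psnd c4 in
    Suc (prod_encode (a, Suc (prod_encode (b, Suc (prod_encode (
      prod_encode (rec_nat qs (\<lambda>i r. Suc (prod_encode (2 * Suc i + 8, r))) c,
        prod_encode (Suc (prod_encode (prod_encode (7, prod_encode (0, 2 * c + 8)), rec_nat ts (encode_link L) c)), 7)),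
      Suc (prod_encode (f, 0)))))))))"

text \<open>No component depends on \<open>k\<close>, although the locale fixes it. Therefore the
  equation \<open>k = self_code m\<close> can be imposed without circularity.\<close>

definition (in queue) self_code :: "mode \<Rightarrow> nat" where
  "self_code m = prod_encode (list_encode (letters 0), prod_encode (list_encode (letters 1),
     prod_encode (encode_fsm (machine1 m), prod_encode (list_encode (states_fix m),
       prod_encode (list_encode (map encode_trans (trans_fix m)), links m N)))))"

lemma (in queue) self_pair_self_code: "k = self_code m \<Longrightarrow> self_pair k = encode_pair (sim_pair m)"
  unfolding self_pair_def encode_pair_def sim_pair_def Let_def encode_fsm_def
  by (simp add: self_code_def list_encode_chain list_encode_chain_states encode_fsm_def)
    (simp add: encode_trans_def ch_def)

lemma recfn_double: "recfn n f \<Longrightarrow> recfn n (\<lambda>xs. 2 * f xs)"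
  using recfn_add[of n f f] by (simp add: mult_2)

lemma recfn_quadruple: "recfn n f \<Longrightarrow> recfn n (\<lambda>xs. 4 * f xs)"
  using recfn_double[OF recfn_double, of n f] by (simp flip: mult.assoc)

lemma recfn_self_pair: "recfn 1 (\<lambda>xs. self_pair (xs ! 0))"
proof -
  note r = recfn_Suc recfn_prod_encode recfn_add recfn_double recfn_quadruple recfn_nth recfn_const recfn_if0 recfn_diff recfn_pfst recfn_psnd
  define L where "L = (\<lambda>c. psnd (psnd (psnd (psnd (psnd c)))))"
  have L: "recfn n (\<lambda>xs. L (f xs))" if "recfn n f" for n f unfolding L_def by (intro r that)
  have "recfn 3 (\<lambda>xs. rec_nat (xs ! 1) (\<lambda>j r. (\<lambda>ys. Suc (prod_encode (prod_encode (2 * Suc (ys ! 2) + 8,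
     prod_encode (4 * (ys ! 0), if ys ! 0 = 0 then 2 * (ys ! 2) + 8 else if L (ys ! 4) - Suc (ys ! 0) = 0 then 1 else 0)), ys ! 1)))
      (j # r # xs)) (L (xs ! 2)))"
    by (intro recfn_prim r L) auto
  then have link: "recfn 3 (\<lambda>xs. encode_link (L (xs ! 2)) (xs ! 0) (xs ! 1))"
    by (simp add: encode_link_def cong: if_cong)
  have "recfn 1 (\<lambda>xs. rec_nat (pfst (psnd (psnd (psnd (psnd (xs ! 0))))))
      (\<lambda>i r. (\<lambda>ys. encode_link (L (ys ! 2)) (ys ! 0) (ys ! 1)) (i # r # xs)) (xs ! 0))"
    by (intro recfn_prim r) (use link in \<open>auto simp: numeral_eq_Suc\<close>)
  then have ts: "recfn 1 (\<lambda>xs. rec_nat (pfst (psnd (psnd (psnd (psnd (xs ! 0)))))) (encode_link (L (xs ! 0))) (xs ! 0))"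
    by (simp add: numeral_eq_Suc)
  have "recfn 1 (\<lambda>xs. rec_nat (pfst (psnd (psnd (psnd (xs ! 0)))))
      (\<lambda>i r. (\<lambda>ys. Suc (prod_encode (2 * Suc (ys ! 0) + 8, ys ! 1))) (i # r # xs)) (xs ! 0))"
    by (intro recfn_prim r) auto
  then have qs: "recfn 1 (\<lambda>xs. rec_nat (pfst (psnd (psnd (psnd (xs ! 0)))))
      (\<lambda>i r. Suc (prod_encode (2 * Suc i + 8, r))) (xs ! 0))"
    by simp
  show ?thesis unfolding self_pair_def Let_def by (intro r qs ts[unfolded L_def]) auto
qed

lemma diagonal:
  fixes D :: recf and m :: mode and g :: bool
  obtains N n \<delta> k t0 t1 where "queue N n \<delta>"
    "\<And>b. \<delta> t0 b = ([b], t0)" "\<And>b. \<delta> t1 b = (if g then [b, b] else [], t1)"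
    "\<And>s. g \<Longrightarrow> s < n \<Longrightarrow> N - 1 \<in> set (fst (\<delta> s (N - 1)))"
    "\<And>v. rec_eval D [encode_pair (queue.sim_pair N \<delta> k m)] v \<Longrightarrow>
      \<exists>W. W \<noteq> [] \<and> (qstep \<delta>)\<^sup>*\<^sup>* (0, replicate (Suc k) 0 @ [N - 1]) (if v = 0 then t0 else t1, W)"
proof -
  \<comment> \<open>The queue starts with \<open>Suc k\<close> letters 0, one of them sent from
    state 7; hence the predecessor.\<close>
  have "recfn 1 (\<lambda>xs. self_pair (xs ! 0 - Suc 0))"
    by (rule recfn_comp1[OF recfn_self_pair]) (intro recfn_pred recfn_nth; simp)
  then obtain G where G: "\<And>xs. length xs = 1 \<Longrightarrow> rec_eval G xs (self_pair (xs ! 0 - Suc 0))"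
    unfolding recfn_def by blast
  have h: "rec_eval (Cnf D [G]) [Suc c] v" if "rec_eval D [self_pair c] v" for c v
    using that G[of "[Suc c]"] by (intro rec_eval.comp[where ys = "[self_pair c]"]) auto
  obtain N n \<delta> t0 t1 where t: "2 \<le> N" "0 < n" "transducer N n \<delta>"
    "\<And>b. \<delta> t0 b = ([b], t0)" "\<And>b. \<delta> t1 b = (if g then [b, b] else [], t1)"
    "\<And>s. g \<Longrightarrow> s < n \<Longrightarrow> N - 1 \<in> set (fst (\<delta> s (N - 1)))"
    "\<And>k v. rec_eval (Cnf D [G]) [k] v \<Longrightarrow>
      \<exists>W. W \<noteq> [] \<and> (qstep \<delta>)\<^sup>*\<^sup>* (0, replicate k 0 @ [N - 1]) (if v = 0 then t0 else t1, W)"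
    using recf_to_transducer[of g "Cnf D [G]"] by metis
  have q: "queue N n \<delta>" using t by unfold_locales
  \<comment> \<open>The transducer was built before \<open>k\<close> is chosen; only the length of
    the chain was still open.\<close>
  define k where "k = queue.self_code N \<delta> m"
  have "encode_pair (queue.sim_pair N \<delta> k m) = self_pair k"
    using queue.self_pair_self_code[OF q] k_def by simp
  then show thesis using that[OF q t(4-6), of k] t(7) h by metis
qed

text \<open>Valid along every run, whether or not the simulated computation halts. It supplies the
  deadlock-freedom promised in (b).\<close>

lemma marker_nonempty:
  assumes "queue N n \<delta>" "\<And>s. s < n \<Longrightarrow> N - 1 \<in> set (fst (\<delta> s (N - 1)))"
    "(qstep \<delta>)\<^sup>*\<^sup>* (0, replicate (Suc k) 0 @ [N - 1]) c"
  shows "N - 1 \<in> set (snd c)"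
proof -
  interpret queue N n \<delta> k by (rule assms)
  \<comment> \<open>This imports \<open>qreach_letters\<close>, which keeps the transducer state
    below \<open>n\<close>.\<close>
  interpret sim N n \<delta> k Reset "sim_pair Reset" by (rule sim_sim_pair)
  show ?thesis using assms(3)
  proof (induction rule: rtranclp_induct)
    case (step c d)
    then have "fst c < n" using qreach_letters S_lt by blast
    then show ?case using step.IH step(2) assms(2) by (fastforce elim!: qstep.cases)
  qed simp
qed

theorem theorem7p1:
  shows "\<not> decidable_on encode_pair
            (\<lambda>P. SR_pair P \<and> \<not> has_send_cycle (F0 P) \<and> \<not> has_send_cycle (F1 P))
            deadlock_free
       \<and> \<not> decidable_on encode_pair
            (\<lambda>P. SR_pair P \<and> deadlock_free P \<and> \<not> has_send_cycle (F0 P) \<and> \<not> has_send_cycle (F1 P))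
            bounded_channel
       \<and> \<not> decidable_on encode_pair (\<lambda>P. SR_pair P \<and> affine P) deadlock_free
       \<and> \<not> decidable_on encode_pair (\<lambda>P. SR_pair P \<and> affine P) bounded_channel"
proof -
  \<comment> \<open>Covers (a) with \<open>Reset\<close> and (c) with \<open>Flush\<close>: the mode
    decides which promise the assumption on \<open>D\<close> asks for.\<close>
  have deadlock: False
    if m: "m = Reset \<or> m = Flush"
      and D: "\<And>P. SR_pair P \<Longrightarrow> (m = Reset \<Longrightarrow> \<not> has_send_cycle (F0 P) \<and> \<not> has_send_cycle (F1 P)) \<Longrightarrow>
        (m \<noteq> Reset \<Longrightarrow> affine P) \<Longrightarrow> rec_eval D [encode_pair P] (if deadlock_free P then 1 else 0)"
    for m D
  proof (rule diagonal[where D = D and m = m and g = False])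
    fix N n \<delta> k t0 t1
    assume q: "queue N n \<delta>" and echo: "\<And>b. \<delta> t0 b = ([b], t0)"
      and last: "\<And>b. \<delta> t1 b = (if False then [b, b] else [], t1)"
      and run: "\<And>v. rec_eval D [encode_pair (queue.sim_pair N \<delta> k m)] v \<Longrightarrow>
        \<exists>W. W \<noteq> [] \<and> (qstep \<delta>)\<^sup>*\<^sup>* (0, replicate (Suc k) 0 @ [N - 1]) (if v = 0 then t0 else t1, W)"
    interpret queue N n \<delta> k by (rule q)
    interpret sim N n \<delta> k m "sim_pair m" by (rule sim_sim_pair)
    have "rec_eval D [encode_pair (sim_pair m)] (if deadlock_free (sim_pair m) then 1 else 0)"
      using SR_pair_sim no_send_cycle_sim affine_sim by (intro D) auto
    from run[OF this] obtain W where W: "W \<noteq> []" "qreach (if deadlock_free (sim_pair m) then t1 else t0, W)"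
      by (auto split: if_splits)
    show False
    proof (cases "deadlock_free (sim_pair m)")
      case True
      moreover have "(qstep \<delta>)\<^sup>*\<^sup>* (t1, W) (t1, [])" using last by (intro qsteps_drain) simp
      ultimately have "qreach (t1, [])" using W(2) rtranclp_trans[of "qstep \<delta>" _ "(t1, W)"] by simp
      then show False using qreach_deadlock True by blast
    next
      case False
      then have "qreach (t0, W)" using W(2) by simp
      from qsteps_echo[OF this echo W(1)] have "\<not> qreach (s, [])" for s by fastforce
      then show False using reset_deadlock_free flush_deadlock_free m False by blast
    qed
  qed
  have bounded: False
    if m: "m = Reset \<or> m = Block"
      and D: "\<And>P. SR_pair P \<Longrightarrow>
        (m = Reset \<Longrightarrow> deadlock_free P \<and> \<not> has_send_cycle (F0 P) \<and> \<not> has_send_cycle (F1 P)) \<Longrightarrow>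
        (m \<noteq> Reset \<Longrightarrow> affine P) \<Longrightarrow> rec_eval D [encode_pair P] (if bounded_channel P then 1 else 0)"
    for m D
  proof (rule diagonal[where D = D and m = m and g = True])
    fix N n \<delta> k t0 t1
    assume q: "queue N n \<delta>" and echo: "\<And>b. \<delta> t0 b = ([b], t0)"
      and last: "\<And>b. \<delta> t1 b = (if True then [b, b] else [], t1)"
      and marker: "\<And>s. True \<Longrightarrow> s < n \<Longrightarrow> N - 1 \<in> set (fst (\<delta> s (N - 1)))"
      and run: "\<And>v. rec_eval D [encode_pair (queue.sim_pair N \<delta> k m)] v \<Longrightarrow>
        \<exists>W. W \<noteq> [] \<and> (qstep \<delta>)\<^sup>*\<^sup>* (0, replicate (Suc k) 0 @ [N - 1]) (if v = 0 then t0 else t1, W)"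
    interpret queue N n \<delta> k by (rule q)
    interpret sim N n \<delta> k m "sim_pair m" by (rule sim_sim_pair)
    have "\<not> qreach (s, [])" for s
      using marker_nonempty[OF q marker, of k "(s, [])"] by auto
    \<comment> \<open>The promise of (b), to be secured before anything is known about the answer of
      \<open>D\<close>.\<close>
    then have "deadlock_free (sim_pair m)" if "m = Reset" using reset_deadlock_free that by blast
    then have "rec_eval D [encode_pair (sim_pair m)] (if bounded_channel (sim_pair m) then 1 else 0)"
      using SR_pair_sim no_send_cycle_sim affine_sim by (intro D) auto
    from run[OF this] obtain W where W: "W \<noteq> []" "qreach (if bounded_channel (sim_pair m) then t1 else t0, W)"
      by (auto split: if_splits)
    show False
    proof (cases "bounded_channel (sim_pair m)")
      case True
      then obtain B where B: "\<And>s W. qreach (s, W) \<Longrightarrow> length W \<le> B" using qreach_unbounded by blast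
      have "qreach (t1, W)" using W(2) True by simp
      moreover obtain W' where "Suc B \<le> length W'" "(qstep \<delta>)\<^sup>*\<^sup>* (t1, W) (t1, W')"
        using qsteps_grow[of \<delta> t1 W "Suc B"] last W(1) by auto
      ultimately show False using B[of t1 W'] by (auto dest: rtranclp_trans)
    next
      case False
      then have "qreach (t0, W)" using W(2) by simp
      from qsteps_echo[OF this echo W(1)] obtain B where "\<forall>d. qreach d \<longrightarrow> snd d \<noteq> [] \<and> length (snd d) \<le> B"
        by blast
      then have "length W \<le> B" if "qreach (s, W)" for s W using that by fastforce
      then show False using reset_bounded block_bounded m False by blast
    qed
  qed
  show ?thesis unfolding decidable_on_def
  proof ((intro conjI notI; elim exE), goal_cases)
    case (1 D)
    then show ?case by - (rule deadlock[of Reset D]; blast)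
  next
    case (2 D)
    then show ?case by - (rule bounded[of Reset D]; blast)
  next
    case (3 D)
    then show ?case by - (rule deadlock[of Flush D]; use mode.distinct in blast)
  next
    case (4 D)
    then show ?case by - (rule bounded[of Block D]; use mode.distinct in blast)
  qed
qed

end
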